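(* Let $\beta\in(0,1)$ and $\nu>0$, let $\{\lambda(t)\}_{t\ge 0}$ be the intensity of a Hawkes process with parameters $\theta\ge0$, $\eta>0$, $\kappa>0$ and jump sizes of mean $\mu$ and variance $\psi^2$, and let $\{E^{\beta,\nu}_t\}_{t\ge0}$ be an independent inverse tempered $\beta$-stable subordinator. Suppose $\gamma=\kappa-\eta\mu>0$. Then for $0\le s\le t$, $$\begin{aligned}\mathbb{C}_0\bigl(\lambda(E^{\beta,\nu}_t),\lambda(E^{\beta,\nu}_s)\bigr)=\;&\frac{\rho_1\lambda_0+\rho_2}{\eta\mu-\kappa}\Bigl[\mathbb{E}_0\bigl[e^{-\gamma(E^{\beta,\nu}_t+E^{\beta,\nu}_s)}\bigr]-\Phi_\gamma(t)\Bigr]\\&+\frac{\rho_2}{2(\eta\mu-\kappa)}\Bigl[\mathbb{E}_0\bigl[e^{-\gamma(E^{\beta,\nu}_t-E^{\beta,\nu}_s)}\bigr]-\mathbb{E}_0\bigl[e^{-\gamma(E^{\beta,\nu}_t+E^{\beta,\nu}_s)}\bigr]\Bigr]\\&+\Bigl(\lambda_0+\frac{\kappa\theta}{\eta\mu-\kappa}\Bigr)^2\Bigl[\mathbb{E}_0\bigl[e^{-\gamma(E^{\beta,\nu}_t+E^{\beta,\nu}_s)}\bigr]-\Phi_\gamma(t)\Phi_\gamma(s)\Bigr].\end{aligned}$$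
   Context: Hawkes process: $\{(N_t,\lambda_t)\}_{t\ge0}$ (write $\lambda(t)=\lambda_t$), where $N_t$ is a counting process with stochastic intensity $\lambda_t$ satisfying $$\lambda_t=\theta+e^{-\kappa(t-s)}(\lambda_s-\theta)+\eta\int_s^t e^{-\kappa(t-u)}\,dP_u,\qquad t\ge s,$$ with $\theta\ge0$, $\eta>0$, $\kappa>0$ and $P_t=\sum_{i=1}^{N_t}\xi_i$, where $(\xi_i)$ are i.i.d. positive random variables with finite positive mean $\mu$ and finite variance $\psi^2$. $\mathbb{E}_0,\mathbb{C}_0$ denote expectation and covariance conditional on $\mathcal{F}_0$, the initial information of the Hawkes process (so $\lambda_0$ is treated as known). Inverse tempered stable subordinator: the tempered $\beta$-stable subordinator $\{D^{\beta,\nu}_t\}_{t\ge0}$ is the subordinator with $\mathbb{E}[e^{-sD^{\beta,\nu}_t}]=e^{-t((s+\nu)^\beta-\nu^\beta)}$, and $E^{\beta,\nu}_t=\inf\{r\ge0: D^{\beta,\nu}_r>t\}$. It is independent of the Hawkes process. Notation: $\Phi_\gamma(t)=\mathbb{E}[e^{-\gamma E^{\beta,\nu}_t}]$, $\rho_1=\eta^2(\psi^2+\mu^2)$ and $\rho_2=\dfrac{\eta^2\kappa\theta(\psi^2+\mu^2)}{\eta\mu-\kappa}$.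
   Formalization: Besides being i.i.d., each jump size is assumed independent of the history strictly before its jump (initial information included), as is usual for marked Hawkes processes; if a jump size may depend on its own jump time, the formula is false. *)

theory Defs
  imports "HOL-Probability.Probability"
begin

definition process_sigma :: "'a measure \<Rightarrow> (real \<Rightarrow> 'a \<Rightarrow> 'b) \<Rightarrow> 'b measure \<Rightarrow> 'a measure" where
  "process_sigma M X S =
     sigma (space M) (\<Union>t\<in>{0..}. sets (vimage_algebra (space M) (X t) S))"

definition cond_cov :: "'a measure \<Rightarrow> 'a measure \<Rightarrow> ('a \<Rightarrow> real) \<Rightarrow> ('a \<Rightarrow> real) \<Rightarrow> 'a \<Rightarrow> real" where
  "cond_cov M G X Y =
     real_cond_exp M G (\<lambda>\<omega>. (X \<omega> - real_cond_exp M G X \<omega>) * (Y \<omega> - real_cond_exp M G Y \<omega>))"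

text \<open>Processes are indexed by \<open>real\<close>, but only their values at times \<open>\<ge> 0\<close> are constrained
  or used.\<close>

definition filtration_on :: "'a measure \<Rightarrow> (real \<Rightarrow> 'a measure) \<Rightarrow> bool" where
  "filtration_on M F \<longleftrightarrow>
     (\<forall>t\<ge>0. subalgebra M (F t)) \<and> (\<forall>s t. 0 \<le> s \<longrightarrow> s \<le> t \<longrightarrow> subalgebra (F t) (F s))"

text \<open>The last condition says that all jumps have size one.\<close>

definition counting_process :: "'a measure \<Rightarrow> (real \<Rightarrow> 'a measure) \<Rightarrow> (real \<Rightarrow> 'a \<Rightarrow> nat) \<Rightarrow> bool" where
  "counting_process M F N \<longleftrightarrow>
     (\<forall>t\<ge>0. N t \<in> measurable (F t) (count_space UNIV)) \<and>
     (\<forall>\<omega>\<in>space M.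
        N 0 \<omega> = 0 \<and>
        mono_on {0..} (\<lambda>t. N t \<omega>) \<and>
        (\<forall>t\<ge>0. continuous (at_right t) (\<lambda>u. real (N u \<omega>))) \<and>
        (\<forall>t>0. \<forall>\<^sub>F u in at_left t. N t \<omega> \<le> N u \<omega> + 1))"

definition predictable_sigma :: "'a measure \<Rightarrow> (real \<Rightarrow> 'a measure) \<Rightarrow> (real \<times> 'a) measure" where
  "predictable_sigma M F =
     sigma ({0<..} \<times> space M) {{s<..t} \<times> A | s t A. 0 \<le> s \<and> s \<le> t \<and> A \<in> sets (F s)}"

text \<open>The Stieltjes measure \<open>dG\<close> on \<open>(0,\<infinity>)\<close> of a nondecreasing right-continuous function on
  \<open>[0,\<infinity>)\<close>, which is extended to the left by the constant \<open>G 0\<close>.\<close>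

definition stieltjes :: "(real \<Rightarrow> real) \<Rightarrow> real measure" where
  "stieltjes G = interval_measure (\<lambda>u. G (max 0 u))"

text \<open>The \<open>F\<close>-intensity of a point process in the sense of Bremaud: a nonnegative, progressively
  measurable, locally integrable process for which
  \<open>E[\<integral> C\<^sub>u dN\<^sub>u] = E[\<integral> C\<^sub>u lam\<^sub>u du]\<close> for all nonnegative predictable \<open>C\<close>.\<close>

definition stochastic_intensity ::
    "'a measure \<Rightarrow> (real \<Rightarrow> 'a measure) \<Rightarrow> (real \<Rightarrow> 'a \<Rightarrow> nat) \<Rightarrow> (real \<Rightarrow> 'a \<Rightarrow> real) \<Rightarrow> bool" where
  "stochastic_intensity M F N lam \<longleftrightarrow>
     (\<forall>t\<ge>0. \<forall>\<omega>\<in>space M. 0 \<le> lam t \<omega>) \<and>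
     (\<forall>t\<ge>0. (\<lambda>(u, \<omega>). lam u \<omega>)
        \<in> borel_measurable (restrict_space borel {0..t} \<Otimes>\<^sub>M F t)) \<and>
     (AE \<omega> in M. \<forall>t\<ge>0. (\<integral>\<^sup>+u\<in>{0..t}. ennreal (lam u \<omega>) \<partial>lborel) < \<infinity>) \<and>
     (\<forall>C :: real \<times> 'a \<Rightarrow> ennreal. C \<in> borel_measurable (predictable_sigma M F) \<longrightarrow>
        (\<integral>\<^sup>+\<omega>. (\<integral>\<^sup>+u\<in>{0<..}. C (u, \<omega>) \<partial>stieltjes (\<lambda>u. real (N u \<omega>))) \<partial>M) =
        (\<integral>\<^sup>+\<omega>. (\<integral>\<^sup>+u\<in>{0<..}. C (u, \<omega>) * ennreal (lam u \<omega>) \<partial>lborel) \<partial>M))"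

text \<open>The strict past \<open>F\<^bsub>T-\<^esub>\<close> of the \<open>i\<close>-th jump time \<open>T = inf {t. N\<^sub>t \<ge> i}\<close>, generated by \<open>F\<^sub>0\<close> and
  the events \<open>A \<inter> {t < T}\<close> with \<open>A \<in> F\<^sub>t\<close>; note that \<open>{t < T} = {N\<^sub>t < i}\<close>.\<close>

definition strict_past :: "'a measure \<Rightarrow> (real \<Rightarrow> 'a measure) \<Rightarrow> (real \<Rightarrow> 'a \<Rightarrow> nat) \<Rightarrow> nat \<Rightarrow> 'a measure" where
  "strict_past M F N i =
     sigma (space M)
       (sets (F 0) \<union> {A \<inter> {\<omega>\<in>space M. N t \<omega> < i} | A t. 0 \<le> t \<and> A \<in> sets (F t)})"

definition jump_sum :: "(real \<Rightarrow> 'a \<Rightarrow> nat) \<Rightarrow> (nat \<Rightarrow> 'a \<Rightarrow> real) \<Rightarrow> real \<Rightarrow> 'a \<Rightarrow> real" where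
  "jump_sum N xi t \<omega> = (\<Sum>i=1..N t \<omega>. xi i \<omega>)"

text \<open>Assumption \<open>mark_unpredictable\<close> is the usual requirement on an i.i.d.-marked point process:
  a mark is independent of everything that happened strictly before its jump (including the
  initial information). It does not follow from the marks being i.i.d.: a mark could, for example,
  be a function of its own jump time.\<close>

locale hawkes_process = prob_space M
  for M :: "'a measure" +
  fixes F :: "real \<Rightarrow> 'a measure"
    and N :: "real \<Rightarrow> 'a \<Rightarrow> nat"
    and lam :: "real \<Rightarrow> 'a \<Rightarrow> real"
    and xi :: "nat \<Rightarrow> 'a \<Rightarrow> real"
    and \<theta> \<eta> \<kappa> \<mu> \<psi> :: real
  assumes theta_nonneg: "0 \<le> \<theta>"
    and eta_pos: "0 < \<eta>"
    and kappa_pos: "0 < \<kappa>"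
    and filtration: "filtration_on M F"
    and counting: "counting_process M F N"
    and intensity: "stochastic_intensity M F N lam"
    and marks_indep: "indep_vars (\<lambda>_. borel) xi {1..}"
    and marks_ident: "\<And>i. 1 \<le> i \<Longrightarrow> distr M borel (xi i) = distr M borel (xi 1)"
    and marks_pos: "\<And>i \<omega>. 1 \<le> i \<Longrightarrow> \<omega> \<in> space M \<Longrightarrow> 0 < xi i \<omega>"
    and marks_square_integrable: "\<And>i. 1 \<le> i \<Longrightarrow> integrable M (\<lambda>\<omega>. (xi i \<omega>)\<^sup>2)"
    and marks_mean: "\<And>i. 1 \<le> i \<Longrightarrow> expectation (xi i) = \<mu>"
    and marks_variance: "\<And>i. 1 \<le> i \<Longrightarrow> variance (xi i) = \<psi>\<^sup>2"
    and mark_unpredictable: "\<And>i. 1 \<le> i \<Longrightarrow>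
      indep_set (sets (vimage_algebra (space M) (xi i) borel)) (sets (strict_past M F N i))"
    and intensity_eq: "\<And>s t \<omega>. 0 \<le> s \<Longrightarrow> s \<le> t \<Longrightarrow> \<omega> \<in> space M \<Longrightarrow>
      lam t \<omega> = \<theta> + exp (- \<kappa> * (t - s)) * (lam s \<omega> - \<theta>)
        + \<eta> * (LINT u:{s<..t}|stieltjes (\<lambda>v. jump_sum N xi v \<omega>). exp (- \<kappa> * (t - u)))"

text \<open>The information carried by a Hawkes process: \<open>F\<^sub>0\<close> and all \<open>N\<^sub>t\<close> and \<open>lam\<^sub>t\<close>.\<close>

definition hawkes_sigma ::
    "'a measure \<Rightarrow> (real \<Rightarrow> 'a measure) \<Rightarrow> (real \<Rightarrow> 'a \<Rightarrow> nat) \<Rightarrow> (real \<Rightarrow> 'a \<Rightarrow> real) \<Rightarrow> 'a measure" where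
  "hawkes_sigma M F N lam =
     sigma (space M)
       (sets (F 0) \<union> sets (process_sigma M N (count_space UNIV)) \<union> sets (process_sigma M lam borel))"

locale subordinator = prob_space M
  for M :: "'a measure" +
  fixes D :: "real \<Rightarrow> 'a \<Rightarrow> real"
  assumes random_variable: "\<And>t. 0 \<le> t \<Longrightarrow> D t \<in> borel_measurable M"
    and start: "\<And>\<omega>. \<omega> \<in> space M \<Longrightarrow> D 0 \<omega> = 0"
    and paths_mono: "\<And>\<omega>. \<omega> \<in> space M \<Longrightarrow> mono_on {0..} (\<lambda>t. D t \<omega>)"
    and paths_right_cont: "\<And>\<omega> t. \<omega> \<in> space M \<Longrightarrow> 0 \<le> t \<Longrightarrow> continuous (at_right t) (\<lambda>u. D u \<omega>)"
    and indep_increments: "\<And>(\<tau> :: nat \<Rightarrow> real) n. 0 \<le> \<tau> 0 \<Longrightarrow> (\<And>i. i < n \<Longrightarrow> \<tau> i \<le> \<tau> (Suc i)) \<Longrightarrow>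
      indep_vars (\<lambda>_. borel) (\<lambda>i \<omega>. D (\<tau> (Suc i)) \<omega> - D (\<tau> i) \<omega>) {..<n}"
    and stationary_increments: "\<And>s t. 0 \<le> s \<Longrightarrow> s \<le> t \<Longrightarrow>
      distr M borel (\<lambda>\<omega>. D t \<omega> - D s \<omega>) = distr M borel (D (t - s))"

locale tempered_stable_subordinator = subordinator M D
  for M :: "'a measure" and D :: "real \<Rightarrow> 'a \<Rightarrow> real" +
  fixes \<beta> \<nu> :: real
  assumes beta_range: "0 < \<beta>" "\<beta> < 1"
    and nu_pos: "0 < \<nu>"
    and laplace_transform: "\<And>s t. 0 \<le> s \<Longrightarrow> 0 \<le> t \<Longrightarrow>
      expectation (\<lambda>\<omega>. exp (- s * D t \<omega>)) = exp (- t * ((s + \<nu>) powr \<beta> - \<nu> powr \<beta>))"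

text \<open>Where the path \<open>D\<close> never exceeds \<open>t\<close> (an event of probability zero for tempered stable
  subordinators) the infimum is over the empty set, and we use the value \<open>0\<close>.\<close>

definition inverse_subordinator :: "(real \<Rightarrow> 'a \<Rightarrow> real) \<Rightarrow> real \<Rightarrow> 'a \<Rightarrow> real" where
  "inverse_subordinator D t \<omega> =
     (if \<exists>r\<ge>0. t < D r \<omega> then Inf {r. 0 \<le> r \<and> t < D r \<omega>} else 0)"

definition laplace_of :: "'a measure \<Rightarrow> (real \<Rightarrow> 'a \<Rightarrow> real) \<Rightarrow> real \<Rightarrow> real \<Rightarrow> real" where
  "laplace_of M E \<gamma> t = (LINT \<omega>|M. exp (- \<gamma> * E t \<omega>))"

end

theory Submission
  imports Defs
begin

text \<open>
  Why the formula holds. The Markovian form of the intensity makes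
  \<open>exp (\<kappa> t) (lam\<^sub>t - \<theta>)\<close> a pure jump process: it moves only at the jump times \<open>T\<^sub>i\<close>, by
  \<open>\<eta> \<xi>\<^sub>i exp (\<kappa> T\<^sub>i)\<close> (\<open>lam_eq\<close>). Every moment of \<open>lam\<close> can therefore be read off from finite sums
  over jumps, and such sums are averaged by one compensation rule (\<open>marked_compensator\<close>): the
  defining property of the intensity turns a sum over jumps into a time integral against \<open>lam\<close>,
  and a mark, being independent of the strict past of its jump, contributes only its moment.

  Testing against \<open>F\<^sub>0\<close>-measurable weights \<open>G\<close> instead of conditioning, the rule yields linear
  Volterra equations for \<open>E[G lam\<^sub>t]\<close> and \<open>E[G lam\<^sub>t\<^sup>2]\<close>. They are solved explicitly
  (\<open>first_moment_formula\<close>, \<open>second_moment_formula\<close>), with relaxation rate \<open>\<gamma> = \<kappa> - \<eta> \<mu>\<close>.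
  Using an \<open>F\<^sub>s\<close>-measurable weight containing \<open>lam\<^sub>s\<close> in the first-moment equation gives the mixed
  moment \<open>E[G lam\<^sub>s lam\<^sub>t]\<close> (\<open>joint_moment_formula\<close>).

  Two finiteness questions have to be settled before an equation can be solved. A stochastic
  intensity is only locally integrable along paths, so nothing bounds the moments a priori; they
  are first truncated predictably and then controlled by a Gronwall argument
  (\<open>V_moment_finite\<close>). And \<open>lam\<^sub>0\<close> need not be integrable, so that the conditional expectations
  given \<open>F\<^sub>0\<close> exist only locally; they are identified on the sets \<open>{lam\<^sub>0 \<le> k}\<close>, which lie in
  \<open>F\<^sub>0\<close> and exhaust the space (\<open>real_cond_exp_charact_local\<close>).

  Finally the clock is independent of the whole Hawkes process, so \<open>E[G lam(E\<^sub>s) lam(E\<^sub>t)]\<close> is the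
  deterministic-time moment averaged over the law of \<open>(E\<^sub>s, E\<^sub>t)\<close>
  (\<open>time_change_expectation\<close>). This uses \<open>E\<^sub>s \<le> E\<^sub>t\<close>, which is almost surely true because a tempered
  stable subordinator tends to infinity (\<open>unbounded_AE\<close>). The averaged exponentials are the
  Laplace transforms in the statement, and they remain constants after conditioning on \<open>F\<^sub>0\<close>. The
  first two summands are the expected covariance given the clock, split into a part affine in
  \<open>lam\<^sub>0\<close> and a constant part; the third is the covariance of the conditional means.
\<close>

section \<open>Paths with unit jumps\<close>

definition reached :: "(real \<Rightarrow> nat) \<Rightarrow> nat \<Rightarrow> bool" where
  "reached n i \<longleftrightarrow> 1 \<le> i \<and> (\<exists>t\<ge>0. i \<le> n t)"

text \<open>On paths with fewer than \<open>i\<close> jumps the infimum is over the empty set; the value is meaningful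
  only together with \<open>reached n i\<close>.\<close>

definition jump_time :: "(real \<Rightarrow> nat) \<Rightarrow> nat \<Rightarrow> real" where
  "jump_time n i = Inf {t. 0 \<le> t \<and> i \<le> n t}"

locale unit_jump_path =
  fixes n :: "real \<Rightarrow> nat"
  assumes start: "n 0 = 0"
    and mono: "mono_on {0..} n"
    and right_cont: "0 \<le> t \<Longrightarrow> continuous (at_right t) (\<lambda>u. real (n u))"
    and unit_jumps: "0 < t \<Longrightarrow> \<forall>\<^sub>F u in at_left t. n t \<le> n u + 1"
begin

lemma n_mono: "0 \<le> s \<Longrightarrow> s \<le> t \<Longrightarrow> n s \<le> n t"
  using mono by (auto simp: mono_on_def)

lemma eventually_const_right:
  assumes "0 \<le> t" shows "\<forall>\<^sub>F u in at_right t. n u = n t"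
proof -
  have "((\<lambda>u. real (n u)) \<longlongrightarrow> real (n t)) (at_right t)"
    using right_cont[OF assms] by (simp add: continuous_within)
  then have "\<forall>\<^sub>F u in at_right t. dist (real (n u)) (real (n t)) < 1"
    by (rule tendstoD) simp
  then show ?thesis
    by eventually_elim (auto simp: dist_real_def)
qed

lemma jump_time_nonneg: "reached n i \<Longrightarrow> 0 \<le> jump_time n i"
  unfolding jump_time_def reached_def by (rule cInf_greatest) auto

lemma jump_time_attained:
  assumes "reached n i" shows "i \<le> n (jump_time n i)"
proof -
  let ?S = "{t. 0 \<le> t \<and> i \<le> n t}" and ?T = "jump_time n i"
  have ne: "?S \<noteq> {}" and bd: "bdd_below ?S"
    using assms by (auto simp: reached_def bdd_below_def)
  have T0: "0 \<le> ?T" by (rule jump_time_nonneg[OF assms])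
  obtain d where d: "?T < d" "\<And>u. ?T < u \<Longrightarrow> u < d \<Longrightarrow> n u = n ?T"
    using eventually_const_right[OF T0] unfolding eventually_at_right_field by blast
  obtain u where u: "u \<in> ?S" "u < d"
    using cInf_lessD[OF ne] d(1) unfolding jump_time_def by blast
  have "?T \<le> u" unfolding jump_time_def by (rule cInf_lower[OF u(1) bd])
  then show ?thesis using u d(2)[of u] by (cases "u = ?T") auto
qed

lemma jump_time_le_iff:
  assumes "reached n i" "0 \<le> r" shows "jump_time n i \<le> r \<longleftrightarrow> i \<le> n r"
proof
  assume "jump_time n i \<le> r"
  then show "i \<le> n r"
    using jump_time_attained[OF assms(1)] n_mono[OF jump_time_nonneg[OF assms(1)]] by force
next
  assume "i \<le> n r"
  then show "jump_time n i \<le> r" unfolding jump_time_def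
    using assms(2) by (intro cInf_lower) (auto simp: bdd_below_def)
qed

lemma reachedI: "1 \<le> i \<Longrightarrow> i \<le> n t \<Longrightarrow> 0 \<le> t \<Longrightarrow> reached n i"
  unfolding reached_def by blast

lemma jump_time_pos:
  assumes "reached n i" shows "0 < jump_time n i"
  using jump_time_le_iff[OF assms, of 0] assms by (auto simp: start reached_def)

text \<open>Since a jump has size one, the count just before the \<open>i\<close>-th jump is exactly \<open>i - 1\<close>; without
  this, left limits at a jump time would not enumerate the jumps.\<close>

lemma just_before_jump:
  assumes "reached n i"
  shows "\<exists>q0\<ge>0. q0 < jump_time n i \<and> (\<forall>q. q0 \<le> q \<and> q < jump_time n i \<longrightarrow> n q = i - 1)"
proof -
  let ?T = "jump_time n i"
  have T: "0 < ?T" by (rule jump_time_pos[OF assms])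
  obtain b where b: "b < ?T" "\<And>u. b < u \<Longrightarrow> u < ?T \<Longrightarrow> n ?T \<le> n u + 1"
    using unit_jumps[OF T] unfolding eventually_at_left_field by blast
  \<comment> \<open>midpoint of the left neighbourhood on which the jump bound holds, cut off at time zero\<close>
  define q0 where "q0 = (max 0 b + ?T) / 2"
  have q0: "0 \<le> q0" "q0 < ?T" "b < q0" using T b(1) by (auto simp: q0_def max_def field_simps)
  have "n q = i - 1" if "q0 \<le> q" "q < ?T" for q
    using b(2)[of q] that q0 jump_time_attained[OF assms] jump_time_le_iff[OF assms, of q] by force
  then show ?thesis using q0 by blast
qed

lemma jumps_in_Ioc:
  assumes "a \<le> b"
  shows "{i. reached n i \<and> jump_time n i \<in> {a<..b}} = {n (max 0 a)<..n (max 0 b)}"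
proof (intro set_eqI iffI; clarsimp)
  fix i assume i: "reached n i" "a < jump_time n i" "jump_time n i \<le> b"
  then show "n (max 0 a) < i \<and> i \<le> n (max 0 b)"
    using jump_time_le_iff[OF i(1), of "max 0 a"] jump_time_le_iff[OF i(1), of "max 0 b"]
      jump_time_pos[OF i(1)] by auto
next
  fix i assume i: "n (max 0 a) < i" "i \<le> n (max 0 b)"
  then have r: "reached n i" by (intro reachedI[of i "max 0 b"]) auto
  have "\<not> jump_time n i \<le> max 0 a" "jump_time n i \<le> max 0 b"
    using i jump_time_le_iff[OF r, of "max 0 a"] jump_time_le_iff[OF r, of "max 0 b"] by auto
  then show "reached n i \<and> a < jump_time n i \<and> jump_time n i \<le> b"
    using r jump_time_pos[OF r] by (auto simp: max_def split: if_splits)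
qed

lemma jumps_in_Ioc_nonneg:
  assumes "0 \<le> a" "a \<le> b"
  shows "{i. reached n i \<and> jump_time n i \<in> {a<..b}} = {n a<..n b}"
  using jumps_in_Ioc[OF assms(2)] assms by (simp add: max_absorb2)

text \<open>The right-hand side is the point measure with mass \<open>w i\<close> at the \<open>i\<close>-th jump time, written as an
  image of a weighted counting measure so that integrals against it become sums. Both sides give a
  half-open interval the weights of the jumps in it.\<close>

lemma stieltjes_jump_sum_eq:
  assumes w: "\<And>i. 1 \<le> i \<Longrightarrow> 0 \<le> w i"
  shows "stieltjes (\<lambda>u. \<Sum>i=1..n u. w i) =
    distr (density (count_space {i. reached n i}) (\<lambda>i. ennreal (w i))) borel (jump_time n)"
    (is "_ = ?R")
proof -
  define G where "G u = (\<Sum>i=1..n (max 0 u). w i)" for u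
  have mono_G: "G x \<le> G y" if "x \<le> y" for x y
    unfolding G_def using that n_mono[of "max 0 x" "max 0 y"]
    by (intro sum_mono2) (auto intro: w)
  have cont_G: "continuous (at_right a) G" for a
  proof (cases "0 \<le> a")
    case True
    have "\<forall>\<^sub>F u in at_right a. G u = G a"
      using eventually_const_right[OF True] eventually_at_right_less[of a]
      by eventually_elim (use True in \<open>auto simp: G_def\<close>)
    then show ?thesis unfolding continuous_within by (rule tendsto_eventually)
  next
    case False
    then have "\<forall>\<^sub>F u in at_right a. u < 0"
      unfolding eventually_at_right_field by (auto intro!: exI[of _ 0])
    then have "\<forall>\<^sub>F u in at_right a. G u = G a"
      by eventually_elim (use False in \<open>auto simp: G_def\<close>)
    then show ?thesis unfolding continuous_within by (rule tendsto_eventually)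
  qed
  have L: "emeasure (interval_measure G) {a<..b} = ennreal (G b - G a)" if "a \<le> b" for a b
    using that mono_G cont_G by (rule emeasure_interval_measure_Ioc)
  have R: "emeasure ?R {a<..b} = ennreal (G b - G a)" if "a \<le> b" for a b
  proof -
    let ?J = "{i. reached n i}" and ?A = "{n (max 0 a)<..n (max 0 b)}"
    have sub: "?A = {i\<in>?J. jump_time n i \<in> {a<..b}}" using jumps_in_Ioc[OF that] by simp
    then have subJ: "?A \<subseteq> ?J" by blast
    have "emeasure ?R {a<..b} = emeasure (density (count_space ?J) (\<lambda>i. ennreal (w i))) ?A"
      unfolding sub by (subst emeasure_distr) (auto intro!: arg_cong[where f="emeasure _"])
    also have "\<dots> = (\<integral>\<^sup>+i. ennreal (w i) * indicator ?A i \<partial>count_space ?J)"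
      using subJ by (subst emeasure_density) auto
    also have "\<dots> = (\<Sum>i\<in>?A. ennreal (w i))"
    proof -
      have "(\<integral>\<^sup>+i. ennreal (w i) * indicator ?A i \<partial>count_space ?J) =
        (\<Sum>i\<in>?A. ennreal (w i) * indicator ?A i)"
        using subJ by (intro nn_integral_count_space') auto
      then show ?thesis by simp
    qed
    also have "\<dots> = ennreal (\<Sum>i\<in>?A. w i)" by (rule sum_ennreal) (auto intro: w)
    also have "(\<Sum>i\<in>?A. w i) = G b - G a"
    proof -
      have le: "n (max 0 a) \<le> n (max 0 b)" using that by (intro n_mono) auto
      then have "{1..n (max 0 b)} = {1..n (max 0 a)} \<union> ?A" by auto
      then have "G b = G a + (\<Sum>i\<in>?A. w i)" unfolding G_def
        by (subst sum.union_disjoint[symmetric]) auto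
      then show ?thesis by simp
    qed
    finally show ?thesis .
  qed
  have "interval_measure G = ?R"
  proof (rule measure_eqI_generator_eq[where \<Omega>=UNIV and E="range (\<lambda>(a, b). {a<..b::real})"
        and A="\<lambda>i. {- real i<..real i}"])
    show "Int_stable (range (\<lambda>(a, b). {a<..b::real}))"
      by (auto simp: Int_stable_def Int_greaterThanAtMost)
    show "emeasure (interval_measure G) X = emeasure ?R X" if "X \<in> range (\<lambda>(a, b). {a<..b})" for X
    proof -
      obtain a b where X: "X = {a<..b}" using \<open>X \<in> _\<close> by auto
      show ?thesis
      proof (cases "a \<le> b")
        case True then show ?thesis unfolding X L[OF True] R[OF True] by simp
      next
        case False then show ?thesis unfolding X by simp
      qed
    qed
    show "sets (interval_measure G) = sigma_sets UNIV (range (\<lambda>(a, b). {a<..b}))"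
      by (simp, subst borel_sigma_sets_Ioc) simp
    show "sets ?R = sigma_sets UNIV (range (\<lambda>(a, b). {a<..b}))"
      by (simp, subst borel_sigma_sets_Ioc) simp
    show "(\<Union>i. {- real i<..real i}) = UNIV"
    proof (intro UNIV_eq_I[THEN sym])
      fix x :: real
      obtain k :: nat where "\<bar>x\<bar> < real k" using reals_Archimedean2 by blast
      then show "x \<in> (\<Union>i. {- real i<..real i})" by (auto intro!: exI[of _ k])
    qed
    show "emeasure (interval_measure G) {- real i<..real i} \<noteq> \<infinity>" for i
      by (subst L) auto
  qed auto
  then show ?thesis unfolding stieltjes_def G_def .
qed

lemma nn_integral_stieltjes:
  assumes w: "\<And>i. 1 \<le> i \<Longrightarrow> 0 \<le> w i" and f[measurable]: "f \<in> borel_measurable borel"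
  shows "(\<integral>\<^sup>+u. f u \<partial>stieltjes (\<lambda>u. \<Sum>i=1..n u. w i)) =
    (\<Sum>i. if reached n i then f (jump_time n i) * ennreal (w i) else 0)"
proof -
  have "(\<integral>\<^sup>+u. f u \<partial>stieltjes (\<lambda>u. \<Sum>i=1..n u. w i)) =
      (\<integral>\<^sup>+i. ennreal (w i) * f (jump_time n i) \<partial>count_space {i. reached n i})"
    by (subst stieltjes_jump_sum_eq[of w, OF w], assumption, subst nn_integral_distr, simp, simp, subst nn_integral_density) auto
  also have "\<dots> = (\<integral>\<^sup>+i. ennreal (w i) * f (jump_time n i) * indicator {i. reached n i} i
      \<partial>count_space UNIV)"
    by (subst nn_integral_count_space_indicator) auto
  also have "\<dots> = (\<Sum>i. if reached n i then f (jump_time n i) * ennreal (w i) else 0)"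
    by (subst nn_integral_count_space_nat) (auto intro!: suminf_cong simp: mult.commute)
  finally show ?thesis .
qed

lemma set_lebesgue_integral_stieltjes:
  fixes f :: "real \<Rightarrow> real"
  assumes w: "\<And>i. 1 \<le> i \<Longrightarrow> 0 \<le> w i" and f[measurable]: "f \<in> borel_measurable borel"
    and st: "0 \<le> s" "s \<le> t"
  shows "(LINT u:{s<..t}|stieltjes (\<lambda>u. \<Sum>i=1..n u. w i). f u) =
    (\<Sum>i\<in>{n s<..n t}. w i * f (jump_time n i))"
proof -
  let ?J = "{i. reached n i}"
  have A: "{n s<..n t} = {i\<in>?J. jump_time n i \<in> {s<..t}}" using jumps_in_Ioc_nonneg[OF st] by simp
  have "(LINT u:{s<..t}|stieltjes (\<lambda>u. \<Sum>i=1..n u. w i). f u) =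
      (LINT i|density (count_space ?J) (\<lambda>i. ennreal (w i)). indicator {s<..t} (jump_time n i) *\<^sub>R f (jump_time n i))"
    unfolding set_lebesgue_integral_def
    by (subst stieltjes_jump_sum_eq[of w, OF w], assumption, subst integral_distr) auto
  also have "\<dots> = (LINT i|count_space ?J. w i *\<^sub>R indicator {s<..t} (jump_time n i) *\<^sub>R f (jump_time n i))"
    by (subst integral_density) (auto simp: AE_count_space reached_def intro!: w)
  also have "\<dots> = (\<Sum>i\<in>{n s<..n t}. w i *\<^sub>R indicator {s<..t} (jump_time n i) *\<^sub>R f (jump_time n i))"
    unfolding A by (subst lebesgue_integral_count_space_finite_support)
      (use A in \<open>auto intro!: sum.mono_neutral_left finite_subset[of _ "{n s<..n t}"] simp: indicator_def\<close>)
  also have "\<dots> = (\<Sum>i\<in>{n s<..n t}. w i * f (jump_time n i))"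
    unfolding A by (intro sum.cong) auto
  finally show ?thesis .
qed

end

section \<open>Freezing an independent variable\<close>

text \<open>Fubini for an independent pair whose second component is the identity, viewed as a map
  into the sub-\<open>\<sigma>\<close>-algebra \<open>G\<close>: the value of \<open>X\<close> may be frozen while the remaining randomness, seen
  through \<open>G\<close>, is averaged.\<close>

lemma (in prob_space) nn_integral_independent_freeze:
  assumes X[measurable]: "X \<in> measurable M S" and sub: "subalgebra M G"
    and ind: "indep_set (sets (vimage_algebra (space M) X S)) (sets G)"
    and f[measurable]: "f \<in> borel_measurable (S \<Otimes>\<^sub>M G)"
  shows "(\<integral>\<^sup>+w. f (X w, w) \<partial>M) = (\<integral>\<^sup>+x. \<integral>\<^sup>+w. f (x, w) \<partial>M \<partial>distr M S X)"
proof -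
  have sp: "space G = space M" and le: "sets G \<subseteq> sets M" using sub by (auto simp: subalgebra_def)
  have id[measurable]: "(\<lambda>w. w) \<in> measurable M G"
    by (rule measurable_from_subalg[OF sub]) simp
  interpret X: prob_space "distr M S X" by (rule prob_space_distr) simp
  interpret G: prob_space "distr M G (\<lambda>w. w)" by (rule prob_space_distr) simp
  have eq: "distr M S X \<Otimes>\<^sub>M distr M G (\<lambda>w. w) = distr M (S \<Otimes>\<^sub>M G) (\<lambda>w. (X w, w))"
  proof (rule pair_measure_eqI[OF X.sigma_finite_measure_axioms G.sigma_finite_measure_axioms])
    show "sets (distr M S X \<Otimes>\<^sub>M distr M G (\<lambda>w. w)) = sets (distr M (S \<Otimes>\<^sub>M G) (\<lambda>w. (X w, w)))"
      by (simp cong: sets_pair_measure_cong)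
    fix A B assume "A \<in> sets (distr M S X)" "B \<in> sets (distr M G (\<lambda>w. w))"
    then have AB[measurable]: "A \<in> sets S" "B \<in> sets G" by simp_all
    have "prob ((X -` A \<inter> space M) \<inter> B) = prob (X -` A \<inter> space M) * prob B"
      by (intro indep_setD[OF ind] in_vimage_algebra AB)
    moreover have "(\<lambda>w. (X w, w)) -` (A \<times> B) \<inter> space M = (X -` A \<inter> space M) \<inter> B" by auto
    moreover have "(\<lambda>w. w) -` B \<inter> space M = B" using sets.sets_into_space[OF AB(2)] sp by auto
    ultimately show "emeasure (distr M S X) A * emeasure (distr M G (\<lambda>w. w)) B =
        emeasure (distr M (S \<Otimes>\<^sub>M G) (\<lambda>w. (X w, w))) (A \<times> B)"
      by (simp add: emeasure_distr emeasure_eq_measure ennreal_mult)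
  qed
  have "(\<integral>\<^sup>+w. f (X w, w) \<partial>M) = (\<integral>\<^sup>+z. f z \<partial>distr M (S \<Otimes>\<^sub>M G) (\<lambda>w. (X w, w)))"
    by (subst nn_integral_distr) auto
  also have "\<dots> = (\<integral>\<^sup>+x. \<integral>\<^sup>+w. f (x, w) \<partial>distr M G (\<lambda>w. w) \<partial>distr M S X)"
    unfolding eq[symmetric] by (rule G.nn_integral_fst[symmetric]) (simp cong: measurable_cong_sets)
  also have "\<dots> = (\<integral>\<^sup>+x. \<integral>\<^sup>+w. f (x, w) \<partial>M \<partial>distr M S X)"
    by (intro nn_integral_cong, subst nn_integral_distr) auto
  finally show ?thesis .
qed

section \<open>Compensation of marked jumps\<close>

context hawkes_process
begin

text \<open>The jump times of the counting process; the mark \<open>xi i\<close> belongs to \<open>T i\<close>.\<close>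

abbreviation T :: "nat \<Rightarrow> 'a \<Rightarrow> real" where "T i w \<equiv> jump_time (\<lambda>t. N t w) i"
abbreviation jumps :: "nat \<Rightarrow> 'a \<Rightarrow> bool" where "jumps i w \<equiv> reached (\<lambda>t. N t w) i"

abbreviation predictable :: "(real \<times> 'a \<Rightarrow> ennreal) \<Rightarrow> bool" where
  "predictable C \<equiv> C \<in> borel_measurable (predictable_sigma M F)"

lemma jump_path: "w \<in> space M \<Longrightarrow> unit_jump_path (\<lambda>t. N t w)"
  using counting unfolding counting_process_def unit_jump_path_def by blast

lemma F_sub: "0 \<le> t \<Longrightarrow> subalgebra M (F t)"
  using filtration unfolding filtration_on_def by blast

lemma F_mono: "0 \<le> s \<Longrightarrow> s \<le> t \<Longrightarrow> sets (F s) \<subseteq> sets (F t)"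
  using filtration unfolding filtration_on_def subalgebra_def by blast

lemma space_F: "0 \<le> t \<Longrightarrow> space (F t) = space M"
  using F_sub unfolding subalgebra_def by blast

lemma sets_F: "0 \<le> t \<Longrightarrow> A \<in> sets (F t) \<Longrightarrow> A \<in> sets M"
  using F_sub unfolding subalgebra_def by blast

lemma N_adapted: "0 \<le> t \<Longrightarrow> N t \<in> measurable (F t) (count_space UNIV)"
  using counting unfolding counting_process_def by blast

lemma not_yet_jumped_sets: "0 \<le> t \<Longrightarrow> {w\<in>space M. N t w < i} \<in> sets (F t)"
proof -
  assume t: "0 \<le> t"
  have [measurable]: "N t \<in> measurable (F t) (count_space UNIV)" by (rule N_adapted[OF t])
  have "{w\<in>space (F t). N t w < i} \<in> sets (F t)" by measurable
  then show ?thesis by (simp add: space_F[OF t])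
qed

lemma strict_past_gen:
  "sets (F 0) \<union> {A \<inter> {w\<in>space M. N t w < i} | A t. 0 \<le> t \<and> A \<in> sets (F t)} \<subseteq> sets M"
proof (rule Un_least)
  show "sets (F 0) \<subseteq> sets M" using sets_F by blast
  show "{A \<inter> {w\<in>space M. N t w < i} | A t. 0 \<le> t \<and> A \<in> sets (F t)} \<subseteq> sets M"
  proof
    fix B assume "B \<in> {A \<inter> {w\<in>space M. N t w < i} | A t. 0 \<le> t \<and> A \<in> sets (F t)}"
    then obtain A t where B: "B = A \<inter> {w\<in>space M. N t w < i}" "0 \<le> t" "A \<in> sets (F t)" by blast
    show "B \<in> sets M" unfolding B(1) by (rule sets.Int[OF sets_F[OF B(2,3)] sets_F[OF B(2) not_yet_jumped_sets[OF B(2)]]])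
  qed
qed

lemma sets_strict_past: "sets (strict_past M F N i) = sigma_sets (space M)
    (sets (F 0) \<union> {A \<inter> {w\<in>space M. N t w < i} | A t. 0 \<le> t \<and> A \<in> sets (F t)})"
  unfolding strict_past_def by (rule sets_measure_of[OF order_trans[OF strict_past_gen sets.space_closed]])

lemma strict_past_sub: "subalgebra M (strict_past M F N i)"
proof -
  have "sets (strict_past M F N i) \<subseteq> sets M" unfolding sets_strict_past
    by (rule sets.sigma_sets_subset[OF strict_past_gen])
  then show ?thesis unfolding subalgebra_def by (simp add: strict_past_def space_measure_of_conv)
qed

lemma strict_pastI: "0 \<le> t \<Longrightarrow> A \<in> sets (F t) \<Longrightarrow> A \<inter> {w\<in>space M. N t w < i} \<in> sets (strict_past M F N i)"
  unfolding sets_strict_past by (intro sigma_sets.Basic UnI2) blast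

lemma space_strict_past: "space (strict_past M F N i) = space M"
  using strict_past_sub unfolding subalgebra_def by blast

lemma jumps_sets_strict_past: "{w\<in>space M. jumps i w} \<in> sets (strict_past M F N i)"
proof (cases "1 \<le> i")
  case True
  have "{w\<in>space M. jumps i w} = space M - (\<Inter>k::nat. space M \<inter> {w\<in>space M. N (real k) w < i})"
  proof -
    have "jumps i w \<longleftrightarrow> (\<exists>k::nat. \<not> N (real k) w < i)" if w: "w \<in> space M" for w
    proof
      assume "jumps i w"
      then obtain t where t: "0 \<le> t" "i \<le> N t w" by (auto simp: reached_def)
      obtain k :: nat where "t \<le> real k" using real_arch_simple by blast
      then have "N t w \<le> N (real k) w" using unit_jump_path.n_mono[OF jump_path[OF w] t(1)] by blast
      then show "\<exists>k::nat. \<not> N (real k) w < i" using t(2) by (intro exI[of _ k]) auto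
    qed (use True in \<open>auto simp: reached_def not_less intro: of_nat_0_le_iff\<close>)
    then show ?thesis by blast
  qed
  also have "\<dots> \<in> sets (strict_past M F N i)"
  proof -
    have "space M \<inter> {w\<in>space M. N (real k) w < i} \<in> sets (strict_past M F N i)" for k :: nat
      using sets.top[of "F (real k)"] by (intro strict_pastI) (auto simp: space_F)
    then show ?thesis
      using sets.top[of "strict_past M F N i"] unfolding space_strict_past by (intro sets.Diff sets.countable_INT) auto
  qed
  finally show ?thesis .
qed (auto simp: reached_def)

lemma predictable_gen_Pow:
  "{{s<..t} \<times> A | s t A. 0 \<le> s \<and> s \<le> t \<and> A \<in> sets (F s)} \<subseteq> Pow ({0::real<..} \<times> space M)"
  using sets_F sets.sets_into_space by fastforce

lemma space_predictable: "space (predictable_sigma M F) = {0<..} \<times> space M"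
  unfolding predictable_sigma_def using predictable_gen_Pow by (rule space_measure_of)

text \<open>A predictable process sampled at a jump time depends only on the strict past of the jump. On a
  generating rectangle \<open>(s, t] \<times> A\<close> the event is \<open>A \<inter> {s < T}\<close> without \<open>A \<inter> {t < T}\<close>, and both
  are generators of the strict past because \<open>A\<close> is known at time \<open>s\<close> and hence at time \<open>t\<close>.\<close>

lemma predictable_at_jump_measurable:
  fixes C :: "real \<times> 'a \<Rightarrow> ennreal"
  assumes C: "predictable C" and i: "1 \<le> i"
  shows "(\<lambda>w. if jumps i w then C (T i w, w) else 0) \<in> borel_measurable (strict_past M F N i)"
proof -
  let ?P = "strict_past M F N i" and ?J = "{w\<in>space M. jumps i w}"
  have J: "?J \<inter> space ?P \<in> sets ?P" using jumps_sets_strict_past by (simp add: space_strict_past Int_absorb2)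
  have J': "?J \<inter> space ?P = ?J" by (auto simp: space_strict_past)
  have "(\<lambda>w. (T i w, w)) \<in> measurable (restrict_space ?P ?J) (predictable_sigma M F)"
    unfolding predictable_sigma_def
  proof (rule measurable_measure_of[OF predictable_gen_Pow])
    show "(\<lambda>w. (T i w, w)) \<in> space (restrict_space ?P ?J) \<rightarrow> {0<..} \<times> space M"
      using unit_jump_path.jump_time_pos[OF jump_path] by (auto simp: space_restrict_space space_strict_past)
    fix B assume "B \<in> {{s<..t} \<times> A | s t A. 0 \<le> s \<and> s \<le> t \<and> A \<in> sets (F s)}"
    then obtain s t A where B: "B = {s<..t} \<times> A" "0 \<le> s" "s \<le> t" "A \<in> sets (F s)" by blast
    have At: "A \<in> sets (F t)" using F_mono B by blast
    have "(\<lambda>w. (T i w, w)) -` B \<inter> ?J =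
        ((A \<inter> {w\<in>space M. N s w < i}) - (A \<inter> {w\<in>space M. N t w < i})) \<inter> ?J"
      unfolding B using unit_jump_path.jump_time_le_iff[OF jump_path] B(2,3) by (auto simp: not_less not_le[symmetric])
    also have "\<dots> \<in> sets ?P"
      using B At by (intro sets.Int sets.Diff strict_pastI jumps_sets_strict_past) auto
    finally show "(\<lambda>w. (T i w, w)) -` B \<inter> space (restrict_space ?P ?J) \<in> sets (restrict_space ?P ?J)"
      using J by (subst sets_restrict_space_iff) (auto simp: space_restrict_space J')
  qed
  then have "(\<lambda>w. C (T i w, w)) \<in> borel_measurable (restrict_space ?P ?J)"
    using C by (rule measurable_compose)
  then have "(\<lambda>w. C (T i w, w) * indicator ?J w) \<in> borel_measurable ?P"
    by (subst (asm) borel_measurable_restrict_space_iff_ennreal[OF J])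
  then show ?thesis
    by (rule measurable_cong[THEN iffD1, rotated]) (auto simp: space_strict_past)
qed

lemma predictable_section:
  fixes C :: "real \<times> 'a \<Rightarrow> ennreal"
  assumes C: "predictable C" and wM: "w \<in> space M"
  shows "(\<lambda>u. C (u, w) * indicator {0<..} u) \<in> borel_measurable borel"
proof -
  have "(\<lambda>u. (u, w)) \<in> measurable (restrict_space borel {0<..}) (predictable_sigma M F)"
    unfolding predictable_sigma_def
  proof (rule measurable_measure_of[OF predictable_gen_Pow])
    fix B assume "B \<in> {{s<..t} \<times> A | s t A. 0 \<le> s \<and> s \<le> t \<and> A \<in> sets (F s)}"
    then obtain s t A where B: "B = {s<..t} \<times> A" "0 \<le> s" by blast
    have "(\<lambda>u. (u, w)) -` B \<inter> {0<..} = (if w \<in> A then {s<..t} else {})" using B by auto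
    then show "(\<lambda>u. (u, w)) -` B \<inter> space (restrict_space borel {0<..}) \<in> sets (restrict_space borel {0<..})"
      by (subst sets_restrict_space_iff) (auto simp: space_restrict_space)
  qed (use wM in auto)
  then have "(\<lambda>u. C (u, w)) \<in> borel_measurable (restrict_space borel {0<..})"
    using C by (rule measurable_compose)
  then show ?thesis
    by (subst (asm) borel_measurable_restrict_space_iff_ennreal) auto
qed

lemma xi_measurable: "1 \<le> i \<Longrightarrow> xi i \<in> borel_measurable M"
  using marks_indep unfolding indep_vars_def by auto

text \<open>Compensation for marked jumps. Working jump by jump keeps every step free of integrability
  conditions: at each jump the mark is independent of the sampled predictable value, so its
  expectation factors out; what remains is the integral of \<open>C\<close> against the counting process, to which the
  defining property of the intensity applies.\<close>

theorem marked_compensator: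
  fixes C :: "real \<times> 'a \<Rightarrow> ennreal" and \<phi> :: "real \<Rightarrow> ennreal"
  assumes C: "predictable C" and \<phi>[measurable]: "\<phi> \<in> borel_measurable borel"
  shows "(\<integral>\<^sup>+w. (\<Sum>i. if jumps i w then C (T i w, w) * \<phi> (xi i w) else 0) \<partial>M) =
    (\<integral>\<^sup>+w. \<phi> (xi 1 w) \<partial>M) * (\<integral>\<^sup>+w. (\<integral>\<^sup>+u\<in>{0<..}. C (u, w) * ennreal (lam u w) \<partial>lborel) \<partial>M)"
proof -
  let ?C = "\<lambda>i w. if jumps i w then C (T i w, w) else 0"
  have j0: "\<not> jumps 0 w" for w by (simp add: reached_def)
  have CP: "?C i \<in> borel_measurable (strict_past M F N i)" if "1 \<le> i" for i
    using predictable_at_jump_measurable[OF C that] .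
  have CM: "?C i \<in> borel_measurable M" for i
  proof (cases "1 \<le> i")
    case True show ?thesis using measurable_from_subalg[OF strict_past_sub CP[OF True]] .
  next
    case False then show ?thesis by (simp add: reached_def)
  qed
  have each: "(\<integral>\<^sup>+w. ?C i w * \<phi> (xi i w) \<partial>M) = (\<integral>\<^sup>+w. \<phi> (xi 1 w) \<partial>M) * (\<integral>\<^sup>+w. ?C i w \<partial>M)" for i
  proof (cases "1 \<le> i")
    case True
    note [measurable] = xi_measurable[OF True] xi_measurable[of 1, OF order_refl] CP[OF True] CM[of i]
    have "(\<integral>\<^sup>+w. ?C i w * \<phi> (xi i w) \<partial>M) =
        (\<integral>\<^sup>+x. \<integral>\<^sup>+w. ?C i w * \<phi> x \<partial>M \<partial>distr M borel (xi i))"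
      using nn_integral_independent_freeze[OF xi_measurable[OF True] strict_past_sub mark_unpredictable[OF True],
          of "\<lambda>z. ?C i (snd z) * \<phi> (fst z)"] by (simp add: case_prod_beta cong: if_cong)
    also have "\<dots> = (\<integral>\<^sup>+x. (\<integral>\<^sup>+w. ?C i w \<partial>M) * \<phi> x \<partial>distr M borel (xi i))"
      by (intro nn_integral_cong nn_integral_multc) simp
    also have "\<dots> = (\<integral>\<^sup>+w. ?C i w \<partial>M) * (\<integral>\<^sup>+x. \<phi> x \<partial>distr M borel (xi 1))"
      unfolding marks_ident[OF True] by (intro nn_integral_cmult) simp
    also have "(\<integral>\<^sup>+x. \<phi> x \<partial>distr M borel (xi 1)) = (\<integral>\<^sup>+w. \<phi> (xi 1 w) \<partial>M)"
      by (rule nn_integral_distr[OF xi_measurable[OF order_refl]]) simp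
    finally show ?thesis by (simp add: mult.commute)
  next
    case False
    then have "i = 0" by simp
    then show ?thesis by (simp add: j0)
  qed
  have CphiM: "(\<lambda>w. ?C i w * \<phi> (xi i w)) \<in> borel_measurable M" for i
  proof (cases "1 \<le> i")
    case True
    note [measurable] = xi_measurable[OF True] CM[of i]
    show ?thesis by measurable
  next
    case False
    then have "i = 0" by simp
    then show ?thesis by (simp add: j0)
  qed
  have "(\<integral>\<^sup>+w. (\<Sum>i. if jumps i w then C (T i w, w) * \<phi> (xi i w) else 0) \<partial>M) =
      (\<integral>\<^sup>+w. (\<Sum>i. ?C i w * \<phi> (xi i w)) \<partial>M)"
    by (intro nn_integral_cong suminf_cong) auto
  also have "\<dots> = (\<Sum>i. \<integral>\<^sup>+w. ?C i w * \<phi> (xi i w) \<partial>M)"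
    by (rule nn_integral_suminf[OF CphiM])
  also have "\<dots> = (\<integral>\<^sup>+w. \<phi> (xi 1 w) \<partial>M) * (\<Sum>i. \<integral>\<^sup>+w. ?C i w \<partial>M)"
    unfolding each by simp
  also have "(\<Sum>i. \<integral>\<^sup>+w. ?C i w \<partial>M) = (\<integral>\<^sup>+w. (\<Sum>i. ?C i w) \<partial>M)"
    by (rule nn_integral_suminf[OF CM, symmetric])
  also have "\<dots> = (\<integral>\<^sup>+w. (\<integral>\<^sup>+u\<in>{0<..}. C (u, w) \<partial>stieltjes (\<lambda>u. real (N u w))) \<partial>M)"
  proof (rule nn_integral_cong)
    fix w assume wM: "w \<in> space M"
    interpret p: unit_jump_path "\<lambda>t. N t w" by (rule jump_path[OF wM])
    have "(\<integral>\<^sup>+u\<in>{0<..}. C (u, w) \<partial>stieltjes (\<lambda>u. real (N u w))) =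
      (\<integral>\<^sup>+u. C (u, w) * indicator {0<..} u \<partial>stieltjes (\<lambda>u. \<Sum>i=1..N u w. 1))" by simp
    also have "\<dots> = (\<Sum>i. if jumps i w then C (T i w, w) * indicator {0<..} (T i w) * ennreal 1 else 0)"
      by (rule p.nn_integral_stieltjes) (auto intro: predictable_section[OF C wM])
    also have "\<dots> = (\<Sum>i. ?C i w)"
      using p.jump_time_pos by (intro suminf_cong) auto
    finally show "(\<Sum>i. ?C i w) = (\<integral>\<^sup>+u\<in>{0<..}. C (u, w) \<partial>stieltjes (\<lambda>u. real (N u w)))" ..
  qed
  also have "\<dots> = (\<integral>\<^sup>+w. (\<integral>\<^sup>+u\<in>{0<..}. C (u, w) * ennreal (lam u w) \<partial>lborel) \<partial>M)"
    using intensity C unfolding stochastic_intensity_def by blast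
  finally show ?thesis .
qed

section \<open>The intensity as a pure jump process\<close>

text \<open>The jumps of \<open>exp (\<kappa> t) (lam\<^sub>t - \<theta>)\<close> accumulated up to time \<open>t\<close>.\<close>

definition Y :: "real \<Rightarrow> 'a \<Rightarrow> real" where
  "Y t w = (\<Sum>i=1..N t w. \<eta> * xi i w * exp (\<kappa> * T i w))"

text \<open>The left limit of \<open>Y\<close>. Because \<open>Y\<close> is nondecreasing it is a supremum over earlier rational
  times, and a countable supremum of elementary predictable processes is visibly predictable.\<close>

definition Y_left :: "real \<Rightarrow> 'a \<Rightarrow> ennreal" where
  "Y_left u w = (SUP q\<in>\<rat> \<inter> {0..}. ennreal (Y q w) * indicator {q<..} u)"

lemma lam_eq:
  assumes t: "0 \<le> t" and wM: "w \<in> space M"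
  shows "lam t w = \<theta> + exp (- \<kappa> * t) * (lam 0 w - \<theta>) + exp (- \<kappa> * t) * Y t w"
proof -
  interpret p: unit_jump_path "\<lambda>t. N t w" by (rule jump_path[OF wM])
  have "(LINT u:{0<..t}|stieltjes (\<lambda>v. jump_sum N xi v w). exp (- \<kappa> * (t - u))) =
      (\<Sum>i\<in>{N 0 w<..N t w}. xi i w * exp (- \<kappa> * (t - T i w)))"
    unfolding jump_sum_def
    by (rule p.set_lebesgue_integral_stieltjes) (use marks_pos wM t in \<open>auto intro: less_imp_le\<close>)
  also have "{N 0 w<..N t w} = {1..N t w}" using p.start by auto
  also have "(\<Sum>i\<in>{1..N t w}. xi i w * exp (- \<kappa> * (t - T i w))) =
      exp (- \<kappa> * t) * (\<Sum>i\<in>{1..N t w}. xi i w * exp (\<kappa> * T i w))"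
    unfolding sum_distrib_left
    by (intro sum.cong) (auto simp: exp_add[symmetric] algebra_simps)
  finally show ?thesis
    using intensity_eq[OF order_refl t wM] by (simp add: Y_def sum_distrib_left mult.assoc mult.left_commute)
qed

lemma Y_eq:
  assumes t: "0 \<le> t" and wM: "w \<in> space M"
  shows "Y t w = exp (\<kappa> * t) * (lam t w - \<theta>) - (lam 0 w - \<theta>)"
proof -
  have e: "exp (\<kappa> * t) * exp (- \<kappa> * t) = 1" by (simp add: exp_add[symmetric])
  have "exp (\<kappa> * t) * (lam t w - \<theta>) = (exp (\<kappa> * t) * exp (- \<kappa> * t)) * (lam 0 w - \<theta> + Y t w)"
    unfolding lam_eq[OF assms] by (simp add: algebra_simps)
  then show ?thesis unfolding e by simp
qed

lemma summand_nonneg: "w \<in> space M \<Longrightarrow> 1 \<le> i \<Longrightarrow> 0 \<le> \<eta> * xi i w * exp (\<kappa> * T i w)"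
  using marks_pos[of i w] eta_pos by simp

lemma Y_nonneg: "w \<in> space M \<Longrightarrow> 0 \<le> Y t w"
  unfolding Y_def by (rule sum_nonneg) (use summand_nonneg in auto)

lemma Y_mono: "w \<in> space M \<Longrightarrow> 0 \<le> s \<Longrightarrow> s \<le> t \<Longrightarrow> Y s w \<le> Y t w"
  unfolding Y_def using unit_jump_path.n_mono[OF jump_path, of w s t]
  by (intro sum_mono2) (auto intro: summand_nonneg)

lemma Y_right: "w \<in> space M \<Longrightarrow> 0 \<le> t \<Longrightarrow> \<forall>\<^sub>F u in at_right t. Y u w = Y t w"
  by (rule eventually_mono[OF unit_jump_path.eventually_const_right[OF jump_path]]) (auto simp: Y_def)

lemma lam_nonneg: "0 \<le> t \<Longrightarrow> w \<in> space M \<Longrightarrow> 0 \<le> lam t w"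
  using intensity unfolding stochastic_intensity_def by blast

text \<open>Progressive measurability on \<open>[0, t]\<close>, restricted to the section at \<open>t\<close>.\<close>

lemma lam_adapted: assumes "0 \<le> t" shows "lam t \<in> borel_measurable (F t)"
proof -
  have "(\<lambda>(u, w). lam u w) \<in> borel_measurable (restrict_space borel {0..t} \<Otimes>\<^sub>M F t)"
    using intensity assms unfolding stochastic_intensity_def by blast
  moreover have "(\<lambda>w. (t, w)) \<in> measurable (F t) (restrict_space borel {0..t} \<Otimes>\<^sub>M F t)"
    using assms by (intro measurable_Pair measurable_const) (auto simp: space_restrict_space)
  ultimately have "(\<lambda>w. (\<lambda>(u, w). lam u w) (t, w)) \<in> borel_measurable (F t)"
    by (rule measurable_compose[rotated])
  then show ?thesis by simp
qed

lemma F0_lift: "0 \<le> t \<Longrightarrow> f \<in> measurable (F 0) S \<Longrightarrow> f \<in> measurable (F t) S"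
  using F_mono[of 0 t] space_F[of t] space_F[of 0] by (auto simp: measurable_def)

lemma F_lift: "0 \<le> t \<Longrightarrow> f \<in> measurable (F t) S \<Longrightarrow> f \<in> measurable M S"
  by (rule measurable_from_subalg[OF F_sub])

lemma lam_measurable: "0 \<le> t \<Longrightarrow> lam t \<in> borel_measurable M"
  using F_lift lam_adapted by blast

lemma Y_measurable:
  assumes sp: "space H = space M" and l: "\<And>q. 0 \<le> q \<Longrightarrow> q \<le> t \<Longrightarrow> lam q \<in> borel_measurable H" and t: "0 \<le> t"
  shows "Y t \<in> borel_measurable H"
proof -
  have [measurable]: "lam t \<in> borel_measurable H" "lam 0 \<in> borel_measurable H" using l t by auto
  have "(\<lambda>w. exp (\<kappa> * t) * (lam t w - \<theta>) - (lam 0 w - \<theta>)) \<in> borel_measurable H" by measurable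
  then show ?thesis
    by (rule measurable_cong[THEN iffD2, rotated]) (simp add: Y_eq t sp)
qed

lemma Y_adapted: assumes "0 \<le> t" shows "Y t \<in> borel_measurable (F t)"
proof (rule Y_measurable[OF space_F[OF assms] _ assms])
  fix q assume q: "0 \<le> q" "q \<le> t"
  show "lam q \<in> borel_measurable (F t)"
    using lam_adapted[OF q(1)] F_mono[OF q] space_F[OF q(1)] space_F[OF assms] by (auto simp: measurable_def)
qed

lemma Y_measurable_M: "0 \<le> t \<Longrightarrow> Y t \<in> borel_measurable M"
  using F_lift Y_adapted by blast

lemma predictable_Ioi:
  assumes "0 \<le> s" "A \<in> sets (F s)"
  shows "{s<..} \<times> A \<in> sets (predictable_sigma M F)"
proof -
  have eq: "{s<..} \<times> A = (\<Union>k::nat. {s<..s + real k} \<times> A)"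
  proof (intro set_eqI iffI)
    fix z assume z: "z \<in> {s<..} \<times> A"
    obtain k :: nat where "fst z - s \<le> real k" using real_arch_simple by blast
    then show "z \<in> (\<Union>k::nat. {s<..s + real k} \<times> A)" using z by (auto intro!: exI[of _ k])
  qed auto
  have "{s<..s + real k} \<times> A \<in> sets (predictable_sigma M F)" for k
    unfolding predictable_sigma_def sets_measure_of[OF predictable_gen_Pow] using assms
    by (intro sigma_sets.Basic CollectI exI[of _ s] exI[of _ "s + real k"] exI[of _ A]) auto
  then show ?thesis unfolding eq by blast
qed

lemma predictable_step:
  fixes Z :: "'a \<Rightarrow> ennreal"
  assumes s: "0 \<le> s" and Z[measurable]: "Z \<in> borel_measurable (F s)"
  shows "predictable (\<lambda>z. Z (snd z) * indicator {s<..} (fst z))"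
proof (rule borel_measurableI_greater)
  fix a :: ennreal
  have "{w\<in>space (F s). a < Z w} \<in> sets (F s)" by measurable
  from predictable_Ioi[OF s this]
  show "{z \<in> space (predictable_sigma M F). a < Z (snd z) * indicator {s<..} (fst z)} \<in> sets (predictable_sigma M F)"
    by (rule back_subst[where P="\<lambda>x. x \<in> _"])
      (use s in \<open>auto simp: space_predictable space_F[OF s] indicator_def split: if_splits\<close>)
qed

lemma predictable_fst: "fst \<in> borel_measurable (predictable_sigma M F)"
proof (rule borel_measurableI_greater)
  fix a :: real
  have "{max 0 a<..} \<times> space M \<in> sets (predictable_sigma M F)"
    using F_mono[of 0 "max 0 a"] sets.top[of "F 0"] by (intro predictable_Ioi) (auto simp: space_F)
  then show "{z \<in> space (predictable_sigma M F). a < fst z} \<in> sets (predictable_sigma M F)"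
    by (rule back_subst[where P="\<lambda>x. x \<in> _"]) (auto simp: space_predictable)
qed

lemma Y_left_predictable: "predictable (\<lambda>z. Y_left (fst z) (snd z))"
  unfolding Y_left_def
proof (rule borel_measurable_SUP)
  show "countable (\<rat> \<inter> {0::real..})" using countable_rat by blast
  fix q :: real assume "q \<in> \<rat> \<inter> {0..}"
  then have q: "0 \<le> q" by simp
  note [measurable] = Y_adapted[OF q]
  show "predictable (\<lambda>z. ennreal (Y q (snd z)) * indicator {q<..} (fst z))"
    by (rule predictable_step[OF q]) measurable
qed

lemma Y_left_mono: "u \<le> v \<Longrightarrow> Y_left u w \<le> Y_left v w"
  unfolding Y_left_def by (intro SUP_mono') (auto simp: indicator_def)

lemma Y_left_le_Y: "w \<in> space M \<Longrightarrow> 0 \<le> u \<Longrightarrow> Y_left u w \<le> ennreal (Y u w)"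
  unfolding Y_left_def by (intro SUP_least) (auto simp: indicator_def intro!: ennreal_leI Y_mono)

lemma Y_le_Y_left: "q \<in> \<rat> \<Longrightarrow> 0 \<le> q \<Longrightarrow> q < u \<Longrightarrow> ennreal (Y q w) \<le> Y_left u w"
  unfolding Y_left_def by (rule SUP_upper2[of q]) auto

text \<open>At a jump the left limit contains exactly the earlier jumps; this is what makes the discrete
  partial sums available as a predictable integrand.\<close>

lemma Y_left_at_jump:
  assumes wM: "w \<in> space M" and j: "jumps i w"
  shows "Y_left (T i w) w = ennreal (\<Sum>j=1..i-1. \<eta> * xi j w * exp (\<kappa> * T j w))" (is "_ = ennreal ?S")
proof (rule antisym)
  interpret p: unit_jump_path "\<lambda>t. N t w" by (rule jump_path[OF wM])
  have "Y q w \<le> ?S" if "0 \<le> q" "q < T i w" for q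
    unfolding Y_def using p.jump_time_le_iff[OF j that(1)] that(2)
    by (intro sum_mono2) (auto intro: summand_nonneg[OF wM])
  then show "Y_left (T i w) w \<le> ennreal ?S"
    unfolding Y_left_def by (intro SUP_least) (auto simp: indicator_def intro!: ennreal_leI)
  obtain q0 where q0: "0 \<le> q0" "q0 < T i w" "\<And>q. q0 \<le> q \<Longrightarrow> q < T i w \<Longrightarrow> N q w = i - 1"
    using p.just_before_jump[OF j] by blast
  obtain q where q: "q \<in> \<rat>" "q0 < q" "q < T i w" using Rats_dense_in_real[OF q0(2)] by blast
  have "?S = Y q w" unfolding Y_def q0(3)[OF less_imp_le[OF q(2)] q(3)] ..
  then show "ennreal ?S \<le> Y_left (T i w) w" using Y_le_Y_left[OF q(1) _ q(3)] q0(1) q(2) by simp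
qed

text \<open>Away from the countably many jump times \<open>Y\<close> does not notice the difference between left limit and
  value, so that time integrals may use either.\<close>

lemma Y_left_eq_Y:
  assumes wM: "w \<in> space M" and u: "0 < u" "u \<notin> range (\<lambda>i. T i w)"
  shows "Y_left u w = ennreal (Y u w)"
proof (rule antisym)
  interpret p: unit_jump_path "\<lambda>t. N t w" by (rule jump_path[OF wM])
  show "Y_left u w \<le> ennreal (Y u w)" using u by (intro Y_left_le_Y[OF wM]) simp
  show "ennreal (Y u w) \<le> Y_left u w"
  proof (cases "N u w = 0")
    case True then show ?thesis by (simp add: Y_def)
  next
    case False
    let ?k = "N u w"
    have j: "jumps ?k w" using False u by (intro p.reachedI[of _ u]) auto
    have "T ?k w \<le> u" using p.jump_time_le_iff[OF j, of u] u by simp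
    then have "T ?k w < u" using u(2) by (metis order_le_less rangeI)
    then obtain q where q: "q \<in> \<rat>" "T ?k w < q" "q < u" using Rats_dense_in_real by blast
    have q0: "0 \<le> q" using p.jump_time_nonneg[OF j] q by linarith
    have "?k \<le> N q w" using p.jump_time_le_iff[OF j q0] q by simp
    moreover have "N q w \<le> ?k" using p.n_mono[OF q0] q by simp
    ultimately have "Y u w = Y q w" unfolding Y_def by simp
    then show ?thesis using Y_le_Y_left[OF q(1) q0 q(3)] by simp
  qed
qed

lemma AE_Y_left_eq_Y:
  assumes wM: "w \<in> space M" shows "AE u in lborel. 0 < u \<longrightarrow> Y_left u w = ennreal (Y u w)"
proof -
  have "range (\<lambda>i. T i w) \<in> null_sets lborel" by (intro countable_imp_null_set_lborel) auto
  from AE_not_in[OF this] show ?thesis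
    by eventually_elim (use Y_left_eq_Y[OF wM] in blast)
qed

text \<open>\<open>Y\<close> is nondecreasing and right-continuous, hence below a level exactly if it is so at some later
  rational time. The \<open>\<sigma>\<close>-algebra is left open because the result is needed for all events and for
  those of the Hawkes process alone; \<open>max 0\<close> makes the process total in time.\<close>

lemma Y_joint:
  assumes sp: "space H = space M" and l: "\<And>q. 0 \<le> q \<Longrightarrow> lam q \<in> borel_measurable H"
  shows "(\<lambda>z. Y (max 0 (fst z)) (snd z)) \<in> borel_measurable (borel \<Otimes>\<^sub>M H)"
proof (rule borel_measurableI_less)
  fix a :: real
  let ?Q = "\<rat> \<inter> {0::real<..}"
  have Y_left[measurable]: "Y q \<in> borel_measurable H" if "0 \<le> q" for q
    using Y_measurable[OF sp l that] by blast
  have eq: "{z \<in> space (borel \<Otimes>\<^sub>M H). Y (max 0 (fst z)) (snd z) < a} =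
      (\<Union>q\<in>?Q. {..<q} \<times> {w\<in>space H. Y q w < a})"
  proof (intro set_eqI iffI)
    fix z assume z: "z \<in> {z \<in> space (borel \<Otimes>\<^sub>M H). Y (max 0 (fst z)) (snd z) < a}"
    define v where "v = max 0 (fst z)"
    have wM: "snd z \<in> space M" and v: "0 \<le> v" using z by (auto simp: space_pair_measure sp v_def)
    obtain b where b: "v < b" "\<And>u. v < u \<Longrightarrow> u < b \<Longrightarrow> Y u (snd z) = Y v (snd z)"
      using Y_right[OF wM v] unfolding eventually_at_right_field by blast
    obtain q where q: "q \<in> \<rat>" "v < q" "q < b" using Rats_dense_in_real[OF b(1)] by blast
    have "Y q (snd z) < a" using b(2)[OF q(2,3)] z by (simp add: v_def)
    then show "z \<in> (\<Union>q\<in>?Q. {..<q} \<times> {w\<in>space H. Y q w < a})"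
      using q wM by (cases z) (auto simp: sp v_def intro!: bexI[of _ q])
  next
    fix z assume "z \<in> (\<Union>q\<in>?Q. {..<q} \<times> {w\<in>space H. Y q w < a})"
    then obtain q where q: "0 < q" "fst z < q" "snd z \<in> space M" "Y q (snd z) < a"
      by (auto simp: sp)
    have "Y (max 0 (fst z)) (snd z) \<le> Y q (snd z)" using q by (intro Y_mono) auto
    then show "z \<in> {z \<in> space (borel \<Otimes>\<^sub>M H). Y (max 0 (fst z)) (snd z) < a}"
      using q by (cases z) (auto simp: space_pair_measure sp)
  qed
  have "countable ?Q" using countable_rat by blast
  moreover have "{..<q} \<times> {w\<in>space H. Y q w < a} \<in> sets (borel \<Otimes>\<^sub>M H)" if "q \<in> ?Q" for q
    using Y_left[of q] that by (intro pair_measureI) auto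
  ultimately show "{z \<in> space (borel \<Otimes>\<^sub>M H). Y (max 0 (fst z)) (snd z) < a} \<in> sets (borel \<Otimes>\<^sub>M H)"
    unfolding eq by (intro sets.countable_UN'') auto
qed

lemma lam_joint:
  assumes sp: "space H = space M" and l: "\<And>q. 0 \<le> q \<Longrightarrow> lam q \<in> borel_measurable H"
  shows "(\<lambda>z. lam (max 0 (fst z)) (snd z)) \<in> borel_measurable (borel \<Otimes>\<^sub>M H)"
proof -
  note [measurable] = Y_joint[OF sp l] l[of 0]
  have "(\<lambda>z. \<theta> + exp (- \<kappa> * max 0 (fst z)) * (lam 0 (snd z) - \<theta>) +
      exp (- \<kappa> * max 0 (fst z)) * Y (max 0 (fst z)) (snd z)) \<in> borel_measurable (borel \<Otimes>\<^sub>M H)"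
    by measurable
  then show ?thesis
    by (rule measurable_cong[THEN iffD2, rotated]) (subst lam_eq, auto simp: space_pair_measure sp)
qed

end

section \<open>A Gronwall inequality for nonnegative integrals\<close>

lemma nn_integral_exp_decay:
  assumes c: "(0::real) < c"
  shows "(\<integral>\<^sup>+u. ennreal (exp (- c * u)) * indicator {v..} u \<partial>lborel) = ennreal (exp (- c * v) / c)"
proof -
  have "(\<integral>\<^sup>+u. ennreal (exp (- c * u)) * indicator {v..} u \<partial>lborel) = ennreal (0 - (- exp (- c * v) / c))"
  proof (rule nn_integral_FTC_atLeast)
    show "((\<lambda>u. - exp (- c * u) / c) has_real_derivative exp (- c * x)) (at x)" for x
      using c by (auto intro!: derivative_eq_intros)
    show "((\<lambda>u. - exp (- c * u) / c) \<longlongrightarrow> 0) at_top"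
    proof -
      have "((\<lambda>u. exp (- c * u)) \<longlongrightarrow> 0) at_top"
        using c by (intro filterlim_compose[OF exp_at_bot] filterlim_tendsto_neg_mult_at_bot[of _ "-c"]
            tendsto_const filterlim_ident) auto
      then have "((\<lambda>u. - exp (- c * u) / c) \<longlongrightarrow> - 0 / c) at_top"
        using c by (intro tendsto_divide tendsto_minus tendsto_const) auto
      then show ?thesis by simp
    qed
  qed auto
  then show ?thesis by simp
qed

text \<open>Multiplying by \<open>exp (- 2 L u)\<close> and exchanging the order of integration bounds the weighted integral
  by a constant plus one half of itself. A finite integral can therefore be absorbed; finiteness is
  needed only qualitatively, and the bound does not depend on it.\<close>

lemma gronwall_nn_integral:
  fixes f :: "real \<Rightarrow> ennreal" and L c S :: real
  assumes f[measurable]: "f \<in> borel_measurable borel"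
    and L: "0 < L" and c: "0 \<le> c"
    and fin: "(\<integral>\<^sup>+u. f u * indicator {0..S} u \<partial>lborel) < \<infinity>"
    and le: "\<And>t. 0 \<le> t \<Longrightarrow> t \<le> S \<Longrightarrow> f t \<le> ennreal c + ennreal L * (\<integral>\<^sup>+u. f u * indicator {0..t} u \<partial>lborel)"
  shows "(\<integral>\<^sup>+u. f u * indicator {0..S} u \<partial>lborel) \<le> ennreal (exp (2 * L * S) * (c / L))"
proof -
  let ?e = "\<lambda>u. ennreal (exp (- (2 * L) * u))"
  let ?k = "\<lambda>u v. (ennreal L * (?e u * indicator {v..} u)) * (f v * indicator {0..S} v)"
  let ?J = "\<integral>\<^sup>+u. ?e u * f u * indicator {0..S} u \<partial>lborel"
  have "?J \<le> (\<integral>\<^sup>+u. f u * indicator {0..S} u \<partial>lborel)"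
  proof (intro nn_integral_mono)
    fix u :: real
    show "?e u * f u * indicator {0..S} u \<le> f u * indicator {0..S} u"
    proof (cases "0 \<le> u \<and> u \<le> S")
      case True
      then have "?e u \<le> 1" using L by simp
      from mult_right_mono[OF this, of "f u"] show ?thesis using True by simp
    qed auto
  qed
  then have Jfin: "?J < \<infinity>" using fin by (rule le_less_trans)
  have "?J \<le> (\<integral>\<^sup>+u. (?e u * indicator {0..} u) * ennreal c +
      (\<integral>\<^sup>+v. ?k u v \<partial>lborel) \<partial>lborel)"
  proof (intro nn_integral_mono)
    fix u :: real
    show "?e u * f u * indicator {0..S} u \<le> (?e u * indicator {0..} u) * ennreal c +
      (\<integral>\<^sup>+v. ?k u v \<partial>lborel)"
    proof (cases "0 \<le> u \<and> u \<le> S")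
      case True
      have "?e u * f u \<le> ?e u * (ennreal c + ennreal L * (\<integral>\<^sup>+v. f v * indicator {0..u} v \<partial>lborel))"
        using le True by (intro mult_left_mono) auto
      also have "\<dots> = ?e u * ennreal c + (\<integral>\<^sup>+v. (ennreal L * ?e u) * (f v * indicator {0..u} v) \<partial>lborel)"
        by (subst nn_integral_cmult) (auto simp: algebra_simps)
      also have "(\<integral>\<^sup>+v. (ennreal L * ?e u) * (f v * indicator {0..u} v) \<partial>lborel) =
          (\<integral>\<^sup>+v. ?k u v \<partial>lborel)"
        using True by (intro nn_integral_cong) (auto simp: indicator_def)
      finally show ?thesis using True by simp
    qed auto
  qed
  also have "\<dots> = (\<integral>\<^sup>+u. (?e u * indicator {0..} u) * ennreal c \<partial>lborel) +
      (\<integral>\<^sup>+u. (\<integral>\<^sup>+v. ?k u v \<partial>lborel) \<partial>lborel)"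
    by (intro nn_integral_add) (auto simp: indicator_def)
  also have "(\<integral>\<^sup>+u. (\<integral>\<^sup>+v. ?k u v \<partial>lborel) \<partial>lborel)
    = (\<integral>\<^sup>+v. (\<integral>\<^sup>+u. ?k u v \<partial>lborel) \<partial>lborel)"
    by (rule lborel_pair.Fubini') (auto simp: indicator_def)
  also have "\<dots> = (\<integral>\<^sup>+v. ennreal (1/2) * (?e v * f v * indicator {0..S} v) \<partial>lborel)"
  proof (intro nn_integral_cong)
    fix v :: real
    have "(\<integral>\<^sup>+u. ?k u v \<partial>lborel)
      = ennreal L * (\<integral>\<^sup>+u. ?e u * indicator {v..} u \<partial>lborel) * (f v * indicator {0..S} v)"
      by (subst nn_integral_multc, simp, subst nn_integral_cmult) auto
    also have "(\<integral>\<^sup>+u. ?e u * indicator {v..} u \<partial>lborel) = ennreal (exp (- (2 * L) * v) / (2 * L))"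
      using L by (intro nn_integral_exp_decay) simp
    also have "ennreal L * ennreal (exp (- (2 * L) * v) / (2 * L)) = ennreal (1/2) * ?e v"
    proof -
      have "L * (exp (- (2 * L) * v) / (2 * L)) = 1/2 * exp (- (2 * L) * v)" using L by simp
      then have "ennreal (L * (exp (- (2 * L) * v) / (2 * L))) = ennreal (1/2 * exp (- (2 * L) * v))"
        by (rule arg_cong)
      then show ?thesis using L by (subst (1 2) ennreal_mult[symmetric]) auto
    qed
    finally show "(\<integral>\<^sup>+u. ?k u v \<partial>lborel)
       = ennreal (1/2) * (?e v * f v * indicator {0..S} v)" by (simp add: mult.assoc)
  qed
  also have "\<dots> = ennreal (1/2) * ?J" by (rule nn_integral_cmult) simp
  also have "(\<integral>\<^sup>+u. (?e u * indicator {0..} u) * ennreal c \<partial>lborel) = ennreal (c / (2 * L))"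
    using L c nn_integral_exp_decay[of "2 * L" 0]
    by (subst nn_integral_multc) (auto simp: ennreal_mult[symmetric] mult.assoc)
  finally have J: "?J \<le> ennreal (c / (2 * L)) + ennreal (1/2) * ?J" .
  obtain j where j: "?J = ennreal j" "0 \<le> j" using Jfin by (cases ?J) auto
  have "ennreal (c / (2 * L)) + ennreal (1/2) * ennreal j = ennreal (c / (2 * L) + 1/2 * j)"
    using c L j(2) by (subst ennreal_mult[symmetric], simp, simp, subst ennreal_plus[symmetric]) simp_all
  then have "ennreal j \<le> ennreal (c / (2 * L) + 1/2 * j)" using J unfolding j by simp
  then have "j \<le> c / (2 * L) + 1/2 * j"
    using c L j(2) by (subst (asm) ennreal_le_iff) auto
  then have jb: "j \<le> c / L" by (simp add: field_simps)
  have "(\<integral>\<^sup>+u. f u * indicator {0..S} u \<partial>lborel) \<le> (\<integral>\<^sup>+u. ennreal (exp (2 * L * S)) * (?e u * f u * indicator {0..S} u) \<partial>lborel)"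
  proof (intro nn_integral_mono)
    fix u :: real
    show "f u * indicator {0..S} u \<le> ennreal (exp (2 * L * S)) * (?e u * f u * indicator {0..S} u)"
    proof (cases "0 \<le> u \<and> u \<le> S")
      case True
      have "1 \<le> exp (2 * L * S) * exp (- (2 * L) * u)"
        using True L by (simp add: exp_add[symmetric])
      then have "ennreal 1 \<le> ennreal (exp (2 * L * S)) * ?e u"
        by (subst ennreal_mult[symmetric]) (auto intro!: ennreal_leI simp del: ennreal_1)
      from mult_right_mono[OF this, of "f u"] show ?thesis using True by (simp add: mult.assoc)
    qed auto
  qed
  also have "\<dots> = ennreal (exp (2 * L * S)) * ?J" by (rule nn_integral_cmult) simp
  also have "\<dots> \<le> ennreal (exp (2 * L * S)) * ennreal (c / L)"
    unfolding j using jb by (intro mult_left_mono ennreal_leI) auto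
  also have "\<dots> = ennreal (exp (2 * L * S) * (c / L))"
    using c L by (intro ennreal_mult[symmetric]) auto
  finally show ?thesis .
qed

context hawkes_process
begin

section \<open>Compensators of sums over jumps\<close>

text \<open>The jump of \<open>Y\<close> at \<open>T i\<close>.\<close>

definition kick :: "nat \<Rightarrow> 'a \<Rightarrow> real" where "kick i w = \<eta> * xi i w * exp (\<kappa> * T i w)"

lemma kick_nonneg: "w \<in> space M \<Longrightarrow> 1 \<le> i \<Longrightarrow> 0 \<le> kick i w"
  unfolding kick_def by (rule summand_nonneg)

lemma Y_kick: "Y t w = (\<Sum>i=1..N t w. kick i w)"
  unfolding Y_def kick_def ..

text \<open>Needed to exchange expectation and time integral: predictable processes are jointly measurable.
  The indicator removes time zero and negative times, where predictability says nothing.\<close>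

lemma predictable_joint:
  fixes C :: "real \<times> 'a \<Rightarrow> ennreal"
  assumes C: "predictable C"
  shows "(\<lambda>z. C z * indicator {0<..} (fst z)) \<in> borel_measurable (borel \<Otimes>\<^sub>M M)"
proof -
  let ?R = "{0::real<..} \<times> space M"
  have sp: "?R \<inter> space (borel \<Otimes>\<^sub>M M) \<in> sets (borel \<Otimes>\<^sub>M M)"
    by (intro sets.Int pair_measureI) auto
  have "(\<lambda>z. z) \<in> measurable (restrict_space (borel \<Otimes>\<^sub>M M) ?R) (predictable_sigma M F)"
    unfolding predictable_sigma_def
  proof (rule measurable_measure_of[OF predictable_gen_Pow])
    fix B assume "B \<in> {{s<..t} \<times> A | s t A. 0 \<le> s \<and> s \<le> t \<and> A \<in> sets (F s)}"
    then obtain s t A where B: "B = {s<..t} \<times> A" "0 \<le> s" "A \<in> sets (F s)" by blast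
    have A: "A \<in> sets M" using sets_F B by blast
    have "B \<in> sets (borel \<Otimes>\<^sub>M M)" unfolding B using A by (intro pair_measureI) auto
    moreover have "B \<subseteq> ?R" using B sets.sets_into_space[OF A] by auto
    ultimately show "(\<lambda>z. z) -` B \<inter> space (restrict_space (borel \<Otimes>\<^sub>M M) ?R) \<in> sets (restrict_space (borel \<Otimes>\<^sub>M M) ?R)"
      by (subst sets_restrict_space_iff[OF sp]) (auto simp: space_restrict_space space_pair_measure Int_absorb2)
  qed (auto simp: space_restrict_space)
  then have "C \<in> borel_measurable (restrict_space (borel \<Otimes>\<^sub>M M) ?R)"
    using C by (rule measurable_compose)
  then have "(\<lambda>z. C z * indicator ?R z) \<in> borel_measurable (borel \<Otimes>\<^sub>M M)"
    by (subst (asm) borel_measurable_restrict_space_iff_ennreal[OF sp])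
  then show ?thesis
    by (rule measurable_cong[THEN iffD1, rotated]) (auto simp: space_pair_measure indicator_def)
qed

lemma lam_jointM: "(\<lambda>z. lam (max 0 (fst z)) (snd z)) \<in> borel_measurable (borel \<Otimes>\<^sub>M M)"
  by (rule lam_joint) (auto intro: lam_measurable)

lemma Y_jointM: "(\<lambda>z. Y (max 0 (fst z)) (snd z)) \<in> borel_measurable (borel \<Otimes>\<^sub>M M)"
  by (rule Y_joint) (auto intro: lam_measurable)

lemma jump_sum_as_suminf:
  fixes B :: "real \<times> 'a \<Rightarrow> ennreal" and \<phi> :: "real \<Rightarrow> ennreal"
  assumes st: "0 \<le> s" "s \<le> t" and wM: "w \<in> space M"
  shows "(\<Sum>i\<in>{N s w<..N t w}. B (T i w, w) * \<phi> (xi i w)) =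
    (\<Sum>i. if jumps i w then (B (T i w, w) * indicator {s<..t} (T i w)) * \<phi> (xi i w) else 0)"
proof -
  let ?c = "\<lambda>i. if jumps i w then (B (T i w, w) * indicator {s<..t} (T i w)) * \<phi> (xi i w) else 0"
  have A: "{N s w<..N t w} = {i. jumps i w \<and> T i w \<in> {s<..t}}"
    using unit_jump_path.jumps_in_Ioc_nonneg[OF jump_path[OF wM] st] by simp
  have "(\<Sum>i. ?c i) =
    (\<Sum>i\<in>{N s w<..N t w}. ?c i)"
    unfolding A by (rule suminf_finite) (use A in \<open>auto simp: indicator_def intro: finite_subset[of _ "{N s w<..N t w}"]\<close>)
  also have "\<dots> = (\<Sum>i\<in>{N s w<..N t w}. B (T i w, w) * \<phi> (xi i w))"
    unfolding A by (intro sum.cong) auto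
  finally show ?thesis ..
qed

lemma jump_sum_measurable:
  fixes B :: "real \<times> 'a \<Rightarrow> ennreal" and \<phi> :: "real \<Rightarrow> ennreal"
  assumes B[measurable]: "predictable B" and \<phi>[measurable]: "\<phi> \<in> borel_measurable borel"
    and st: "0 \<le> s" "s \<le> t"
  shows "(\<lambda>w. \<Sum>i\<in>{N s w<..N t w}. B (T i w, w) * \<phi> (xi i w)) \<in> borel_measurable M"
proof -
  let ?C = "\<lambda>z. B z * indicator {s<..t} (fst z)"
  note [measurable] = predictable_fst
  have C: "predictable ?C" by measurable
  have "(\<lambda>w. if jumps i w then ?C (T i w, w) * \<phi> (xi i w) else 0) \<in> borel_measurable M" for i
  proof (cases "1 \<le> i")
    case True
    note [measurable] = xi_measurable[OF True]
      measurable_from_subalg[OF strict_past_sub predictable_at_jump_measurable[OF C True]]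
    have "(\<lambda>w. (if jumps i w then ?C (T i w, w) else 0) * \<phi> (xi i w)) \<in> borel_measurable M"
      by measurable
    then show ?thesis by (rule measurable_cong[THEN iffD1, rotated]) auto
  next
    case False then show ?thesis by (simp add: reached_def)
  qed
  then have "(\<lambda>w. \<Sum>i. if jumps i w then ?C (T i w, w) * \<phi> (xi i w) else 0) \<in> borel_measurable M"
    by measurable
  then show ?thesis
    by (rule measurable_cong[THEN iffD2, rotated]) (simp add: jump_sum_as_suminf[OF st] cong: if_cong)
qed

lemma jump_sum_compensator:
  fixes B :: "real \<times> 'a \<Rightarrow> ennreal" and \<phi> :: "real \<Rightarrow> ennreal"
  assumes B: "predictable B" and \<phi>: "\<phi> \<in> borel_measurable borel"
    and st: "0 \<le> s" "s \<le> t"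
  shows "(\<integral>\<^sup>+w. (\<Sum>i\<in>{N s w<..N t w}. B (T i w, w) * \<phi> (xi i w)) \<partial>M) =
    (\<integral>\<^sup>+w. \<phi> (xi 1 w) \<partial>M) *
      (\<integral>\<^sup>+u. (\<integral>\<^sup>+w. B (u, w) * ennreal (lam u w) \<partial>M) * indicator {s..t} u \<partial>lborel)"
proof -
  let ?C = "\<lambda>z. B z * indicator {s<..t} (fst z)"
  let ?h = "\<lambda>u w. (?C (u, w) * indicator {0<..} u) * ennreal (lam (max 0 u) w)"
  note [measurable] = predictable_fst B lam_jointM
  have C: "predictable ?C" by measurable
  have "(\<integral>\<^sup>+w. (\<Sum>i\<in>{N s w<..N t w}. B (T i w, w) * \<phi> (xi i w)) \<partial>M) =
    (\<integral>\<^sup>+w. (\<Sum>i. if jumps i w then ?C (T i w, w) * \<phi> (xi i w) else 0) \<partial>M)"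
    by (intro nn_integral_cong) (simp add: jump_sum_as_suminf[OF st] cong: if_cong)
  also have "\<dots> = (\<integral>\<^sup>+w. \<phi> (xi 1 w) \<partial>M) *
      (\<integral>\<^sup>+w. (\<integral>\<^sup>+u\<in>{0<..}. ?C (u, w) * ennreal (lam u w) \<partial>lborel) \<partial>M)"
    by (rule marked_compensator[OF C \<phi>])
  also have "(\<integral>\<^sup>+w. (\<integral>\<^sup>+u\<in>{0<..}. ?C (u, w) * ennreal (lam u w) \<partial>lborel) \<partial>M) =
      (\<integral>\<^sup>+w. (\<integral>\<^sup>+u. ?h u w \<partial>lborel) \<partial>M)"
    by (intro nn_integral_cong) (auto simp: indicator_def)
  also have "\<dots> = (\<integral>\<^sup>+u. (\<integral>\<^sup>+w. ?h u w \<partial>M) \<partial>lborel)"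
  proof -
    interpret P: pair_sigma_finite lborel M ..
    note [measurable] = predictable_joint[OF C]
    have [measurable]: "(\<lambda>z. (?C z * indicator {0<..} (fst z)) * ennreal (lam (max 0 (fst z)) (snd z)))
        \<in> borel_measurable (borel \<Otimes>\<^sub>M M)"
      by measurable
    have m: "(\<lambda>(u, w). ?h u w)
        \<in> borel_measurable (lborel \<Otimes>\<^sub>M M)"
      using \<open>(\<lambda>z. (?C z * indicator {0<..} (fst z)) * ennreal (lam (max 0 (fst z)) (snd z))) \<in> _\<close>
      by (simp add: split_beta' cong: measurable_cong_sets sets_pair_measure_cong)
    show ?thesis by (rule P.Fubini'[OF m])
  qed
  also have "\<dots> = (\<integral>\<^sup>+u. (\<integral>\<^sup>+w. B (u, w) * ennreal (lam u w) \<partial>M) * indicator {s..t} u \<partial>lborel)"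
    using AE_lborel_singleton[of s]
    by (intro nn_integral_cong_AE, eventually_elim) (use st in \<open>auto simp: indicator_def\<close>)
  finally show ?thesis .
qed

lemma mark_first_moment: "(\<integral>\<^sup>+w. ennreal (xi 1 w) \<partial>M) = ennreal \<mu>"
  and mark_second_moment: "(\<integral>\<^sup>+w. ennreal ((xi 1 w)\<^sup>2) \<partial>M) = ennreal (\<psi>\<^sup>2 + \<mu>\<^sup>2)"
  and mean_nonneg: "0 \<le> \<mu>"
proof -
  have x[measurable]: "xi 1 \<in> borel_measurable M" by (rule xi_measurable) simp
  have sq: "integrable M (\<lambda>w. (xi 1 w)\<^sup>2)" by (rule marks_square_integrable) simp
  have i: "integrable M (xi 1)" by (rule square_integrable_imp_integrable[OF x sq])
  have pos: "AE w in M. 0 \<le> xi 1 w" using marks_pos[of 1] by (intro AE_I2) (auto intro: less_imp_le)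
  show "(\<integral>\<^sup>+w. ennreal (xi 1 w) \<partial>M) = ennreal \<mu>"
    using nn_integral_eq_integral[OF i pos] marks_mean[of 1] by simp
  show "0 \<le> \<mu>" using integral_nonneg_AE[OF pos] marks_mean[of 1] by simp
  have "expectation (\<lambda>w. (xi 1 w)\<^sup>2) = \<psi>\<^sup>2 + \<mu>\<^sup>2"
    using variance_eq[OF i sq] marks_variance[of 1] marks_mean[of 1] by simp
  then show "(\<integral>\<^sup>+w. ennreal ((xi 1 w)\<^sup>2) \<partial>M) = ennreal (\<psi>\<^sup>2 + \<mu>\<^sup>2)"
    using nn_integral_eq_integral[OF sq] by simp
qed

lemma kick_power_split:
  "ennreal (kick i w ^ p) = ennreal ((\<eta> * exp (\<kappa> * T i w)) ^ p) * ennreal (xi i w ^ p)"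
  using eta_pos by (subst ennreal_mult'[symmetric]) (simp_all add: kick_def power_mult_distrib mult_ac)

lemma kick_power_compensator:
  fixes B :: "real \<times> 'a \<Rightarrow> ennreal"
  assumes B: "predictable B" and st: "0 \<le> s" "s \<le> t"
  shows "(\<integral>\<^sup>+w. (\<Sum>i\<in>{N s w<..N t w}. B (T i w, w) * ennreal (kick i w ^ p)) \<partial>M) =
    (\<integral>\<^sup>+w. ennreal (xi 1 w ^ p) \<partial>M) *
    (\<integral>\<^sup>+u. (\<integral>\<^sup>+w. B (u, w) * ennreal ((\<eta> * exp (\<kappa> * u)) ^ p * lam u w) \<partial>M) * indicator {s..t} u \<partial>lborel)"
    (is "?L = _ * ?R")
proof -
  note [measurable] = predictable_fst B
  let ?B = "\<lambda>z. B z * ennreal ((\<eta> * exp (\<kappa> * fst z)) ^ p)"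
  have "?L = (\<integral>\<^sup>+w. (\<Sum>i\<in>{N s w<..N t w}. ?B (T i w, w) * ennreal (xi i w ^ p)) \<partial>M)"
    by (intro nn_integral_cong sum.cong) (simp_all add: kick_power_split mult.assoc)
  also have "\<dots> = (\<integral>\<^sup>+w. ennreal (xi 1 w ^ p) \<partial>M) *
      (\<integral>\<^sup>+u. (\<integral>\<^sup>+w. ?B (u, w) * ennreal (lam u w) \<partial>M) * indicator {s..t} u \<partial>lborel)"
    by (rule jump_sum_compensator[OF _ _ st]) measurable
  also have "(\<integral>\<^sup>+u. (\<integral>\<^sup>+w. ?B (u, w) * ennreal (lam u w) \<partial>M) * indicator {s..t} u \<partial>lborel) = ?R"
    using st eta_pos by (intro nn_integral_cong)
      (auto simp: indicator_def ennreal_mult lam_nonneg mult.assoc intro!: nn_integral_cong)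
  finally show ?thesis .
qed

lemmas kick_sum_compensator = kick_power_compensator[where p=1, unfolded power_one_right mark_first_moment]
lemmas kick_sq_sum_compensator = kick_power_compensator[where p=2, unfolded mark_second_moment]

lemma kick_power_measurable:
  fixes W :: "real \<times> 'a \<Rightarrow> ennreal"
  assumes W[measurable]: "predictable W" and t: "0 \<le> t"
  shows "(\<lambda>w. \<Sum>i\<in>{N 0 w<..N t w}. W (T i w, w) * ennreal (kick i w ^ p)) \<in> borel_measurable M"
proof -
  note [measurable] = predictable_fst
  have "(\<lambda>w. \<Sum>i\<in>{N 0 w<..N t w}. (W (T i w, w) * ennreal ((\<eta> * exp (\<kappa> * T i w)) ^ p)) * ennreal (xi i w ^ p)) \<in> borel_measurable M"
    using jump_sum_measurable[of "\<lambda>z. W z * ennreal ((\<eta> * exp (\<kappa> * fst z)) ^ p)" "\<lambda>x. ennreal (x ^ p)", OF _ _ order_refl t]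
    by simp
  then show ?thesis by (simp add: kick_power_split mult.assoc)
qed

lemmas kick_sum_measurable = kick_power_measurable[where p=1, unfolded power_one_right] kick_power_measurable[where p=2]

end

section \<open>Finiteness of second moments\<close>

text \<open>Squares are summed by parts. The constant \<open>1\<close> makes the square dominate the sum itself, so that a
  single estimate will control first and second moments.\<close>

lemma sum_telescope_square:
  fixes a :: "nat \<Rightarrow> real"
  shows "(1 + (\<Sum>i=1..k. a i))\<^sup>2 = 1 + (\<Sum>i=1..k. 2 * (1 + (\<Sum>j=1..i-1. a j)) * a i + (a i)\<^sup>2)"
proof (induction k)
  case (Suc k)
  have "(1 + (\<Sum>i=1..Suc k. a i))\<^sup>2 =
    (1 + (\<Sum>i=1..k. a i))\<^sup>2 + (2 * (1 + (\<Sum>i=1..k. a i)) * a (Suc k) + (a (Suc k))\<^sup>2)"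
    by (simp add: power2_eq_square algebra_simps)
  then show ?case unfolding Suc by simp
qed simp

context hawkes_process
begin

text \<open>The quantity whose expected value is estimated by Gronwall; it bounds both \<open>Y\<close> and \<open>Y\<^sup>2\<close>.\<close>

definition V :: "real \<Rightarrow> 'a \<Rightarrow> real" where "V u w = (1 + Y u w)\<^sup>2"

abbreviation sq_jump :: "nat \<Rightarrow> 'a \<Rightarrow> ennreal" where
  "sq_jump i w \<equiv> 2 * (1 + Y_left (T i w) w) * ennreal (kick i w) + ennreal ((kick i w)\<^sup>2)"

text \<open>The increment of \<open>V\<close> at a jump involves the value just before it, which is predictable, and the
  mark. This replaces an Ito formula.\<close>

lemma V_sum:
  assumes wM: "w \<in> space M" and t: "0 \<le> t"
  shows "ennreal (V t w) = 1 + (\<Sum>i\<in>{N 0 w<..N t w}. sq_jump i w)"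
proof -
  interpret p: unit_jump_path "\<lambda>t. N t w" by (rule jump_path[OF wM])
  have e: "{N 0 w<..N t w} = {1..N t w}" using p.start by auto
  let ?s = "\<lambda>i. 2 * (1 + (\<Sum>j=1..i-1. kick j w)) * kick i w + (kick i w)\<^sup>2"
  have nn: "0 \<le> (\<Sum>j=1..m. kick j w)" for m
    by (intro sum_nonneg) (auto intro: kick_nonneg[OF wM])
  have term_nn: "0 \<le> ?s i" if "1 \<le> i" for i
    using nn[of "i-1"] kick_nonneg[OF wM that] by simp
  have "ennreal (V t w) = ennreal (1 + (\<Sum>i=1..N t w. ?s i))"
    unfolding V_def Y_kick sum_telescope_square ..
  also have "\<dots> = 1 + (\<Sum>i=1..N t w. ennreal (?s i))"
  proof -
    have "(\<Sum>i=1..N t w. ennreal (?s i)) =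
      ennreal (\<Sum>i=1..N t w. ?s i)"
      by (rule sum_ennreal, rule term_nn) simp
    moreover have "0 \<le> (\<Sum>i=1..N t w. ?s i)"
      by (intro sum_nonneg term_nn) simp
    ultimately show ?thesis by (subst ennreal_plus) auto
  qed
  also have "(\<Sum>i=1..N t w. ennreal (?s i)) =
      (\<Sum>i=1..N t w. sq_jump i w)"
  proof (intro sum.cong refl)
    fix i assume i: "i \<in> {1..N t w}"
    then have j: "jumps i w" using t by (intro p.reachedI[of _ t]) auto
    have Y_left: "Y_left (T i w) w = ennreal (\<Sum>j=1..i-1. kick j w)"
      unfolding Y_left_at_jump[OF wM j] kick_def ..
    have a: "0 \<le> kick i w" using i by (auto intro: kick_nonneg[OF wM])
    have "ennreal (?s i) =
      ennreal 2 * (ennreal 1 + ennreal (\<Sum>j=1..i-1. kick j w)) * ennreal (kick i w) + ennreal ((kick i w)\<^sup>2)"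
      using a nn[of "i-1"] by (simp add: ennreal_mult ennreal_plus del: ennreal_1 ennreal_numeral distrib_left_numeral)
    then show "ennreal (?s i) = sq_jump i w"
      unfolding Y_left by simp
  qed
  finally show ?thesis unfolding e .
qed

lemma Y_left_joint: "(\<lambda>z. Y_left (fst z) (snd z)) \<in> borel_measurable (borel \<Otimes>\<^sub>M M)"
proof -
  have "Y_left u w \<le> 0" if "u \<le> 0" for u w
    unfolding Y_left_def using that by (intro SUP_least) (auto simp: indicator_def)
  then have "Y_left u w * indicator {0<..} u = Y_left u w" for u w
    by (auto simp: indicator_def not_less)
  then show ?thesis using predictable_joint[OF Y_left_predictable] by simp
qed

lemma predictable_F0:
  fixes Z :: "'a \<Rightarrow> ennreal"
  assumes Z: "Z \<in> borel_measurable (F 0)"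
  shows "predictable (\<lambda>z. Z (snd z))"
  by (rule measurable_cong[THEN iffD1, rotated, OF predictable_step[OF order_refl Z]])
    (auto simp: space_predictable)

lemma sq_jump_sum_measurable:
  fixes W :: "real \<times> 'a \<Rightarrow> ennreal"
  assumes W[measurable]: "predictable W" and t: "0 \<le> t"
  shows "(\<lambda>w. \<Sum>i\<in>{N 0 w<..N t w}. W (T i w, w) * sq_jump i w) \<in> borel_measurable M"
proof -
  note [measurable] = Y_left_predictable
  have B: "(\<lambda>z. W z * (2 * (1 + Y_left (fst z) (snd z)))) \<in> borel_measurable (predictable_sigma M F)" by measurable
  note [measurable] = kick_sum_measurable(1)[OF B t] kick_sum_measurable(2)[OF W t]
  have "(\<lambda>w. (\<Sum>i\<in>{N 0 w<..N t w}. (\<lambda>z. W z * (2 * (1 + Y_left (fst z) (snd z)))) (T i w, w) * ennreal (kick i w)) +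
       (\<Sum>i\<in>{N 0 w<..N t w}. W (T i w, w) * ennreal ((kick i w)\<^sup>2))) \<in> borel_measurable M"
    by measurable
  then show ?thesis
    by (simp only: sum.distrib[symmetric] distrib_left[of "W z" for z] mult.assoc fst_conv snd_conv)
qed

lemma V_increment_moment:
  fixes W :: "real \<times> 'a \<Rightarrow> ennreal"
  assumes W[measurable]: "predictable W" and t: "0 \<le> t"
  shows "(\<integral>\<^sup>+w. (\<Sum>i\<in>{N 0 w<..N t w}. W (T i w, w) * sq_jump i w) \<partial>M) =
    ennreal \<mu> * (\<integral>\<^sup>+u. (\<integral>\<^sup>+w. W (u, w) * (2 * (1 + Y_left u w)) * ennreal (\<eta> * exp (\<kappa> * u) * lam u w) \<partial>M)
        * indicator {0..t} u \<partial>lborel) +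
    ennreal (\<psi>\<^sup>2 + \<mu>\<^sup>2) * (\<integral>\<^sup>+u. (\<integral>\<^sup>+w. W (u, w) * ennreal ((\<eta> * exp (\<kappa> * u))\<^sup>2 * lam u w) \<partial>M)
        * indicator {0..t} u \<partial>lborel)"
proof -
  note [measurable] = Y_left_predictable predictable_fst
  let ?B = "\<lambda>z. W z * (2 * (1 + Y_left (fst z) (snd z)))"
  let ?s1 = "\<lambda>w. \<Sum>i\<in>{N 0 w<..N t w}. ?B (T i w, w) * ennreal (kick i w)"
  let ?s2 = "\<lambda>w. \<Sum>i\<in>{N 0 w<..N t w}. W (T i w, w) * ennreal ((kick i w)\<^sup>2)"
  have B: "predictable ?B" by measurable
  have m: "?s2 \<in> borel_measurable M"
    by (rule kick_sum_measurable(2)[OF W t])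
  have m': "?s1 \<in> borel_measurable M"
    by (rule kick_sum_measurable(1)[OF B t])
  have "(\<integral>\<^sup>+w. (\<Sum>i\<in>{N 0 w<..N t w}. W (T i w, w) * sq_jump i w) \<partial>M) =
     (\<integral>\<^sup>+w. ?s1 w +
       ?s2 w \<partial>M)"
    by (intro nn_integral_cong) (simp only: sum.distrib[symmetric] distrib_left[of "W z" for z] mult.assoc fst_conv snd_conv)
  also have "\<dots> = (\<integral>\<^sup>+w. ?s1 w \<partial>M) +
       (\<integral>\<^sup>+w. ?s2 w \<partial>M)"
    by (rule nn_integral_add[OF m' m])
  finally show ?thesis
    unfolding kick_sum_compensator[OF B order_refl t] kick_sq_sum_compensator[OF W order_refl t]
    by simp
qed

text \<open>The test weights that stand in for conditioning on \<open>F\<^sub>0\<close>. They are supported where \<open>lam\<^sub>0\<close> is bounded,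
  since \<open>lam\<^sub>0\<close> need not be integrable.\<close>

definition admissible :: "('a \<Rightarrow> real) \<Rightarrow> real \<Rightarrow> bool" where
  "admissible G K \<longleftrightarrow> G \<in> borel_measurable (F 0) \<and>
    (\<forall>w\<in>space M. 0 \<le> G w \<and> G w \<le> K \<and> (G w \<noteq> 0 \<longrightarrow> lam 0 w \<le> K))"

lemma scaled_lam_eq:
  assumes "0 \<le> u" "w \<in> space M"
  shows "exp (\<kappa> * u) * lam u w = \<theta> * (exp (\<kappa> * u) - 1) + lam 0 w + Y u w"
  using Y_eq[OF assms] by (simp add: algebra_simps)

text \<open>The indicator \<open>I n\<close> of \<open>Y_left \<le> n\<close> is predictable and decreasing in time: it may be moved inside the sum over
  jumps as an upper bound, and it makes the truncated moments finite because \<open>Y\<close> equals its left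
  limit at almost every time. Gronwall then gives a bound that is uniform in \<open>n\<close>, and monotone convergence
  removes the truncation.\<close>

lemma V_moment_finite:
  assumes adm: "admissible G K" and S: "0 \<le> S"
  shows "(\<integral>\<^sup>+w. ennreal (G w * V S w) \<partial>M) < \<infinity>"
proof -
  have G[measurable]: "G \<in> borel_measurable (F 0)" and G0: "\<And>w. w \<in> space M \<Longrightarrow> 0 \<le> G w"
    and GK: "\<And>w. w \<in> space M \<Longrightarrow> G w \<le> K" and lK: "\<And>w. w \<in> space M \<Longrightarrow> G w \<noteq> 0 \<Longrightarrow> lam 0 w \<le> K"
    using adm unfolding admissible_def by auto
  have [measurable]: "G \<in> borel_measurable M" by (rule F_lift[OF order_refl G])
  obtain w0 where "w0 \<in> space M" using not_empty by blast
  then have K: "0 \<le> K" using G0 GK order_trans by blast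
  note [measurable] = Y_left_predictable predictable_fst Y_left_joint Y_jointM
  define I :: "nat \<Rightarrow> real \<Rightarrow> 'a \<Rightarrow> ennreal" where "I n u w = indicator {..of_nat n} (Y_left u w)" for n u w
  have [measurable]: "(\<lambda>z. I n (fst z) (snd z)) \<in> borel_measurable (borel \<Otimes>\<^sub>M M)"
    "predictable (\<lambda>z. I n (fst z) (snd z))" for n
    unfolding I_def by measurable
  have I_le1: "I n u w \<le> 1" for n u w unfolding I_def by (simp add: indicator_def)
  have I_mono: "I n t w \<le> I n u w" if "u \<le> t" for n u t w
    using Y_left_mono[OF that, of w] unfolding I_def by (auto simp: indicator_def)
  \<comment> \<open>chosen so that the rescaled intensity is at most \<open>c (1 + Y)\<close> on the support of \<open>G\<close>; the summand \<open>1\<close> ensures \<open>1 \<le> c\<close>\<close>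
  define c where "c = exp (\<kappa> * S) * \<theta> + K + 1"
  have c1: "1 \<le> c" using K theta_nonneg by (simp add: c_def)
  \<comment> \<open>the rates of the linear and of the quadratic part of a jump, and \<open>1\<close> to make \<open>L\<close> positive\<close>
  define L where "L = \<mu> * (2 * \<eta> * c) + (\<psi>\<^sup>2 + \<mu>\<^sup>2) * (\<eta>\<^sup>2 * exp (\<kappa> * S) * c) + 1"
  have nnL: "0 \<le> \<mu> * (2 * \<eta> * c)" "0 \<le> (\<psi>\<^sup>2 + \<mu>\<^sup>2) * (\<eta>\<^sup>2 * exp (\<kappa> * S) * c)"
    using mean_nonneg eta_pos c1 by auto
  then have L: "0 < L" unfolding L_def by linarith
  let ?g = "\<lambda>n u w. ennreal (G w) * I n u w * ennreal (V (max 0 u) w)"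
  define f where "f n u = (\<integral>\<^sup>+w. ?g n u w \<partial>M)" for n u
  have jm[measurable]: "(\<lambda>z. ?g n (fst z) (snd z)) \<in> borel_measurable (borel \<Otimes>\<^sub>M M)" for n
    unfolding V_def by measurable
  have f_meas[measurable]: "f n \<in> borel_measurable borel" for n
  proof -
    have "(\<lambda>u. \<integral>\<^sup>+w. (\<lambda>(u, w). ?g n u w) (u, w) \<partial>M) \<in> borel_measurable borel"
      by (rule borel_measurable_nn_integral_fst) (use jm[of n] in \<open>simp add: split_beta'\<close>)
    then show ?thesis by (simp add: f_def[abs_def])
  qed
  have lam_bound: "exp (\<kappa> * u) * lam u w \<le> c * (1 + Y u w)"
    if "0 \<le> u" "u \<le> S" "w \<in> space M" "G w \<noteq> 0" for u w
  proof -
    have e: "exp (\<kappa> * u) \<le> exp (\<kappa> * S)" using that kappa_pos by simp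
    have "exp (\<kappa> * u) * lam u w \<le> c + Y u w"
      unfolding scaled_lam_eq[OF that(1,3)] c_def
      using lK[OF that(3,4)] mult_left_mono[OF e theta_nonneg] theta_nonneg
      by (simp add: algebra_simps)
    also have "\<dots> \<le> c * (1 + Y u w)"
      using mult_right_mono[OF c1 Y_nonneg[OF that(3), of u]] by (simp add: algebra_simps)
    finally show ?thesis .
  qed
  have bound: "f n t \<le> ennreal K + ennreal L * (\<integral>\<^sup>+u. f n u * indicator {0..t} u \<partial>lborel)"
    if t: "0 \<le> t" "t \<le> S" for n t
  proof -
    let ?c1 = "ennreal (2 * \<eta> * c)" and ?c2 = "ennreal (\<eta>\<^sup>2 * exp (\<kappa> * S) * c)"
    let ?J = "\<integral>\<^sup>+u. f n u * indicator {0..t} u \<partial>lborel"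
    let ?W = "\<lambda>z. ennreal (G (snd z)) * I n (fst z) (snd z)"
    let ?sum = "\<lambda>w. \<Sum>i\<in>{N 0 w<..N t w}. ?W (T i w, w) * sq_jump i w"
    let ?d1 = "\<lambda>u w. ?W (u, w) * (2 * (1 + Y_left u w)) * ennreal (\<eta> * exp (\<kappa> * u) * lam u w)"
    let ?d2 = "\<lambda>u w. ?W (u, w) * ennreal ((\<eta> * exp (\<kappa> * u))\<^sup>2 * lam u w)"
    have W: "predictable ?W"
    proof -
      have [measurable]: "predictable (\<lambda>z. ennreal (G (snd z)))"
        by (rule predictable_F0) measurable
      show ?thesis by measurable
    qed
    have "f n t \<le> (\<integral>\<^sup>+w. ennreal K + ?sum w \<partial>M)"
      unfolding f_def
    proof (intro nn_integral_mono)
      fix w assume wM: "w \<in> space M"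
      interpret p: unit_jump_path "\<lambda>t. N t w" by (rule jump_path[OF wM])
      have "?g n t w = ennreal (G w) * I n t w + (\<Sum>i\<in>{N 0 w<..N t w}. ennreal (G w) * I n t w * sq_jump i w)"
        using t by (simp add: max_absorb2 V_sum[OF wM] distrib_left sum_distrib_left)
      also have "\<dots> \<le> ennreal K * 1 + ?sum w"
      proof (rule add_mono)
        show "ennreal (G w) * I n t w \<le> ennreal K * 1"
          by (intro mult_mono I_le1 ennreal_leI GK[OF wM]) auto
        show "(\<Sum>i\<in>{N 0 w<..N t w}. ennreal (G w) * I n t w * sq_jump i w) \<le> ?sum w"
          unfolding fst_conv snd_conv
        proof (rule sum_mono)
          fix i assume i: "i \<in> {N 0 w<..N t w}"
          then have j: "jumps i w" using t by (intro p.reachedI[of _ t]) auto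
          have "T i w \<le> t" using p.jump_time_le_iff[OF j t(1)] i by simp
          then show "ennreal (G w) * I n t w * sq_jump i w \<le> ennreal (G w) * I n (T i w) w * sq_jump i w"
            by (intro mult_right_mono mult_left_mono I_mono) auto
        qed
      qed
      finally show "?g n t w \<le> ennreal K + ?sum w" by simp
    qed
    also have "\<dots> = ennreal K + (\<integral>\<^sup>+w. ?sum w \<partial>M)"
      by (subst nn_integral_add[OF _ sq_jump_sum_measurable[OF W t(1)]]) (auto simp: emeasure_space_1)
    also have "\<dots> \<le> ennreal K + ennreal L * ?J"
    proof (intro add_left_mono)
      have lin: "ennreal (G w) * I n u w * X \<le> ennreal d * ?g n u w"
        if "G w \<noteq> 0 \<Longrightarrow> X \<le> ennreal (d * V u w)" "0 \<le> d" "0 \<le> u" for u w X d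
      proof (cases "G w = 0")
        case False
        have "ennreal (d * V u w) = ennreal d * ennreal (V u w)"
          using that(2) by (intro ennreal_mult) (simp_all add: V_def)
        then show ?thesis
          using mult_left_mono[OF that(1)[OF False], of "ennreal (G w) * I n u w"] that(3)
          by (simp add: max_absorb2 mult_ac)
      qed simp
      have jm': "(\<lambda>w. ?g n u w) \<in> borel_measurable M" for u
        using measurable_Pair2[OF jm[of n], of u] by simp
      have 1: "(\<integral>\<^sup>+w. ?d1 u w \<partial>M) * indicator {0..t} u
          \<le> ?c1 * (f n u * indicator {0..t} u)" for u
      proof (cases "0 \<le> u \<and> u \<le> t")
        case True
        then have u: "0 \<le> u" "u \<le> S" using t by auto
        have "(\<integral>\<^sup>+w. ?d1 u w \<partial>M) \<le> (\<integral>\<^sup>+w. ?c1 * ?g n u w \<partial>M)"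
          unfolding fst_conv snd_conv mult.assoc[of "ennreal (G _) * I n u _"]
        proof (intro nn_integral_mono lin)
          fix w assume wM: "w \<in> space M" and nz: "G w \<noteq> 0"
          have "2 * (1 + Y_left u w) \<le> 2 * (1 + ennreal (Y u w))"
            using Y_left_le_Y[OF wM u(1)] by (intro mult_left_mono add_left_mono) auto
          also have "\<dots> = ennreal (2 * (1 + Y u w))"
            using Y_nonneg[OF wM, of u] by (simp add: ennreal_mult ennreal_plus del: ennreal_1 ennreal_numeral distrib_left_numeral flip: ennreal_1 ennreal_numeral)
          finally have "2 * (1 + Y_left u w) * ennreal (\<eta> * exp (\<kappa> * u) * lam u w) \<le>
            ennreal (2 * (1 + Y u w)) * ennreal (\<eta> * exp (\<kappa> * u) * lam u w)" by (rule mult_right_mono) simp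
          also have "\<dots> = ennreal (2 * (1 + Y u w) * (\<eta> * exp (\<kappa> * u) * lam u w))"
            using Y_nonneg[OF wM, of u] by (intro ennreal_mult'[symmetric]) simp
          also have "\<dots> \<le> ennreal (2 * \<eta> * c * V u w)"
          proof (rule ennreal_leI)
            have "2 * (1 + Y u w) * \<eta> * (exp (\<kappa> * u) * lam u w) \<le> 2 * (1 + Y u w) * \<eta> * (c * (1 + Y u w))"
              using Y_nonneg[OF wM, of u] eta_pos by (intro mult_left_mono lam_bound u wM nz) simp
            then show "2 * (1 + Y u w) * (\<eta> * exp (\<kappa> * u) * lam u w) \<le> 2 * \<eta> * c * V u w"
              by (simp add: V_def power2_eq_square algebra_simps)
          qed
          finally show "2 * (1 + Y_left u w) * ennreal (\<eta> * exp (\<kappa> * u) * lam u w) \<le> ennreal (2 * \<eta> * c * V u w)" .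
        qed (use eta_pos c1 u in auto)
        also have "\<dots> = ?c1 * f n u" unfolding f_def by (rule nn_integral_cmult[OF jm'])
        finally show ?thesis using True by simp
      qed auto
      have 2: "(\<integral>\<^sup>+w. ?d2 u w \<partial>M) * indicator {0..t} u
          \<le> ?c2 * (f n u * indicator {0..t} u)" for u
      proof (cases "0 \<le> u \<and> u \<le> t")
        case True
        then have u: "0 \<le> u" "u \<le> S" using t by auto
        have "(\<integral>\<^sup>+w. ?d2 u w \<partial>M) \<le> (\<integral>\<^sup>+w. ?c2 * ?g n u w \<partial>M)"
          unfolding fst_conv snd_conv
        proof (intro nn_integral_mono lin ennreal_leI)
          fix w assume wM: "w \<in> space M" and nz: "G w \<noteq> 0"
          have Y1: "1 \<le> 1 + Y u w" using Y_nonneg[OF wM, of u] by simp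
          have e: "exp (\<kappa> * u) \<le> exp (\<kappa> * S)" using u kappa_pos by simp
          have "(\<eta> * exp (\<kappa> * u))\<^sup>2 * lam u w = (\<eta>\<^sup>2 * exp (\<kappa> * u)) * (exp (\<kappa> * u) * lam u w)"
            by (simp add: power2_eq_square mult_ac)
          also have "\<dots> \<le> (\<eta>\<^sup>2 * exp (\<kappa> * S)) * (c * (1 + Y u w))"
            using e c1 Y1 lam_nonneg[OF u(1) wM] by (intro mult_mono lam_bound u wM nz) auto
          also have "\<dots> \<le> (\<eta>\<^sup>2 * exp (\<kappa> * S)) * (c * ((1 + Y u w) * (1 + Y u w)))"
            using c1 Y1 mult_left_mono[OF Y1, of "1 + Y u w"] by (intro mult_left_mono) auto
          finally show "(\<eta> * exp (\<kappa> * u))\<^sup>2 * lam u w \<le> \<eta>\<^sup>2 * exp (\<kappa> * S) * c * V u w"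
            by (simp add: V_def power2_eq_square mult_ac)
        qed (use c1 u in auto)
        also have "\<dots> = ?c2 * f n u" unfolding f_def by (rule nn_integral_cmult[OF jm'])
        finally show ?thesis using True by simp
      qed auto
      have "(\<integral>\<^sup>+w. ?sum w \<partial>M) \<le>
        ennreal \<mu> * (\<integral>\<^sup>+u. ?c1 * (f n u * indicator {0..t} u) \<partial>lborel) +
        ennreal (\<psi>\<^sup>2 + \<mu>\<^sup>2) * (\<integral>\<^sup>+u. ?c2 * (f n u * indicator {0..t} u) \<partial>lborel)"
        unfolding V_increment_moment[OF W t(1)]
        by (intro add_mono mult_left_mono nn_integral_mono 1 2) auto
      also have "\<dots> = ennreal \<mu> * ?c1 * ?J + ennreal (\<psi>\<^sup>2 + \<mu>\<^sup>2) * ?c2 * ?J"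
        by (simp add: nn_integral_cmult mult.assoc)
      also have "\<dots> = ennreal (\<mu> * (2 * \<eta> * c) + (\<psi>\<^sup>2 + \<mu>\<^sup>2) * (\<eta>\<^sup>2 * exp (\<kappa> * S) * c)) * ?J"
        using nnL mean_nonneg eta_pos c1
        by (subst ennreal_plus, simp, simp, subst (1 2) ennreal_mult, auto simp: distrib_right)
      also have "\<dots> \<le> ennreal L * ?J"
        by (intro mult_right_mono ennreal_leI) (auto simp: L_def)
      finally show "(\<integral>\<^sup>+w. ?sum w \<partial>M) \<le> ennreal L * ?J" .
    qed
    finally show ?thesis .
  qed
  have fin: "(\<integral>\<^sup>+u. f n u * indicator {0..S} u \<partial>lborel) < \<infinity>" for n
  proof -
    interpret P: pair_sigma_finite lborel M ..
    let ?h = "\<lambda>u w. ?g n u w * indicator {0..S} u"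
    have "(\<lambda>z. ?h (fst z) (snd z)) \<in> borel_measurable (borel \<Otimes>\<^sub>M M)" by measurable
    then have hm: "(\<lambda>(u, w). ?h u w) \<in> borel_measurable (lborel \<Otimes>\<^sub>M M)"
      by (simp add: split_beta' cong: measurable_cong_sets sets_pair_measure_cong)
    have "(\<integral>\<^sup>+u. f n u * indicator {0..S} u \<partial>lborel) = (\<integral>\<^sup>+u. (\<integral>\<^sup>+w. ?h u w \<partial>M) \<partial>lborel)"
      unfolding f_def by (intro nn_integral_cong) (auto simp: indicator_def)
    also have "\<dots> = (\<integral>\<^sup>+w. (\<integral>\<^sup>+u. ?h u w \<partial>lborel) \<partial>M)"
      by (rule P.Fubini'[OF hm, symmetric])
    also have "\<dots> \<le> (\<integral>\<^sup>+w. (\<integral>\<^sup>+u. ennreal (K * (1 + real n)\<^sup>2) * indicator {0..S} u \<partial>lborel) \<partial>M)"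
    proof (rule nn_integral_mono, rule nn_integral_mono_AE)
      fix w assume wM: "w \<in> space M"
      show "AE u in lborel. ?h u w \<le> ennreal (K * (1 + real n)\<^sup>2) * indicator {0..S} u"
        using AE_Y_left_eq_Y[OF wM] AE_lborel_singleton[of 0]
      proof eventually_elim
        case (elim u)
        show ?case
        proof (cases "0 < u \<and> u \<le> S \<and> Y_left u w \<le> of_nat n")
          case True
          then have "ennreal (Y u w) \<le> ennreal (real n)" using elim by (simp add: ennreal_of_nat_eq_real_of_nat)
          then have Yn: "Y u w \<le> real n" by (subst (asm) ennreal_le_iff) auto
          have "V u w \<le> (1 + real n)\<^sup>2"
            unfolding V_def using Yn Y_nonneg[OF wM, of u] by (intro power_mono) auto
          then have "G w * V u w \<le> K * (1 + real n)\<^sup>2"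
            using GK[OF wM] K by (intro mult_mono) (auto simp: V_def)
          then show ?thesis using True G0[OF wM]
            by (simp add: I_def ennreal_mult'[symmetric] max_absorb2 ennreal_leI)
        next
          case False
          then show ?thesis using elim by (auto simp: I_def indicator_def)
        qed
      qed
    qed
    also have "\<dots> = ennreal (K * (1 + real n)\<^sup>2) * ennreal S"
      using S by (simp add: nn_integral_cmult_indicator emeasure_space_1)
    also have "\<dots> < \<infinity>" by (simp add: ennreal_mult_less_top)
    finally show ?thesis .
  qed
  have "f n S \<le> ennreal K + ennreal L * ennreal (exp (2 * L * S) * (K / L))" for n
    using order_trans[OF bound[OF S order_refl] add_left_mono[OF mult_left_mono[OF
      gronwall_nn_integral[OF f_meas L K fin bound]]]] by simp
  moreover have "(\<integral>\<^sup>+w. ennreal (G w * V S w) \<partial>M) = (SUP n. f n S)"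
  proof -
    have "(SUP n. f n S) = (\<integral>\<^sup>+w. (SUP n. ?g n S w) \<partial>M)"
      unfolding f_def
    proof (rule nn_integral_monotone_convergence_SUP[symmetric])
      have "I n S w \<le> I m S w" if "n \<le> m" for n m w
        unfolding I_def using that order_trans[of "Y_left S w" "of_nat n" "of_nat m"] by (auto simp: indicator_def)
      then show "incseq (\<lambda>n w. ?g n S w)"
        by (intro incseq_SucI le_funI mult_right_mono mult_left_mono) auto
      show "(\<lambda>w. ?g n S w) \<in> borel_measurable M" for n
        using measurable_Pair2[OF jm[of n], of S] by simp
    qed
    also have "\<dots> = (\<integral>\<^sup>+w. ennreal (G w * V S w) \<partial>M)"
    proof (intro nn_integral_cong antisym)
      fix w assume wM: "w \<in> space M"
      have e: "ennreal (G w * V S w) = ennreal (G w) * ennreal (V (max 0 S) w)"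
        using G0[OF wM] S by (simp add: ennreal_mult' max_absorb2)
      show "(SUP n. ?g n S w) \<le> ennreal (G w * V S w)"
        unfolding e using mult_left_mono[OF I_le1, of "ennreal (G w)"]
        by (intro SUP_least mult_right_mono) auto
      obtain n :: nat where "Y S w \<le> real n" using real_arch_simple by blast
      then have "ennreal (Y S w) \<le> of_nat n" by (simp add: ennreal_of_nat_eq_real_of_nat ennreal_leI)
      then have "I n S w = 1" using order_trans[OF Y_left_le_Y[OF wM S]] by (simp add: I_def)
      then show "ennreal (G w * V S w) \<le> (SUP n. ?g n S w)"
        unfolding e by (intro SUP_upper2[of n]) auto
    qed
    finally show ?thesis ..
  qed
  ultimately have "(\<integral>\<^sup>+w. ennreal (G w * V S w) \<partial>M) \<le> ennreal K + ennreal L * ennreal (exp (2 * L * S) * (K / L))"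
    by (simp add: SUP_least)
  also have "\<dots> < \<infinity>" by (simp add: ennreal_mult_less_top)
  finally show ?thesis .
qed

end

section \<open>Linear Volterra equations\<close>

lemma has_integral_of_nn_integral:
  fixes q :: "real \<Rightarrow> real"
  assumes m: "(\<lambda>u. q u * indicator {a..b} u) \<in> borel_measurable borel"
    and q: "\<And>u. a \<le> u \<Longrightarrow> u \<le> b \<Longrightarrow> 0 \<le> q u"
    and I: "(\<integral>\<^sup>+u. ennreal (q u) * indicator {a..b} u \<partial>lborel) = ennreal r" and r: "0 \<le> r"
  shows "(q has_integral r) {a..b}"
proof -
  have "((\<lambda>u. q u * indicator {a..b} u) has_integral r) UNIV"
  proof (rule nn_integral_has_integral[OF m _ _ r])
    show "0 \<le> q u * indicator {a..b} u" for u using q by (auto simp: indicator_def)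
    have "(\<integral>\<^sup>+u. ennreal (q u * indicator {a..b} u) \<partial>lborel) = (\<integral>\<^sup>+u. ennreal (q u) * indicator {a..b} u \<partial>lborel)"
      by (intro nn_integral_cong) (auto simp: indicator_def)
    then show "(\<integral>\<^sup>+u. ennreal (q u * indicator {a..b} u) \<partial>lborel) = ennreal r" using I by simp
  qed
  also have "(\<lambda>u. q u * indicator {a..b} u) = (\<lambda>u. if u \<in> {a..b} then q u else 0)"
    by (auto simp: indicator_def)
  finally show ?thesis by (subst (asm) has_integral_restrict_UNIV)
qed

text \<open>An integrable solution of the integral equation is automatically continuous, hence
  differentiable; the difference from the given classical solution satisfies \<open>h' = L h\<close>, \<open>h s = 0\<close>.
  This is how explicit moment formulas are verified: only their derivative and initial value have to be checked.\<close>

lemma linear_volterra_unique: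
  fixes f g r :: "real \<Rightarrow> real"
  assumes f: "\<And>t. s \<le> t \<Longrightarrow> ((\<lambda>u. L * f u + r u) has_integral (f t - a)) {s..t}"
    and g0: "g s = a"
    and g: "\<And>t. s \<le> t \<Longrightarrow> (g has_real_derivative L * g t + r t) (at t)"
    and t: "s \<le> t"
  shows "f t = g t"
proof -
  define h where "h u = f u - g u" for u
  have hi: "((\<lambda>u. L * h u) has_integral h v) {s..v}" if v: "s \<le> v" for v
  proof -
    have "((\<lambda>u. L * g u + r u) has_integral (g v - g s)) {s..v}"
      using v g by (intro fundamental_theorem_of_calculus)
        (auto simp: has_real_derivative_iff_has_vector_derivative[symmetric] intro: has_field_derivative_at_within)
    from has_integral_diff[OF f[OF v] this]
    show ?thesis by (simp add: g0 h_def right_diff_distrib)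
  qed
  have hs: "h s = 0" by (rule has_integral_unique[OF hi[OF order_refl] has_integral_null_real]) simp
  have int: "(\<lambda>u. L * h u) integrable_on {s..t}" using hi[OF t] by blast
  have heq: "h v = integral {s..v} (\<lambda>u. L * h u)" if "v \<in> {s..t}" for v
    using integral_unique[OF hi[of v]] that by simp
  have hc: "continuous_on {s..t} h"
    using indefinite_integral_continuous_1[OF int] by (rule continuous_on_eq) (simp add: heq)
  have hd: "(h has_real_derivative L * h v) (at v within {s..t})" if v: "v \<in> {s..t}" for v
  proof -
    have "((\<lambda>x. integral {s..x} (\<lambda>u. L * h u)) has_real_derivative L * h v) (at v within {s..t})"
      using hc v by (intro integral_has_real_derivative continuous_intros)
    then show ?thesis
      by (rule has_field_derivative_transform_within[where d=1]) (use v heq in \<open>auto simp del: integral_mult_right\<close>)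
  qed
  have "((\<lambda>u. exp (- L * u) * h u) has_real_derivative 0) (at v within {s..t})" if "v \<in> {s..t}" for v
    by (rule derivative_eq_intros hd[OF that] refl)+ simp
  from has_field_derivative_zero_constant[OF convex_closed_interval this]
  obtain c where c: "\<And>u. u \<in> {s..t} \<Longrightarrow> exp (- L * u) * h u = c" by blast
  have "c = 0" using c[of s] t hs by simp
  then have "h t = 0" using c[of t] t by simp
  then show ?thesis by (simp add: h_def)
qed

context hawkes_process
begin

section \<open>The first moment of the intensity\<close>

text \<open>The weight \<open>G\<close> is known at time \<open>s\<close>, so after time \<open>s\<close> it is a predictable factor. Weights measurable at
  a positive time are needed for mixed moments.\<close>

lemma first_moment_nn:
  assumes G[measurable]: "G \<in> borel_measurable (F s)" and G0: "\<And>w. w \<in> space M \<Longrightarrow> 0 \<le> G w"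
    and st: "0 \<le> s" "s \<le> t"
  shows "(\<integral>\<^sup>+w. ennreal (G w * (Y t w - Y s w)) \<partial>M) =
    ennreal \<mu> * (\<integral>\<^sup>+u. (\<integral>\<^sup>+w. ennreal (G w * (\<eta> * exp (\<kappa> * u) * lam u w)) \<partial>M) * indicator {s..t} u \<partial>lborel)"
proof -
  \<comment> \<open>equal to \<open>G\<close> at all jumps after \<open>s\<close>, and predictable because it vanishes up to \<open>s\<close>\<close>
  let ?B = "\<lambda>z. ennreal (G (snd z)) * indicator {s<..} (fst z)"
  have B: "predictable ?B"
    by (rule predictable_step[OF st(1)]) measurable
  have "(\<integral>\<^sup>+w. ennreal (G w * (Y t w - Y s w)) \<partial>M) =
    (\<integral>\<^sup>+w. (\<Sum>i\<in>{N s w<..N t w}. ?B (T i w, w) * ennreal (kick i w)) \<partial>M)"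
  proof (intro nn_integral_cong)
    fix w assume wM: "w \<in> space M"
    interpret p: unit_jump_path "\<lambda>t. N t w" by (rule jump_path[OF wM])
    have le: "N s w \<le> N t w" using p.n_mono st by blast
    then have "{1..N t w} = {1..N s w} \<union> {N s w<..N t w}" by auto
    then have "Y t w = Y s w + (\<Sum>i\<in>{N s w<..N t w}. kick i w)"
      unfolding Y_kick by (subst sum.union_disjoint[symmetric]) auto
    then have "ennreal (G w * (Y t w - Y s w)) = ennreal (\<Sum>i\<in>{N s w<..N t w}. G w * kick i w)"
      by (simp add: sum_distrib_left)
    also have "\<dots> = (\<Sum>i\<in>{N s w<..N t w}. ennreal (G w * kick i w))"
      using G0[OF wM] by (intro sum_ennreal[symmetric] mult_nonneg_nonneg kick_nonneg[OF wM]) auto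
    also have "\<dots> = (\<Sum>i\<in>{N s w<..N t w}. ?B (T i w, w) * ennreal (kick i w))"
    proof (intro sum.cong refl)
      fix i assume i: "i \<in> {N s w<..N t w}"
      have "T i w \<in> {s<..t}" using i unfolding p.jumps_in_Ioc_nonneg[OF st, symmetric] by blast
      then show "ennreal (G w * kick i w) = ?B (T i w, w) * ennreal (kick i w)"
        using G0[OF wM] by (simp add: ennreal_mult')
    qed
    finally show "ennreal (G w * (Y t w - Y s w)) = (\<Sum>i\<in>{N s w<..N t w}. ?B (T i w, w) * ennreal (kick i w))" .
  qed
  also have "\<dots> = ennreal \<mu> * (\<integral>\<^sup>+u. (\<integral>\<^sup>+w. ?B (u, w) * ennreal (\<eta> * exp (\<kappa> * u) * lam u w) \<partial>M) * indicator {s..t} u \<partial>lborel)"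
    by (rule kick_sum_compensator[OF B st])
  also have "(\<integral>\<^sup>+u. (\<integral>\<^sup>+w. ?B (u, w) * ennreal (\<eta> * exp (\<kappa> * u) * lam u w) \<partial>M) * indicator {s..t} u \<partial>lborel) =
      (\<integral>\<^sup>+u. (\<integral>\<^sup>+w. ennreal (G w * (\<eta> * exp (\<kappa> * u) * lam u w)) \<partial>M) * indicator {s..t} u \<partial>lborel)"
    using AE_lborel_singleton[of s]
  proof (intro nn_integral_cong_AE, eventually_elim)
    case (elim u)
    have "(\<integral>\<^sup>+w. ?B (u, w) * ennreal (\<eta> * exp (\<kappa> * u) * lam u w) \<partial>M) =
      (\<integral>\<^sup>+w. ennreal (G w * (\<eta> * exp (\<kappa> * u) * lam u w)) \<partial>M)" if "s < u"
      using that by (intro nn_integral_cong) (auto simp: ennreal_mult' G0)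
    then show ?case using elim by (cases "s < u") (auto simp: indicator_def)
  qed
  finally show ?thesis .
qed

lemma joint_expectation_measurable:
  fixes q :: "real \<Rightarrow> 'a \<Rightarrow> real"
  assumes "(\<lambda>z. q (fst z) (snd z)) \<in> borel_measurable (borel \<Otimes>\<^sub>M M)"
  shows "(\<lambda>u. expectation (q u)) \<in> borel_measurable borel"
  proof -
  have "case_prod q \<in> borel_measurable (borel \<Otimes>\<^sub>M M)" using assms by (simp add: split_beta')
  then show ?thesis using borel_measurable_lebesgue_integral[of q borel] by simp
qed

lemma first_moment_has_integral:
  assumes G: "G \<in> borel_measurable (F s)" and G0: "\<And>w. w \<in> space M \<Longrightarrow> 0 \<le> G w"
    and iG: "integrable M G" and iGl: "\<And>u. s \<le> u \<Longrightarrow> integrable M (\<lambda>w. G w * lam u w)"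
    and st: "0 \<le> s" "s \<le> t"
  defines "m \<equiv> \<lambda>u. expectation (\<lambda>w. G w * lam u w)"
  shows "((\<lambda>u. \<eta> * \<mu> * exp (\<kappa> * u) * m u) has_integral
    exp (\<kappa> * t) * (m t - \<theta> * expectation G) - exp (\<kappa> * s) * (m s - \<theta> * expectation G)) {s..t}"
    (is "(_ has_integral ?R) _")
proof -
  define mp where "mp u = expectation (\<lambda>w. G w * lam (max 0 u) w)" for u
  have [measurable]: "mp \<in> borel_measurable borel"
  proof -
    note [measurable] = F_lift[OF st(1) G] lam_jointM
    have "(\<lambda>z. G (snd z) * lam (max 0 (fst z)) (snd z)) \<in> borel_measurable (borel \<Otimes>\<^sub>M M)" by measurable
    from joint_expectation_measurable[OF this] show ?thesis by (simp add: mp_def[abs_def])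
  qed
  have mp: "mp u = m u" if "s \<le> u" for u using that st by (simp add: mp_def m_def max_absorb2)
  let ?I = "\<lambda>u. \<integral>\<^sup>+w. ennreal (G w * (\<eta> * exp (\<kappa> * u) * lam u w)) \<partial>M"
  let ?d = "\<lambda>w. exp (\<kappa> * t) * (G w * lam t w - \<theta> * G w) - exp (\<kappa> * s) * (G w * lam s w - \<theta> * G w)"
  have Ydiff: "G w * (Y t w - Y s w) = ?d w"
    if "w \<in> space M" for w
    using st that by (simp add: Y_eq algebra_simps)
  have int: "integrable M (\<lambda>w. ?d w)"
    using iG iGl st by auto
  have R: "expectation (\<lambda>w. ?d w) = ?R"
    using iG iGl st by (simp add: m_def)
  have nn: "0 \<le> ?d w"
    if "w \<in> space M" for w
    unfolding Ydiff[OF that, symmetric] using G0[OF that] Y_mono[OF that st] by simp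
  have "(\<integral>\<^sup>+w. ennreal (G w * (Y t w - Y s w)) \<partial>M) = ennreal ?R"
    using nn_integral_eq_integral[OF int] nn R by (simp add: Ydiff cong: nn_integral_cong)
  moreover have "ennreal \<mu> * (\<integral>\<^sup>+u. ?I u * indicator {s..t} u \<partial>lborel)
    = (\<integral>\<^sup>+u. ennreal (\<eta> * \<mu> * exp (\<kappa> * u) * m u) * indicator {s..t} u \<partial>lborel)"
  proof -
    have inner: "?I u = ennreal (\<eta> * exp (\<kappa> * u) * m u)" if "s \<le> u" for u
    proof -
      have i: "integrable M (\<lambda>w. \<eta> * exp (\<kappa> * u) * (G w * lam u w))" using iGl[OF that] by simp
      have "AE w in M. 0 \<le> \<eta> * exp (\<kappa> * u) * (G w * lam u w)"
        using eta_pos G0 lam_nonneg[of u] that st by (intro AE_I2) auto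
      from nn_integral_eq_integral[OF i this]
      have "(\<integral>\<^sup>+w. ennreal (\<eta> * exp (\<kappa> * u) * (G w * lam u w)) \<partial>M) = ennreal (\<eta> * exp (\<kappa> * u) * m u)"
        unfolding m_def by simp
      moreover have "?I u =
          (\<integral>\<^sup>+w. ennreal (\<eta> * exp (\<kappa> * u) * (G w * lam u w)) \<partial>M)"
        by (intro nn_integral_cong arg_cong[where f=ennreal] mult.left_commute)
      ultimately show ?thesis by (rule back_subst[where P="\<lambda>x. x = _", OF _ sym])
    qed
    have "(\<integral>\<^sup>+u. ?I u * indicator {s..t} u \<partial>lborel) =
      (\<integral>\<^sup>+u. ennreal (\<eta> * exp (\<kappa> * u) * mp u) * indicator {s..t} u \<partial>lborel)"
      using st by (intro nn_integral_cong) (auto simp: inner indicator_def mp)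
    also have "ennreal \<mu> * \<dots> = (\<integral>\<^sup>+u. ennreal \<mu> * (ennreal (\<eta> * exp (\<kappa> * u) * mp u) * indicator {s..t} u) \<partial>lborel)"
    proof (rule nn_integral_cmult[symmetric])
      show "(\<lambda>u. ennreal (\<eta> * exp (\<kappa> * u) * mp u) * indicator {s..t} u) \<in> borel_measurable lborel"
        by measurable
    qed
    also have "\<dots> = (\<integral>\<^sup>+u. ennreal (\<eta> * \<mu> * exp (\<kappa> * u) * m u) * indicator {s..t} u \<partial>lborel)"
      using st mean_nonneg
      by (intro nn_integral_cong) (auto simp: indicator_def mp ennreal_mult'[symmetric] mult_ac)
    finally show ?thesis .
  qed
  ultimately have I: "(\<integral>\<^sup>+u. ennreal (\<eta> * \<mu> * exp (\<kappa> * u) * m u) * indicator {s..t} u \<partial>lborel) = ennreal ?R"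
    using first_moment_nn[OF G G0 st] by simp
  show ?thesis
  proof (rule has_integral_of_nn_integral[OF _ _ I])
    have "(\<lambda>u. \<eta> * \<mu> * exp (\<kappa> * u) * mp u * indicator {s..t} u) \<in> borel_measurable borel"
      by measurable
    then show "(\<lambda>u. \<eta> * \<mu> * exp (\<kappa> * u) * m u * indicator {s..t} u) \<in> borel_measurable borel"
      by (rule measurable_cong[THEN iffD1, rotated]) (use st in \<open>auto simp: indicator_def mp\<close>)
    show "0 \<le> \<eta> * \<mu> * exp (\<kappa> * u) * m u" if "s \<le> u" "u \<le> t" for u
      unfolding m_def using mean_nonneg eta_pos G0 lam_nonneg that st
      by (intro mult_nonneg_nonneg Bochner_Integration.integral_nonneg) auto
    show "0 \<le> ?R" unfolding R[symmetric] by (rule Bochner_Integration.integral_nonneg) (rule nn)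
  qed
qed

text \<open>In terms of \<open>f u = exp (\<kappa> u) (E[G lam\<^sub>u] - \<theta> E[G])\<close> the integral equation is linear with rate \<open>\<eta> \<mu>\<close>.
  Its solution relaxes exponentially to the stationary level \<open>\<kappa> \<theta> / \<gamma>\<close>.\<close>

lemma first_moment_formula:
  assumes G: "G \<in> borel_measurable (F s)" and G0: "\<And>w. w \<in> space M \<Longrightarrow> 0 \<le> G w"
    and iG: "integrable M G" and iGl: "\<And>u. s \<le> u \<Longrightarrow> integrable M (\<lambda>w. G w * lam u w)"
    and st: "0 \<le> s" "s \<le> t" and \<gamma>: "\<gamma> = \<kappa> - \<eta> * \<mu>" "\<gamma> \<noteq> 0"
  defines "m \<equiv> \<lambda>u. expectation (\<lambda>w. G w * lam u w)" and "b \<equiv> \<kappa> * \<theta> / \<gamma>"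
  shows "m t = b * expectation G + (m s - b * expectation G) * exp (- \<gamma> * (t - s))"
proof -
  let ?e0 = "expectation G"
  define f where "f u = exp (\<kappa> * u) * (m u - \<theta> * ?e0)" for u
  define g where "g u = exp (\<kappa> * u) * (b * ?e0 + (m s - b * ?e0) * exp (- \<gamma> * (u - s)) - \<theta> * ?e0)" for u
  have b: "\<gamma> * b = \<kappa> * \<theta>" using \<gamma> by (simp add: b_def)
  have "f t = g t"
  proof (rule linear_volterra_unique[where f=f and g=g and t=t and L="\<eta> * \<mu>" and r="\<lambda>u. \<eta> * \<mu> * \<theta> * ?e0 * exp (\<kappa> * u)" and s=s and a="f s"])
    show "((\<lambda>u. \<eta> * \<mu> * f u + \<eta> * \<mu> * \<theta> * ?e0 * exp (\<kappa> * u)) has_integral f v - f s) {s..v}" if "s \<le> v" for v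
    proof -
      have "(\<lambda>u. \<eta> * \<mu> * f u + \<eta> * \<mu> * \<theta> * ?e0 * exp (\<kappa> * u)) = (\<lambda>u. \<eta> * \<mu> * exp (\<kappa> * u) * m u)"
        by (auto simp: f_def algebra_simps)
      then show ?thesis
        using first_moment_has_integral[OF G G0 iG iGl st(1) that] by (simp add: f_def m_def)
    qed
    show "g s = f s" by (simp add: f_def g_def)
    show "(g has_real_derivative \<eta> * \<mu> * g v + \<eta> * \<mu> * \<theta> * ?e0 * exp (\<kappa> * v)) (at v)" for v
    proof -
      let ?dg = "\<kappa> * exp (\<kappa> * v) * (b * ?e0 + (m s - b * ?e0) * exp (- \<gamma> * (v - s)) - \<theta> * ?e0)
          + exp (\<kappa> * v) * ((m s - b * ?e0) * (- \<gamma> * exp (- \<gamma> * (v - s))))"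
      have "(g has_real_derivative ?dg) (at v)"
        unfolding g_def[abs_def] by (auto intro!: derivative_eq_intros)
      also have "?dg
        = \<eta> * \<mu> * g v + \<eta> * \<mu> * \<theta> * ?e0 * exp (\<kappa> * v) + exp (\<kappa> * v) * ?e0 * (\<gamma> * b - \<kappa> * \<theta>)"
      proof -
        have "\<kappa> * A * (b * e + (x - b * e) * B - \<theta> * e) + A * ((x - b * e) * (- \<gamma> * B)) =
            \<eta> * \<mu> * (A * (b * e + (x - b * e) * B - \<theta> * e)) + \<eta> * \<mu> * \<theta> * e * A + A * e * (\<gamma> * b - \<kappa> * \<theta>)"
          for A B e x by (simp add: \<gamma>(1) algebra_simps)
        then show ?thesis unfolding g_def .
      qed
      finally show ?thesis by (simp add: b)
    qed
  qed (rule st(2))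
  then show ?thesis by (simp add: f_def g_def)
qed

section \<open>The second moment of the intensity\<close>

lemma admissible_bound_nonneg: "admissible G K \<Longrightarrow> 0 \<le> K"
  using not_empty unfolding admissible_def by force

lemma admissible_measurable: "admissible G K \<Longrightarrow> G \<in> borel_measurable M"
  unfolding admissible_def using F_lift[OF order_refl] by blast

text \<open>The class of weights is stable under multiplication by \<open>lam\<^sub>0\<close>; moments that are mixed with \<open>lam\<^sub>0\<close>
  thereby reduce to plain ones.\<close>

lemma admissible_times_initial:
  assumes "admissible G K" shows "admissible (\<lambda>w. G w * lam 0 w) (max K (K * K))"
proof -
  have [measurable]: "G \<in> borel_measurable (F 0)" "lam 0 \<in> borel_measurable (F 0)"
    using assms lam_adapted[of 0] unfolding admissible_def by auto
  have K: "0 \<le> K" by (rule admissible_bound_nonneg[OF assms])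
  have "0 \<le> G w * lam 0 w \<and> G w * lam 0 w \<le> max K (K * K) \<and>
      (G w * lam 0 w \<noteq> 0 \<longrightarrow> lam 0 w \<le> max K (K * K))" if wM: "w \<in> space M" for w
  proof (cases "G w = 0")
    case True then show ?thesis using K by (simp add: max.coboundedI1)
  next
    case False
    then have "0 \<le> G w" "G w \<le> K" "lam 0 w \<le> K" "0 \<le> lam 0 w"
      using assms wM lam_nonneg[of 0 w] unfolding admissible_def by auto
    moreover from this have "G w * lam 0 w \<le> K * K" using K by (intro mult_mono) auto
    ultimately show ?thesis by (simp add: le_max_iff_disj)
  qed
  then show ?thesis unfolding admissible_def by auto
qed

lemma admissible_integrable:
  assumes adm: "admissible G K"
  shows admissible_integrable_0: "integrable M G"
    and admissible_integrable_V: "0 \<le> u \<Longrightarrow> integrable M (\<lambda>w. G w * V u w)"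
    and admissible_integrable_2: "0 \<le> u \<Longrightarrow> integrable M (\<lambda>w. G w * (lam u w)\<^sup>2)"
    and admissible_integrable_1: "0 \<le> u \<Longrightarrow> integrable M (\<lambda>w. G w * lam u w)"
    and admissible_integrable_11: "0 \<le> u \<Longrightarrow> 0 \<le> v \<Longrightarrow> integrable M (\<lambda>w. G w * (lam u w * lam v w))"
proof -
  have K: "0 \<le> K" by (rule admissible_bound_nonneg[OF adm])
  have [measurable]: "G \<in> borel_measurable M" by (rule admissible_measurable[OF adm])
  have G0: "\<And>w. w \<in> space M \<Longrightarrow> 0 \<le> G w" and GK: "\<And>w. w \<in> space M \<Longrightarrow> G w \<le> K"
    and lK: "\<And>w. w \<in> space M \<Longrightarrow> G w \<noteq> 0 \<Longrightarrow> lam 0 w \<le> K"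
    using adm unfolding admissible_def by auto
  show i0: "integrable M G"
    by (rule integrable_const_bound[where B=K]) (use G0 GK in \<open>auto intro!: AE_I2\<close>)
  show iV: "integrable M (\<lambda>w. G w * V u w)" if "0 \<le> u" for u
  proof (rule integrableI_nonneg)
    have [measurable]: "Y u \<in> borel_measurable M" by (rule Y_measurable_M[OF that])
    show "(\<lambda>w. G w * V u w) \<in> borel_measurable M" unfolding V_def by measurable
    show "(\<integral>\<^sup>+w. ennreal (G w * V u w) \<partial>M) < \<infinity>" by (rule V_moment_finite[OF adm that])
  qed (use G0 in \<open>auto simp: V_def intro!: AE_I2\<close>)
  show i2: "integrable M (\<lambda>w. G w * (lam u w)\<^sup>2)" if u: "0 \<le> u" for u
  proof -
    define c where "c = \<theta> * exp (\<kappa> * u) + K + 1"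
    have c1: "1 \<le> c" using K theta_nonneg by (simp add: c_def)
    have [measurable]: "lam u \<in> borel_measurable M" by (rule lam_measurable[OF u])
    have "integrable M (\<lambda>w. c\<^sup>2 * (G w * V u w))" using iV[OF u] by simp
    then show ?thesis
    proof (rule Bochner_Integration.integrable_bound)
      show "AE w in M. norm (G w * (lam u w)\<^sup>2) \<le> norm (c\<^sup>2 * (G w * V u w))" (is "AE w in M. ?le w")
      proof (rule AE_I2)
        fix w assume wM: "w \<in> space M"
        show "?le w"
        proof (cases "G w = 0")
          case False
          have Y: "0 \<le> Y u w" by (rule Y_nonneg[OF wM])
          have l: "0 \<le> lam u w" by (rule lam_nonneg[OF u wM])
          have "1 * lam u w \<le> exp (\<kappa> * u) * lam u w"
            using u kappa_pos l by (intro mult_right_mono) auto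
          also have "\<dots> \<le> c + Y u w"
            unfolding scaled_lam_eq[OF u wM] c_def using lK[OF wM False] theta_nonneg by (simp add: algebra_simps)
          also have "\<dots> \<le> c * (1 + Y u w)"
            using mult_right_mono[OF c1 Y] by (simp add: algebra_simps)
          finally have "(lam u w)\<^sup>2 \<le> (c * (1 + Y u w))\<^sup>2" using l by (intro power_mono) auto
          then have "(lam u w)\<^sup>2 \<le> c\<^sup>2 * V u w" by (simp add: V_def power_mult_distrib)
          from mult_left_mono[OF this G0[OF wM]] show ?thesis
            using G0[OF wM] by (simp add: V_def abs_mult mult_ac)
        qed simp
      qed
    qed measurable
  qed
  show i11: "integrable M (\<lambda>w. G w * (lam u w * lam v w))" if u: "0 \<le> u" and v: "0 \<le> v" for u v
  proof -
    have [measurable]: "lam u \<in> borel_measurable M" "lam v \<in> borel_measurable M" using u v lam_measurable by auto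
    have "integrable M (\<lambda>w. G w * (lam u w)\<^sup>2 + G w * (lam v w)\<^sup>2)" using i2 u v by simp
    then show ?thesis
    proof (rule Bochner_Integration.integrable_bound)
      show "AE w in M. norm (G w * (lam u w * lam v w)) \<le> norm (G w * (lam u w)\<^sup>2 + G w * (lam v w)\<^sup>2)" (is "AE w in M. ?le w")
      proof (rule AE_I2)
        fix w assume wM: "w \<in> space M"
        have nn: "0 \<le> lam u w" "0 \<le> lam v w" using lam_nonneg u v wM by auto
        have "0 \<le> (lam u w - lam v w)\<^sup>2" "0 \<le> lam u w * lam v w" using nn by auto
        then have "lam u w * lam v w \<le> (lam u w)\<^sup>2 + (lam v w)\<^sup>2"
          unfolding power2_diff by linarith
        from mult_left_mono[OF this G0[OF wM]]
        show "?le w"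
          using G0[OF wM] nn by (simp add: abs_mult distrib_left)
      qed
    qed measurable
  qed
  show "integrable M (\<lambda>w. G w * lam u w)" if u: "0 \<le> u" for u
  proof -
    have [measurable]: "lam u \<in> borel_measurable M" by (rule lam_measurable[OF u])
    have "integrable M (\<lambda>w. G w + G w * (lam u w)\<^sup>2)" using i0 i2[OF u] by simp
    then show ?thesis
    proof (rule Bochner_Integration.integrable_bound)
      show "AE w in M. norm (G w * lam u w) \<le> norm (G w + G w * (lam u w)\<^sup>2)" (is "AE w in M. ?le w")
      proof (rule AE_I2)
        fix w assume wM: "w \<in> space M"
        have nn: "0 \<le> lam u w" using lam_nonneg u wM by auto
        have "0 \<le> (lam u w - 1)\<^sup>2" by simp
        then have "lam u w \<le> 1 + (lam u w)\<^sup>2" unfolding power2_diff using nn by simp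
        from mult_left_mono[OF this G0[OF wM]]
        show "?le w"
          using G0[OF wM] nn by (simp add: abs_mult distrib_left)
      qed
    qed measurable
  qed
qed

lemma AE_AE_Y_left_eq_Y: "AE u in lborel. AE w in M. 0 < u \<longrightarrow> Y_left u w = ennreal (Y (max 0 u) w)"
proof -
  interpret P: pair_sigma_finite lborel M ..
  note [measurable] = Y_left_joint Y_jointM
  have "Measurable.pred (borel \<Otimes>\<^sub>M M) (\<lambda>z. 0 < fst z \<longrightarrow> Y_left (fst z) (snd z) = ennreal (Y (max 0 (fst z)) (snd z)))"
    by measurable
  then have m: "{z \<in> space (lborel \<Otimes>\<^sub>M M). 0 < fst z \<longrightarrow> Y_left (fst z) (snd z) = ennreal (Y (max 0 (fst z)) (snd z))} \<in> sets (lborel \<Otimes>\<^sub>M M)"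
    unfolding pred_def by (simp add: space_pair_measure cong: sets_pair_measure_cong)
  have "AE w in M. AE u in lborel. 0 < u \<longrightarrow> Y_left u w = ennreal (Y (max 0 u) w)"
  proof (rule AE_I2)
    fix w assume wM: "w \<in> space M"
    show "AE u in lborel. 0 < u \<longrightarrow> Y_left u w = ennreal (Y (max 0 u) w)"
      using AE_Y_left_eq_Y[OF wM] by eventually_elim (auto simp: max_absorb2)
  qed
  then show ?thesis using P.AE_commute[OF m] by simp
qed

text \<open>The compensated form of \<open>V_sum\<close>, with the left limits in the integrand replaced by values.\<close>

lemma V_moment_has_integral:
  assumes adm: "admissible G K" and t: "0 \<le> t"
  shows "((\<lambda>u. 2 * \<eta> * \<mu> * exp (\<kappa> * u) * expectation (\<lambda>w. G w * ((1 + Y u w) * lam u w))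
      + \<eta>\<^sup>2 * (\<psi>\<^sup>2 + \<mu>\<^sup>2) * (exp (\<kappa> * u))\<^sup>2 * expectation (\<lambda>w. G w * lam u w))
    has_integral (expectation (\<lambda>w. G w * V t w) - expectation G)) {0..t}"
proof -
  have Gm[measurable]: "G \<in> borel_measurable M" by (rule admissible_measurable[OF adm])
  have GF: "G \<in> borel_measurable (F 0)" and G0: "\<And>w. w \<in> space M \<Longrightarrow> 0 \<le> G w"
    using adm unfolding admissible_def by auto
  define q1 where "q1 u = expectation (\<lambda>w. G w * ((1 + Y (max 0 u) w) * lam (max 0 u) w))" for u
  define q2 where "q2 u = expectation (\<lambda>w. G w * lam (max 0 u) w)" for u
  let ?d1 = "\<lambda>u w. ennreal (G w) * (2 * (1 + Y_left u w)) * ennreal (\<eta> * exp (\<kappa> * u) * lam u w)"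
  let ?d2 = "\<lambda>u w. ennreal (G w) * ennreal ((\<eta> * exp (\<kappa> * u))\<^sup>2 * lam u w)"
  let ?q = "\<lambda>u. 2 * \<eta> * \<mu> * exp (\<kappa> * u) * q1 u + \<eta>\<^sup>2 * (\<psi>\<^sup>2 + \<mu>\<^sup>2) * (exp (\<kappa> * u))\<^sup>2 * q2 u"
  let ?q1 = "\<lambda>u. 2 * \<eta> * exp (\<kappa> * u) * q1 u"
  let ?q2 = "\<lambda>u. (\<eta> * exp (\<kappa> * u))\<^sup>2 * q2 u"
  let ?p1 = "\<lambda>u w. 2 * \<eta> * exp (\<kappa> * u) * (G w * ((1 + Y u w) * lam u w))"
  let ?p2 = "\<lambda>u w. (\<eta> * exp (\<kappa> * u))\<^sup>2 * (G w * lam u w)"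
  let ?sum = "\<lambda>w. (\<Sum>i\<in>{N 0 w<..N t w}. ennreal (G w) * sq_jump i w)"
  have [measurable]: "q1 \<in> borel_measurable borel" "q2 \<in> borel_measurable borel"
  proof -
    note [measurable] = lam_jointM Y_jointM
    have "(\<lambda>z. G (snd z) * ((1 + Y (max 0 (fst z)) (snd z)) * lam (max 0 (fst z)) (snd z))) \<in> borel_measurable (borel \<Otimes>\<^sub>M M)"
      by measurable
    from joint_expectation_measurable[OF this] show "q1 \<in> borel_measurable borel" by (simp add: q1_def[abs_def])
    have "(\<lambda>z. G (snd z) * lam (max 0 (fst z)) (snd z)) \<in> borel_measurable (borel \<Otimes>\<^sub>M M)" by measurable
    from joint_expectation_measurable[OF this] show "q2 \<in> borel_measurable borel" by (simp add: q2_def[abs_def])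
  qed
  have q_nn: "0 \<le> q1 u" "0 \<le> q2 u" for u
    unfolding q1_def q2_def using G0 Y_nonneg lam_nonneg by (auto intro!: Bochner_Integration.integral_nonneg)
  have i1: "integrable M (\<lambda>w. G w * ((1 + Y u w) * lam u w))" if "0 \<le> u" for u
  proof -
    have "integrable M (\<lambda>w. exp (\<kappa> * u) * (G w * (lam u w)\<^sup>2) + (1 + \<theta> - exp (\<kappa> * u) * \<theta>) * (G w * lam u w) - G w * (lam 0 w * lam u w))"
      using that admissible_integrable[OF adm] by simp
    then show ?thesis
      by (rule Bochner_Integration.integrable_cong[THEN iffD1, rotated -1, OF _ refl])
        (simp add: Y_eq[OF that] power2_eq_square algebra_simps)
  qed
  have W: "predictable (\<lambda>z. ennreal (G (snd z)))"
    by (rule predictable_F0) (use GF in measurable)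
  have "ennreal (expectation (\<lambda>w. G w * V t w)) = (\<integral>\<^sup>+w. ennreal (G w * V t w) \<partial>M)"
    using nn_integral_eq_integral[OF admissible_integrable_V[OF adm t]] G0 by (simp add: V_def)
  also have "\<dots> = (\<integral>\<^sup>+w. ennreal (G w) + ?sum w \<partial>M)"
  proof (intro nn_integral_cong)
    fix w assume wM: "w \<in> space M"
    have "ennreal (G w * V t w) = ennreal (G w) * ennreal (V t w)" using G0[OF wM] by (rule ennreal_mult')
    then show "ennreal (G w * V t w) = ennreal (G w) + ?sum w"
      by (simp only: V_sum[OF wM t] distrib_left[of "ennreal (G w)" 1] sum_distrib_left mult_1_right)
  qed
  also have "\<dots> = ennreal (expectation G) + (\<integral>\<^sup>+w. ?sum w \<partial>M)"
  proof -
    have "(\<integral>\<^sup>+w. ennreal (G w) \<partial>M) = ennreal (expectation G)"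
      using nn_integral_eq_integral[OF admissible_integrable_0[OF adm]] G0 by simp
    then show ?thesis using sq_jump_sum_measurable[OF W t] by (subst nn_integral_add) auto
  qed
  also have "(\<integral>\<^sup>+w. ?sum w \<partial>M) =
    ennreal \<mu> * (\<integral>\<^sup>+u. (\<integral>\<^sup>+w. ?d1 u w \<partial>M)
        * indicator {0..t} u \<partial>lborel) +
    ennreal (\<psi>\<^sup>2 + \<mu>\<^sup>2) * (\<integral>\<^sup>+u. (\<integral>\<^sup>+w. ?d2 u w \<partial>M)
        * indicator {0..t} u \<partial>lborel)"
    using V_increment_moment[OF W t] by simp
  also have "(\<integral>\<^sup>+u. (\<integral>\<^sup>+w. ?d1 u w \<partial>M) * indicator {0..t} u \<partial>lborel)
      = (\<integral>\<^sup>+u. ennreal (?q1 u) * indicator {0..t} u \<partial>lborel)"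
    using AE_AE_Y_left_eq_Y AE_lborel_singleton[of "0::real"]
  proof (intro nn_integral_cong_AE, eventually_elim)
    case (elim u)
    show ?case
    proof (cases "0 < u \<and> u \<le> t")
      case True
      then have u: "0 \<le> u" "max 0 u = u" by auto
      have "(\<integral>\<^sup>+w. ?d1 u w \<partial>M) =
          (\<integral>\<^sup>+w. ennreal (?p1 u w) \<partial>M)"
      proof (rule nn_integral_cong_AE)
        show "AE w in M. ?d1 u w =
            ennreal (?p1 u w)"
          using elim(3) AE_space[of M]
        proof eventually_elim
          case (elim w)
          then have wM: "w \<in> space M" and Y_left: "Y_left u w = ennreal (Y u w)" using True u by auto
          have Y: "0 \<le> Y u w" by (rule Y_nonneg[OF wM])
          have "2 * (1 + Y_left u w) = ennreal (2 * (1 + Y u w))"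
            unfolding Y_left using Y
            by (simp add: ennreal_mult ennreal_plus del: ennreal_1 ennreal_numeral distrib_left_numeral flip: ennreal_1 ennreal_numeral)
          then have "?d1 u w =
              ennreal (G w * (2 * (1 + Y u w)) * (\<eta> * exp (\<kappa> * u) * lam u w))"
            using G0[OF wM] Y by (simp only:) (subst ennreal_mult', simp, subst ennreal_mult', simp_all)
          also have "G w * (2 * (1 + Y u w)) * (\<eta> * exp (\<kappa> * u) * lam u w) = ?p1 u w"
            by (simp only: mult_ac)
          finally show ?case .
        qed
      qed
      also have "\<dots> = ennreal (expectation (\<lambda>w. ?p1 u w))"
        by (rule nn_integral_eq_integral)
          (use i1[OF u(1)] eta_pos G0 Y_nonneg lam_nonneg[OF u(1)] in \<open>auto intro!: AE_I2 mult_nonneg_nonneg\<close>)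
      also have "expectation (\<lambda>w. ?p1 u w) = ?q1 u"
        unfolding q1_def u(2) by (rule integral_mult_right_zero)
      finally show ?thesis by simp
    next
      case False
      then show ?thesis using elim by (auto simp: indicator_def)
    qed
  qed
  also have "(\<integral>\<^sup>+u. (\<integral>\<^sup>+w. ?d2 u w \<partial>M) * indicator {0..t} u \<partial>lborel) =
    (\<integral>\<^sup>+u. ennreal (?q2 u) * indicator {0..t} u \<partial>lborel)"
  proof (intro nn_integral_cong)
    fix u :: real
    show "(\<integral>\<^sup>+w. ?d2 u w \<partial>M) * indicator {0..t} u =
      ennreal (?q2 u) * indicator {0..t} u"
    proof (cases "0 \<le> u \<and> u \<le> t")
      case True
      then have u: "0 \<le> u" "max 0 u = u" by auto
      have "(\<integral>\<^sup>+w. ?d2 u w \<partial>M) =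
          (\<integral>\<^sup>+w. ennreal (?p2 u w) \<partial>M)"
        using G0 by (intro nn_integral_cong) (simp add: ennreal_mult'[symmetric] mult.left_commute)
      also have "\<dots> = ennreal (expectation (\<lambda>w. ?p2 u w))"
        by (rule nn_integral_eq_integral)
          (use admissible_integrable_1[OF adm u(1)] G0 lam_nonneg[OF u(1)] in \<open>auto intro!: AE_I2 mult_nonneg_nonneg\<close>)
      also have "expectation (\<lambda>w. ?p2 u w) = ?q2 u"
        unfolding q2_def u(2) by (rule integral_mult_right_zero)
      finally show ?thesis by simp
    qed auto
  qed
  also have "ennreal \<mu> * (\<integral>\<^sup>+u. ennreal (?q1 u) * indicator {0..t} u \<partial>lborel) +
    ennreal (\<psi>\<^sup>2 + \<mu>\<^sup>2) * (\<integral>\<^sup>+u. ennreal (?q2 u) * indicator {0..t} u \<partial>lborel) =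
    (\<integral>\<^sup>+u. ennreal \<mu> * (ennreal (?q1 u) * indicator {0..t} u) +
      ennreal (\<psi>\<^sup>2 + \<mu>\<^sup>2) * (ennreal (?q2 u) * indicator {0..t} u) \<partial>lborel)"
    by (subst nn_integral_add) (simp_all add: nn_integral_cmult)
  also have "\<dots> = (\<integral>\<^sup>+u. ennreal (?q u) * indicator {0..t} u \<partial>lborel)"
  proof (intro nn_integral_cong)
    fix u :: real
    have nn: "0 \<le> \<mu> * (?q1 u)" "0 \<le> (\<psi>\<^sup>2 + \<mu>\<^sup>2) * (?q2 u)"
      using mean_nonneg eta_pos q_nn by auto
    have "?q u =
      \<mu> * (?q1 u) + (\<psi>\<^sup>2 + \<mu>\<^sup>2) * (?q2 u)"
      by (simp add: power_mult_distrib)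
    then have "ennreal (?q u) =
      ennreal \<mu> * ennreal (?q1 u) + ennreal (\<psi>\<^sup>2 + \<mu>\<^sup>2) * ennreal (?q2 u)"
      using nn mean_nonneg by (simp only: ennreal_plus[OF nn]) (subst (1 2) ennreal_mult', auto)
    then show "ennreal \<mu> * (ennreal (?q1 u) * indicator {0..t} u) +
      ennreal (\<psi>\<^sup>2 + \<mu>\<^sup>2) * (ennreal (?q2 u) * indicator {0..t} u) =
      ennreal (?q u) * indicator {0..t} u"
      by (simp only: distrib_right mult.assoc)
  qed
  finally have E: "ennreal (expectation (\<lambda>w. G w * V t w)) = ennreal (expectation G) +
     (\<integral>\<^sup>+u. ennreal (?q u) * indicator {0..t} u \<partial>lborel)"
    (is "_ = _ + ?I") .
  have e0: "0 \<le> expectation G" by (rule Bochner_Integration.integral_nonneg) (rule G0)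
  have "ennreal (expectation G) + ?I < \<infinity>" unfolding E[symmetric] by simp
  then obtain r where r: "?I = ennreal r" "0 \<le> r" by (cases ?I) auto
  have "expectation (\<lambda>w. G w * V t w) = expectation G + r"
  proof -
    have "0 \<le> expectation (\<lambda>w. G w * V t w)"
      by (rule Bochner_Integration.integral_nonneg) (auto simp: V_def G0)
    moreover have "ennreal (expectation (\<lambda>w. G w * V t w)) = ennreal (expectation G + r)"
      using E r e0 by (simp add: ennreal_plus)
    ultimately show ?thesis using r e0 by (subst (asm) ennreal_inj) auto
  qed
  then have r': "r = expectation (\<lambda>w. G w * V t w) - expectation G" by simp
  have "((\<lambda>u. ?q u) has_integral r) {0..t}"
    by (rule has_integral_of_nn_integral[OF _ _ r(1) r(2)])
      (use q_nn eta_pos mean_nonneg in \<open>auto intro!: add_nonneg_nonneg mult_nonneg_nonneg\<close>)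
  then show ?thesis unfolding r'
    by (rule has_integral_eq[rotated]) (auto simp: q1_def q2_def max_absorb2)
qed

text \<open>Written out, \<open>V\<close> is a quadratic polynomial in \<open>lam\<^sub>t\<close> and \<open>lam\<^sub>0\<close>. Subtracting suitable multiples of the
  first-moment equations for the weights \<open>G\<close> and \<open>G lam\<^sub>0\<close> removes all terms mixed with \<open>lam\<^sub>0\<close> and leaves a
  linear equation for \<open>X u = exp (\<kappa> u)\<^sup>2 E[G (lam\<^sub>u - \<theta>)\<^sup>2]\<close> whose forcing term involves only the known first
  moment. The numbers \<open>\<alpha>\<close> and \<open>\<alpha>2\<close> are the weighted first and second moments of \<open>lam\<^sub>0 - b\<close>.\<close>

lemma second_moment_formula:
  assumes adm: "admissible G K" and t: "0 \<le> t" and \<gamma>: "\<gamma> = \<kappa> - \<eta> * \<mu>" "\<gamma> \<noteq> 0"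
    and b: "b = \<kappa> * \<theta> / \<gamma>" and \<rho>: "\<rho> = \<eta>\<^sup>2 * (\<psi>\<^sup>2 + \<mu>\<^sup>2)"
    and e0: "e0 = expectation G"
    and \<alpha>: "\<alpha> = expectation (\<lambda>w. G w * lam 0 w) - b * e0"
    and \<alpha>2: "\<alpha>2 = expectation (\<lambda>w. G w * (lam 0 w)\<^sup>2) - 2 * b * expectation (\<lambda>w. G w * lam 0 w) + b\<^sup>2 * e0"
  shows "expectation (\<lambda>w. G w * lam t w) = b * e0 + \<alpha> * exp (- \<gamma> * t)" (is "?first")
    and "expectation (\<lambda>w. G w * (lam t w)\<^sup>2) =
      b\<^sup>2 * e0 + 2 * b * \<alpha> * exp (- \<gamma> * t) + \<alpha>2 * (exp (- \<gamma> * t))\<^sup>2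
      + \<rho> * (b * e0 * (1 - (exp (- \<gamma> * t))\<^sup>2) / (2 * \<gamma>) + \<alpha> * (exp (- \<gamma> * t) - (exp (- \<gamma> * t))\<^sup>2) / \<gamma>)" (is "?second")
proof -
  have GF: "G \<in> borel_measurable (F 0)" and G0: "\<And>w. w \<in> space M \<Longrightarrow> 0 \<le> G w"
    using adm unfolding admissible_def by auto
  note adm' = admissible_times_initial[OF adm]
  have GF': "(\<lambda>w. G w * lam 0 w) \<in> borel_measurable (F 0)"
    and G0': "\<And>w. w \<in> space M \<Longrightarrow> 0 \<le> G w * lam 0 w"
    using adm' unfolding admissible_def by auto
  note int = admissible_integrable[OF adm] and int' = admissible_integrable[OF adm']
  define m where "m u = expectation (\<lambda>w. G w * lam u w)" for u
  define q where "q u = expectation (\<lambda>w. G w * lam 0 w * lam u w)" for u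
  define v where "v u = expectation (\<lambda>w. G w * (lam u w)\<^sup>2)" for u
  \<comment> \<open>the explicit candidates for the first and second moment are \<open>mm\<close> and \<open>vv\<close>; \<open>g\<close> is built from them as \<open>X\<close> is from the moments\<close>
  define mm where "mm u = b * e0 + \<alpha> * exp (- \<gamma> * u)" for u
  have m_eq: "m u = mm u" if "0 \<le> u" for u
    using first_moment_formula[OF GF G0 int(1) int(4) order_refl that \<gamma>]
    by (simp add: m_def mm_def b e0 \<alpha>)
  show ?first using m_eq[OF t] by (simp add: m_def mm_def)
  define vv where "vv u = b\<^sup>2 * e0 + 2 * b * \<alpha> * exp (- \<gamma> * u) + \<alpha>2 * (exp (- \<gamma> * u))\<^sup>2
      + \<rho> * (b * e0 * (1 - (exp (- \<gamma> * u))\<^sup>2) / (2 * \<gamma>) + \<alpha> * (exp (- \<gamma> * u) - (exp (- \<gamma> * u))\<^sup>2) / \<gamma>)" for u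
  define X where "X u = (exp (\<kappa> * u))\<^sup>2 * (v u - 2 * \<theta> * m u + \<theta>\<^sup>2 * e0)" for u
  define g where "g u = (exp (\<kappa> * u))\<^sup>2 * (vv u - 2 * \<theta> * mm u + \<theta>\<^sup>2 * e0)" for u
  define r where "r u = 2 * \<eta> * \<mu> * (exp (\<kappa> * u))\<^sup>2 * (\<theta> * mm u - \<theta>\<^sup>2 * e0) + \<rho> * (exp (\<kappa> * u))\<^sup>2 * mm u" for u
  have Y1: "1 + Y u w = exp (\<kappa> * u) * lam u w - lam 0 w + (1 + \<theta> - exp (\<kappa> * u) * \<theta>)"
    if "0 \<le> u" "w \<in> space M" for u w
    using that by (simp add: Y_eq algebra_simps)
  have V_exp: "expectation (\<lambda>w. G w * V u w) = (exp (\<kappa> * u))\<^sup>2 * v u + v 0 + (1 + \<theta> - exp (\<kappa> * u) * \<theta>)\<^sup>2 * e0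
      - 2 * exp (\<kappa> * u) * q u + 2 * exp (\<kappa> * u) * (1 + \<theta> - exp (\<kappa> * u) * \<theta>) * m u
      - 2 * (1 + \<theta> - exp (\<kappa> * u) * \<theta>) * m 0" if u: "0 \<le> u" for u
  proof -
    let ?e = "exp (\<kappa> * u)" and ?k = "1 + \<theta> - exp (\<kappa> * u) * \<theta>"
    let ?r = "\<lambda>w. ?e\<^sup>2 * (G w * (lam u w)\<^sup>2) + G w * (lam 0 w)\<^sup>2 + ?k\<^sup>2 * G w
      - 2 * ?e * (G w * lam 0 w * lam u w) + 2 * ?e * ?k * (G w * lam u w) - 2 * ?k * (G w * lam 0 w)"
    have square: "c * (e * l - i + k)\<^sup>2 = e\<^sup>2 * (c * l\<^sup>2) + c * i\<^sup>2 + k\<^sup>2 * c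
        - 2 * e * (c * i * l) + 2 * e * k * (c * l) - 2 * k * (c * i)" for c e l i k :: real
      by (simp add: power2_eq_square algebra_simps)
    have "expectation (\<lambda>w. G w * V u w) = expectation (\<lambda>w. ?r w)"
    proof (rule Bochner_Integration.integral_cong[OF refl])
      fix w assume "w \<in> space M"
      from Y1[OF u this] show "G w * V u w = ?r w"
        unfolding V_def by (simp only: square)
    qed
    also have "\<dots> = ?e\<^sup>2 * v u + v 0 + ?k\<^sup>2 * e0 - 2 * ?e * q u + 2 * ?e * ?k * m u - 2 * ?k * m 0"
      using int int' u unfolding v_def m_def q_def e0 by simp
    finally show ?thesis .
  qed
  have drift: "expectation (\<lambda>w. G w * ((1 + Y u w) * lam u w)) =
      exp (\<kappa> * u) * v u - q u + (1 + \<theta> - exp (\<kappa> * u) * \<theta>) * m u" if u: "0 \<le> u" for u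
  proof -
    let ?e = "exp (\<kappa> * u)" and ?k = "1 + \<theta> - exp (\<kappa> * u) * \<theta>"
    let ?r = "\<lambda>w. ?e * (G w * (lam u w)\<^sup>2) - G w * lam 0 w * lam u w + ?k * (G w * lam u w)"
    have product: "c * ((e * l - i + k) * l) = e * (c * l\<^sup>2) - c * i * l + k * (c * l)" for c e l i k :: real
      by (simp add: power2_eq_square algebra_simps)
    have "expectation (\<lambda>w. G w * ((1 + Y u w) * lam u w)) =
      expectation (\<lambda>w. ?r w)"
    proof (rule Bochner_Integration.integral_cong[OF refl])
      fix w assume "w \<in> space M"
      from Y1[OF u this] show "G w * ((1 + Y u w) * lam u w) = ?r w"
        by (simp only: product)
    qed
    also have "\<dots> = ?e * v u - q u + ?k * m u"
      using int int' u unfolding v_def m_def q_def by simp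
    finally show ?thesis .
  qed
  have XI: "((\<lambda>u. 2 * \<eta> * \<mu> * X u + r u) has_integral (X z - X 0)) {0..z}" if z: "0 \<le> z" for z
  proof -
    let ?val = "(expectation (\<lambda>w. G w * V z w) - e0) + 2 * (exp (\<kappa> * z) * (q z - \<theta> * m 0) - (q 0 - \<theta> * m 0))
        - 2 * (1 + \<theta>) * (exp (\<kappa> * z) * (m z - \<theta> * e0) - (m 0 - \<theta> * e0))"
    have I1: "((\<lambda>u. 2 * \<eta> * \<mu> * exp (\<kappa> * u) * (exp (\<kappa> * u) * v u - q u + (1 + \<theta> - exp (\<kappa> * u) * \<theta>) * m u)
        + \<rho> * (exp (\<kappa> * u))\<^sup>2 * m u) has_integral (expectation (\<lambda>w. G w * V z w) - e0)) {0..z}"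
      using V_moment_has_integral[OF adm z] unfolding e0[symmetric] \<rho>[symmetric] m_def[symmetric]
      by (rule has_integral_eq[rotated]) (simp add: drift)
    have I2: "((\<lambda>u. \<eta> * \<mu> * exp (\<kappa> * u) * m u) has_integral
        exp (\<kappa> * z) * (m z - \<theta> * e0) - (m 0 - \<theta> * e0)) {0..z}"
      using first_moment_has_integral[OF GF G0 int(1) int(4) order_refl z] by (simp add: m_def e0)
    have I3: "((\<lambda>u. \<eta> * \<mu> * exp (\<kappa> * u) * q u) has_integral
        exp (\<kappa> * z) * (q z - \<theta> * m 0) - (q 0 - \<theta> * m 0)) {0..z}"
      using first_moment_has_integral[OF GF' G0' int'(1) int'(4) order_refl z] by (simp add: m_def q_def)
    have q0: "q 0 = v 0" unfolding q_def v_def by (simp add: power2_eq_square mult.assoc)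
    have "((\<lambda>u. 2 * \<eta> * \<mu> * X u + r u) has_integral
        ?val) {0..z}"
    proof (rule has_integral_eq[OF _ has_integral_diff[OF has_integral_add[OF I1 has_integral_mult_right[OF I3, of 2]]
          has_integral_mult_right[OF I2, of "2 * (1 + \<theta>)"]]])
      fix u assume u: "u \<in> {0..z}"
      then have mu: "mm u = m u" using m_eq by simp
      show "2 * \<eta> * \<mu> * exp (\<kappa> * u) * (exp (\<kappa> * u) * v u - q u + (1 + \<theta> - exp (\<kappa> * u) * \<theta>) * m u)
        + \<rho> * (exp (\<kappa> * u))\<^sup>2 * m u + 2 * (\<eta> * \<mu> * exp (\<kappa> * u) * q u) - 2 * (1 + \<theta>) * (\<eta> * \<mu> * exp (\<kappa> * u) * m u)
        = 2 * \<eta> * \<mu> * X u + r u"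
      proof -
        have "2 * \<eta> * \<mu> * e * (e * v' - q' + (1 + \<theta> - e * \<theta>) * m') + \<rho> * e\<^sup>2 * m' + 2 * (\<eta> * \<mu> * e * q')
            - 2 * (1 + \<theta>) * (\<eta> * \<mu> * e * m') =
          2 * \<eta> * \<mu> * (e\<^sup>2 * (v' - 2 * \<theta> * m' + \<theta>\<^sup>2 * e0)) +
            (2 * \<eta> * \<mu> * e\<^sup>2 * (\<theta> * m' - \<theta>\<^sup>2 * e0) + \<rho> * e\<^sup>2 * m')" for e v' q' m' :: real
          by (simp add: power2_eq_square algebra_simps)
        then show ?thesis unfolding X_def r_def mu .
      qed
    qed
    moreover have "?val = X z - X 0"
    proof -
      have "(e\<^sup>2 * v' + v0 + (1 + \<theta> - e * \<theta>)\<^sup>2 * e0 - 2 * e * q' + 2 * e * (1 + \<theta> - e * \<theta>) * m' - 2 * (1 + \<theta> - e * \<theta>) * m0 - e0)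
          + 2 * (e * (q' - \<theta> * m0) - (v0 - \<theta> * m0)) - 2 * (1 + \<theta>) * (e * (m' - \<theta> * e0) - (m0 - \<theta> * e0)) =
        e\<^sup>2 * (v' - 2 * \<theta> * m' + \<theta>\<^sup>2 * e0) - 1\<^sup>2 * (v0 - 2 * \<theta> * m0 + \<theta>\<^sup>2 * e0)" for e v' v0 q' m' m0 :: real
        by (simp add: power2_eq_square algebra_simps)
      then show ?thesis unfolding V_exp[OF z] X_def q0 mult_zero_right exp_zero .
    qed
    ultimately show ?thesis by simp
  qed
  have gb: "\<gamma> * b = \<kappa> * \<theta>" using \<gamma> by (simp add: b)
  have "X t = g t"
  proof (rule linear_volterra_unique[where f=X and g=g and t=t and L="2 * \<eta> * \<mu>" and r=r and s=0 and a="X 0"])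
    show "((\<lambda>u. 2 * \<eta> * \<mu> * X u + r u) has_integral X z - X 0) {0..z}" if "0 \<le> z" for z by (rule XI[OF that])
    have "vv 0 = v 0" unfolding vv_def v_def \<alpha>2 \<alpha> by (simp add: power2_eq_square algebra_simps)
    then show "g 0 = X 0" using m_eq[of 0] by (simp add: g_def X_def)
    show "(g has_real_derivative 2 * \<eta> * \<mu> * g z + r z) (at z)" for z
    proof -
      let ?E = "exp (- \<gamma> * z)" and ?e = "exp (\<kappa> * z)"
      define dv where "dv = - 2 * b * \<alpha> * \<gamma> * ?E - 2 * \<gamma> * \<alpha>2 * ?E\<^sup>2 + \<rho> * (b * e0 * ?E\<^sup>2 - \<alpha> * ?E + 2 * \<alpha> * ?E\<^sup>2)"
      have dE: "((\<lambda>u. exp (- \<gamma> * u)) has_real_derivative - \<gamma> * ?E) (at z)"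
        by (auto intro!: derivative_eq_intros)
      have dE2: "((\<lambda>u. (exp (- \<gamma> * u))\<^sup>2) has_real_derivative - 2 * \<gamma> * ?E\<^sup>2) (at z)"
        by (auto intro!: derivative_eq_intros simp: power2_eq_square)
      have dve: "dv = 0 + 2 * b * \<alpha> * (- \<gamma> * ?E) + \<alpha>2 * (- 2 * \<gamma> * ?E\<^sup>2)
        + \<rho> * (b * e0 * (0 - - 2 * \<gamma> * ?E\<^sup>2) / (2 * \<gamma>) + \<alpha> * (- \<gamma> * ?E - - 2 * \<gamma> * ?E\<^sup>2) / \<gamma>)"
        using \<gamma>(2) unfolding dv_def by (simp add: field_simps)
      have dvv: "(vv has_real_derivative dv) (at z)"
        unfolding vv_def[abs_def] dve
        by (intro DERIV_add DERIV_cmult DERIV_const DERIV_cdivide DERIV_diff dE dE2)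
      have dmm: "(mm has_real_derivative \<alpha> * (- \<gamma> * ?E)) (at z)"
        unfolding mm_def[abs_def] using DERIV_add[OF DERIV_const DERIV_cmult[OF dE]] by simp
      have de: "((\<lambda>u. (exp (\<kappa> * u))\<^sup>2) has_real_derivative 2 * \<kappa> * ?e\<^sup>2) (at z)"
        by (auto intro!: derivative_eq_intros simp: power2_eq_square)
      let ?dg = "(2 * \<kappa> * ?e\<^sup>2) * (vv z - 2 * \<theta> * mm z + \<theta>\<^sup>2 * e0)
          + (dv - 2 * \<theta> * (\<alpha> * (- \<gamma> * ?E)) + 0) * ?e\<^sup>2"
      have dg: "(g has_real_derivative ?dg) (at z)"
        unfolding g_def[abs_def]
        by (intro DERIV_mult DERIV_add DERIV_diff DERIV_cmult DERIV_const de dvv dmm)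
      \<comment> \<open>the differential equation of the second moment, \<open>v' = - 2 \<gamma> v + (2 \<kappa> \<theta> + \<rho>) m\<close>\<close>
      have dv_eq: "dv = - 2 * \<gamma> * vv z + 2 * (\<gamma> * b) * mm z + \<rho> * mm z"
        using \<gamma>(2) unfolding dv_def vv_def mm_def by (simp add: field_simps power2_eq_square)
      have dm_eq: "\<alpha> * (- \<gamma> * ?E) = (\<gamma> * b) * e0 - \<gamma> * mm z"
        unfolding mm_def by (simp add: algebra_simps)
      have p: "\<eta> * \<mu> = \<kappa> - \<gamma>" using \<gamma>(1) by simp
      have "?dg
         = 2 * \<eta> * \<mu> * g z + r z"
      proof -
        have "(2 * \<kappa> * e2) * (v' - 2 * \<theta> * m' + \<theta>\<^sup>2 * e0) +
            (- 2 * \<gamma> * v' + 2 * (\<kappa> * \<theta>) * m' + \<rho> * m' - 2 * \<theta> * ((\<kappa> * \<theta>) * e0 - \<gamma> * m') + 0) * e2 =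
          2 * (\<kappa> - \<gamma>) * (e2 * (v' - 2 * \<theta> * m' + \<theta>\<^sup>2 * e0)) +
            (2 * (\<kappa> - \<gamma>) * e2 * (\<theta> * m' - \<theta>\<^sup>2 * e0) + \<rho> * e2 * m')" for e2 v' m' :: real
          by (simp add: power2_eq_square algebra_simps)
        then show ?thesis unfolding dm_eq dv_eq gb g_def r_def mult.assoc[of 2 \<eta> \<mu>] p .
      qed
      then show ?thesis using dg by simp
    qed
  qed (rule t)
  then have "v t - 2 * \<theta> * m t + \<theta>\<^sup>2 * e0 = vv t - 2 * \<theta> * mm t + \<theta>\<^sup>2 * e0"
    unfolding X_def g_def by (subst (asm) mult_cancel_left) simp
  then have "v t = vv t" using m_eq[OF t] by simp
  then show ?second
    unfolding v_def vv_def .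
qed

text \<open>The first-moment formula started at time \<open>s\<close> with the weight \<open>G lam\<^sub>s\<close> reduces the mixed moment to
  moments at time \<open>s\<close>.\<close>

lemma joint_moment_formula:
  assumes adm: "admissible G K" and st: "0 \<le> s" "s \<le> t" and \<gamma>: "\<gamma> = \<kappa> - \<eta> * \<mu>" "\<gamma> \<noteq> 0"
    and b: "b = \<kappa> * \<theta> / \<gamma>" and \<rho>: "\<rho> = \<eta>\<^sup>2 * (\<psi>\<^sup>2 + \<mu>\<^sup>2)"
    and e0: "e0 = expectation G"
    and \<alpha>: "\<alpha> = expectation (\<lambda>w. G w * lam 0 w) - b * e0"
    and \<alpha>2: "\<alpha>2 = expectation (\<lambda>w. G w * (lam 0 w)\<^sup>2) - 2 * b * expectation (\<lambda>w. G w * lam 0 w) + b\<^sup>2 * e0"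
  shows "expectation (\<lambda>w. G w * (lam s w * lam t w)) =
      b\<^sup>2 * e0 + b * \<alpha> * (exp (- \<gamma> * s) + exp (- \<gamma> * t)) + \<alpha>2 * exp (- \<gamma> * (t + s))
      + \<rho> * (b * e0 * (exp (- \<gamma> * (t - s)) - exp (- \<gamma> * (t + s))) / (2 * \<gamma>) + \<alpha> * (exp (- \<gamma> * t) - exp (- \<gamma> * (t + s))) / \<gamma>)"
proof -
  note mom = second_moment_formula[OF adm st(1) \<gamma> b \<rho> e0 \<alpha> \<alpha>2]
  note int = admissible_integrable[OF adm]
  have GF: "G \<in> borel_measurable (F s)" "lam s \<in> borel_measurable (F s)" and G0: "\<And>w. w \<in> space M \<Longrightarrow> 0 \<le> G w"
    using adm F0_lift[OF st(1)] lam_adapted[OF st(1)] unfolding admissible_def by auto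
  have "expectation (\<lambda>w. (G w * lam s w) * lam t w) = b * expectation (\<lambda>w. G w * lam s w)
     + (expectation (\<lambda>w. (G w * lam s w) * lam s w) - b * expectation (\<lambda>w. G w * lam s w)) * exp (- \<gamma> * (t - s))"
    unfolding b
  proof (rule first_moment_formula[OF _ _ _ _ st \<gamma>])
    show "(\<lambda>w. G w * lam s w) \<in> borel_measurable (F s)" using GF by measurable
    show "0 \<le> G w * lam s w" if "w \<in> space M" for w using G0 lam_nonneg[OF st(1)] that by simp
    show "integrable M (\<lambda>w. G w * lam s w)" by (rule int(4)[OF st(1)])
    show "integrable M (\<lambda>w. G w * lam s w * lam u w)" if "s \<le> u" for u
      using int(5)[OF st(1), of u] that st by (simp add: mult.assoc)
  qed
  then have J: "expectation (\<lambda>w. G w * (lam s w * lam t w)) = b * expectation (\<lambda>w. G w * lam s w)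
     + (expectation (\<lambda>w. G w * (lam s w)\<^sup>2) - b * expectation (\<lambda>w. G w * lam s w)) * exp (- \<gamma> * (t - s))"
    by (simp add: mult.assoc power2_eq_square)
  \<comment> \<open>all exponentials are monomials in these two\<close>
  define A where "A = exp (- \<gamma> * s)"
  define B where "B = exp (- \<gamma> * (t - s))"
  have t': "exp (- \<gamma> * t) = A * B" and p: "exp (- \<gamma> * (t + s)) = A * A * B"
    unfolding A_def B_def by (simp_all add: exp_add[symmetric] algebra_simps)
  show ?thesis
    unfolding J mom p t' A_def[symmetric] B_def[symmetric]
    using \<gamma>(2) by (simp add: field_simps power2_eq_square)
qed

end

section \<open>Conditional expectations determined locally\<close>

lemma (in prob_space) sigma_finite_subalgebraI:
  assumes "subalgebra M H" shows "sigma_finite_subalgebra M H"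
proof -
  have "finite_measure_subalgebra M H"
    by (intro finite_measure_subalgebra.intro finite_measure_axioms finite_measure_subalgebra_axioms.intro assms)
  then show ?thesis by (rule finite_measure_subalgebra_is_sigma_finite)
qed

text \<open>For an indicator, pulling out a known factor holds for
  every measurable function, because it holds for the conditional expectations of positive and
  negative part.\<close>

lemma (in sigma_finite_subalgebra) real_cond_exp_indicator:
  assumes A[measurable]: "A \<in> sets F" and f[measurable]: "f \<in> borel_measurable M"
  shows "AE x in M. real_cond_exp M F (\<lambda>x. indicator A x * f x) x = indicator A x * real_cond_exp M F f x"
proof -
  have e: "ennreal (indicator A x * f x) = indicator A x * ennreal (f x)"
    "ennreal (- (indicator A x * f x)) = indicator A x * ennreal (- f x)" for x
    by (auto simp: indicator_def)
  have "AE x in M. indicator A x * nn_cond_exp M F (\<lambda>x. ennreal (f x)) x = nn_cond_exp M F (\<lambda>x. indicator A x * ennreal (f x)) x"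
    "AE x in M. indicator A x * nn_cond_exp M F (\<lambda>x. ennreal (- f x)) x = nn_cond_exp M F (\<lambda>x. indicator A x * ennreal (- f x)) x"
    by (rule nn_cond_exp_prod; measurable)+
  then show ?thesis
    unfolding real_cond_exp_def e
    by eventually_elim (auto simp: indicator_def split: if_splits)
qed

text \<open>A conditional expectation is determined by its restriction to sets of the conditioning \<open>\<sigma>\<close>-algebra
  that exhaust the space, so integrability is only needed locally.\<close>

lemma (in sigma_finite_subalgebra) real_cond_exp_charact_local:
  fixes A :: "nat \<Rightarrow> 'a set"
  assumes A: "\<And>k. A k \<in> sets F" and cover: "(\<Union>k. A k) = space M"
    and f[measurable]: "f \<in> borel_measurable M" and g[measurable]: "g \<in> borel_measurable F"
    and intf: "\<And>k B. B \<in> sets F \<Longrightarrow> B \<subseteq> A k \<Longrightarrow> integrable M (\<lambda>x. indicator B x * f x)"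
    and intg: "\<And>k B. B \<in> sets F \<Longrightarrow> B \<subseteq> A k \<Longrightarrow> integrable M (\<lambda>x. indicator B x * g x)"
    and eq: "\<And>k B. B \<in> sets F \<Longrightarrow> B \<subseteq> A k \<Longrightarrow> (\<integral>x. indicator B x * f x \<partial>M) = (\<integral>x. indicator B x * g x \<partial>M)"
  shows "AE x in M. real_cond_exp M F f x = g x"
proof -
  have "AE x in M. indicator (A k) x * real_cond_exp M F f x = indicator (A k) x * g x" for k
  proof -
    note [measurable] = A[of k]
    have "AE x in M. real_cond_exp M F (\<lambda>x. indicator (A k) x * f x) x = indicator (A k) x * g x"
    proof (rule real_cond_exp_charact)
      fix B assume B: "B \<in> sets F"
      have BA: "B \<inter> A k \<in> sets F" "B \<inter> A k \<subseteq> A k" using B A by auto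
      have "(\<integral>x\<in>B. indicator (A k) x * h x \<partial>M) = (\<integral>x. indicator (B \<inter> A k) x * h x \<partial>M)" for h :: "'a \<Rightarrow> real"
        unfolding set_lebesgue_integral_def by (intro Bochner_Integration.integral_cong) (auto simp: indicator_def)
      then show "(\<integral>x\<in>B. indicator (A k) x * f x \<partial>M) = (\<integral>x\<in>B. indicator (A k) x * g x \<partial>M)"
        using eq[OF BA] by simp
    qed (use intf[OF A order_refl] intg[OF A order_refl] in auto)
    with real_cond_exp_indicator[OF A[of k] f] show ?thesis by eventually_elim auto
  qed
  then have "AE x in M. \<forall>k. indicator (A k) x * real_cond_exp M F f x = indicator (A k) x * g x"
    by (subst AE_all_countable) blast
  with AE_space show ?thesis
  proof eventually_elim
    case (elim x)
    then obtain k where "x \<in> A k" using cover by blast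
    then show ?case using elim(2)[rule_format, of k] by simp
  qed
qed

section \<open>Evaluation at independent times\<close>

lemma (in prob_space) indep_set_mono:
  assumes "indep_set A B" "A' \<subseteq> A" "B' \<subseteq> B" shows "indep_set A' B'"
  using assms unfolding indep_set_def by (rule_tac indep_sets_mono_sets) (auto split: bool.split)

lemma sets_vimage_algebra_mono:
  assumes "X \<in> measurable H S" "space H = Om"
  shows "sets (vimage_algebra Om X S) \<subseteq> sets H"
  using assms measurable_space[OF assms(1)]
  by (subst sets_vimage_algebra2) (auto intro: measurable_sets)

lemma process_sigma_measurable:
  assumes t: "0 \<le> t" and X: "X t \<in> space M \<rightarrow> space S"
  shows "X t \<in> measurable (process_sigma M X S) S"
    and "space (process_sigma M X S) = space M"
proof -
  let ?U = "\<Union>t\<in>{0..}. sets (vimage_algebra (space M) (X t) S)"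
  have U: "?U \<subseteq> Pow (space M)"
    using sets.sets_into_space[of _ "vimage_algebra (space M) (X _) S"] by (auto simp: )
  show sp: "space (process_sigma M X S) = space M"
    unfolding process_sigma_def by (rule space_measure_of[OF U])
  show "X t \<in> measurable (process_sigma M X S) S"
  proof (rule measurableI)
    show "X t w \<in> space S" if "w \<in> space (process_sigma M X S)" for w
      using that X unfolding sp by blast
    fix B assume "B \<in> sets S"
    then have "X t -` B \<inter> space M \<in> ?U" using t by (auto intro!: in_vimage_algebra)
    then show "X t -` B \<inter> space (process_sigma M X S) \<in> sets (process_sigma M X S)"
      unfolding sp unfolding process_sigma_def sets_measure_of[OF U] by (rule sigma_sets.Basic)
  qed
qed

context hawkes_process
begin

abbreviation \<H> :: "'a measure" where "\<H> \<equiv> hawkes_sigma M F N lam"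

lemma hawkes_sigma_facts:
  shows space_hawkes_sigma: "space \<H> = space M"
    and F0_hawkes_sigma: "sets (F 0) \<subseteq> sets \<H>"
    and lam_hawkes_sigma: "0 \<le> q \<Longrightarrow> lam q \<in> borel_measurable \<H>"
proof -
  let ?U = "sets (F 0) \<union> sets (process_sigma M N (count_space UNIV)) \<union> sets (process_sigma M lam borel)"
  have spN: "space (process_sigma M N (count_space UNIV)) = space M"
    by (rule process_sigma_measurable(2)[of 0]) auto
  have spl: "space (process_sigma M lam borel) = space M"
    by (rule process_sigma_measurable(2)[of 0]) auto
  have U: "?U \<subseteq> Pow (space M)"
    using sets.space_closed[of "F 0"] sets.space_closed[of "process_sigma M N (count_space UNIV)"]
      sets.space_closed[of "process_sigma M lam borel"] unfolding spN spl space_F[OF order_refl] by simp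
  show sp: "space \<H> = space M"
    unfolding hawkes_sigma_def by (rule space_measure_of[OF U])
  have gen: "?U \<subseteq> sets \<H>"
    unfolding hawkes_sigma_def sets_measure_of[OF U] by (rule sigma_sets_superset_generator)
  then show "sets (F 0) \<subseteq> sets \<H>" by blast
  show "lam q \<in> borel_measurable \<H>" if "0 \<le> q"
  proof -
    have "lam q \<in> measurable (process_sigma M lam borel) borel"
      by (rule process_sigma_measurable(1)[OF that]) auto
    moreover have "sets (process_sigma M lam borel) \<subseteq> sets \<H>" using gen by blast
    ultimately show ?thesis unfolding measurable_def spl sp by auto
  qed
qed

abbreviation \<B> :: "(real \<times> real) measure" where "\<B> \<equiv> borel \<Otimes>\<^sub>M borel"

text \<open>Freezing the clock \<open>Z\<close>. The formula \<open>J\<close> for deterministic times is assumed only for ordered pairs,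
  since the mixed moment depends on which time comes first. Nonnegativity of \<open>h\<close> lets integrability be
  a conclusion.\<close>

lemma time_change_expectation:
  fixes Z :: "'a \<Rightarrow> real \<times> real" and h :: "real \<times> real \<Rightarrow> 'a \<Rightarrow> real" and J :: "real \<times> real \<Rightarrow> real"
  assumes Z[measurable]: "Z \<in> measurable M \<B>"
    and H: "subalgebra M H"
    and ind: "indep_set (sets (vimage_algebra (space M) Z \<B>)) (sets H)"
    and order: "AE w in M. 0 \<le> fst (Z w) \<and> fst (Z w) \<le> snd (Z w)"
    and h: "(\<lambda>p. h (fst p) (snd p)) \<in> borel_measurable (\<B> \<Otimes>\<^sub>M H)"
    and h0: "\<And>z w. w \<in> space M \<Longrightarrow> 0 \<le> h z w"
    and J[measurable]: "J \<in> borel_measurable \<B>" and JZ: "integrable M (\<lambda>w. J (Z w))"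
    and inth: "\<And>u v. 0 \<le> u \<Longrightarrow> u \<le> v \<Longrightarrow> integrable M (h (u, v))"
    and hJ: "\<And>u v. 0 \<le> u \<Longrightarrow> u \<le> v \<Longrightarrow> expectation (h (u, v)) = J (u, v)"
  shows "integrable M (\<lambda>w. h (Z w) w)" "expectation (\<lambda>w. h (Z w) w) = expectation (\<lambda>w. J (Z w))"
proof -
  have inner: "(\<integral>\<^sup>+w. ennreal (h z w) \<partial>M) = ennreal (J z) \<and> 0 \<le> J z" if "0 \<le> fst z \<and> fst z \<le> snd z" for z
  proof -
    have z: "0 \<le> fst z" "fst z \<le> snd z" using that by auto
    have "(\<integral>\<^sup>+w. ennreal (h (fst z, snd z) w) \<partial>M) = ennreal (expectation (h (fst z, snd z)))"
      by (rule nn_integral_eq_integral[OF inth[OF z]]) (auto intro!: AE_I2 h0)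
    moreover have "0 \<le> expectation (h (fst z, snd z))"
      by (rule Bochner_Integration.integral_nonneg) (rule h0)
    ultimately show ?thesis using hJ[OF z] by simp
  qed
  have Jnn: "AE w in M. 0 \<le> J (Z w)" using order by eventually_elim (use inner in blast)
  have "(\<integral>\<^sup>+w. ennreal (h (Z w) w) \<partial>M) = (\<integral>\<^sup>+z. \<integral>\<^sup>+w. ennreal (h z w) \<partial>M \<partial>distr M \<B> Z)"
    using nn_integral_independent_freeze[OF Z H ind, of "\<lambda>p. ennreal (h (fst p) (snd p))"] h by simp
  also have "\<dots> = (\<integral>\<^sup>+z. ennreal (J z) \<partial>distr M \<B> Z)"
  proof (rule nn_integral_cong_AE)
    have "AE z in distr M \<B> Z. 0 \<le> fst z \<and> fst z \<le> snd z"
    proof (subst AE_distr_iff[OF Z])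
      show "{z \<in> space \<B>. 0 \<le> fst z \<and> fst z \<le> (snd z :: real)} \<in> sets \<B>"
        by measurable
    qed (rule order)
    then show "AE z in distr M \<B> Z. (\<integral>\<^sup>+w. ennreal (h z w) \<partial>M) = ennreal (J z)"
      by eventually_elim (use inner in blast)
  qed
  also have "\<dots> = (\<integral>\<^sup>+w. ennreal (J (Z w)) \<partial>M)" by (rule nn_integral_distr) auto
  also have "\<dots> = ennreal (expectation (\<lambda>w. J (Z w)))"
    by (rule nn_integral_eq_integral[OF JZ Jnn])
  finally have E: "(\<integral>\<^sup>+w. ennreal (h (Z w) w) \<partial>M) = ennreal (expectation (\<lambda>w. J (Z w)))" .
  have J0: "0 \<le> expectation (\<lambda>w. J (Z w))"
    by (rule integral_nonneg_AE[OF Jnn])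
  have "(\<lambda>w. w) \<in> measurable M H" by (rule measurable_from_subalg[OF H]) simp
  then have "(\<lambda>w. (Z w, w)) \<in> measurable M (\<B> \<Otimes>\<^sub>M H)" using Z by measurable
  from measurable_compose[OF this h] have m: "(\<lambda>w. h (Z w) w) \<in> borel_measurable M" by simp
  have nn: "AE w in M. 0 \<le> h (Z w) w" by (auto intro!: AE_I2 h0)
  show i: "integrable M (\<lambda>w. h (Z w) w)" by (rule integrableI_nn_integral_finite[OF m nn E])
  show "expectation (\<lambda>w. h (Z w) w) = expectation (\<lambda>w. J (Z w))"
    using E J0 Bochner_Integration.integral_nonneg[of M "\<lambda>w. h (Z w) w"] h0
    by (simp add: nn_integral_eq_integral[OF i nn])
qed

end

section \<open>The inverse of a tempered stable subordinator\<close>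

text \<open>By Markov's inequality a path stays below \<open>t\<close> up to time \<open>n\<close> with probability at most
  \<open>exp t E[exp (- D\<^sub>n)]\<close>, which decays geometrically in \<open>n\<close> by the Laplace transform at \<open>1\<close>.\<close>

lemma (in tempered_stable_subordinator) unbounded_AE: "AE w in M. \<exists>r\<ge>0. t < D r w"
proof -
  define c where "c = (1 + \<nu>) powr \<beta> - \<nu> powr \<beta>"
  have c: "0 < c" unfolding c_def using nu_pos beta_range powr_less_mono2[of \<beta> \<nu> "1 + \<nu>"] by simp
  let ?B = "{w\<in>space M. \<forall>n::nat. D (real n) w \<le> t}"
  have [measurable]: "D (real n) \<in> borel_measurable M" for n by (rule random_variable) simp
  have Bm: "?B \<in> sets M" by measurable
  have D0: "0 \<le> D (real n) w" if "w \<in> space M" for n w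
    using mono_onD[OF paths_mono[OF that], of 0 "real n"] start[OF that] by simp
  have le: "prob ?B \<le> exp t * exp (- c * real n)" for n
  proof -
    have i: "integrable M (\<lambda>w. exp (- D (real n) w))"
      by (rule integrable_const_bound[where B=1]) (use D0 in \<open>auto intro!: AE_I2\<close>)
    have "prob ?B = expectation (indicator ?B)" using Bm by simp
    also have "\<dots> \<le> expectation (\<lambda>w. exp t * exp (- D (real n) w))"
    proof (rule integral_mono)
      show "integrable M (indicator ?B :: 'a \<Rightarrow> real)" using Bm by (simp add: integrable_real_indicator emeasure_eq_measure)
      show "integrable M (\<lambda>w. exp t * exp (- D (real n) w))" using i by simp
      show "indicator ?B w \<le> exp t * exp (- D (real n) w)" if "w \<in> space M" for w
        by (auto simp: indicator_def exp_add[symmetric])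
    qed
    also have "\<dots> = exp t * exp (- real n * ((1 + \<nu>) powr \<beta> - \<nu> powr \<beta>))"
      using laplace_transform[of 1 "real n"] by simp
    finally show ?thesis by (simp add: c_def[symmetric] mult.commute)
  qed
  have "(\<lambda>n. exp t * exp (- c * real n)) \<longlonglongrightarrow> exp t * 0"
  proof (intro tendsto_mult tendsto_const)
    have "(\<lambda>n. exp (- c) ^ n) \<longlonglongrightarrow> 0" using c by (intro LIMSEQ_power_zero) simp
    then show "(\<lambda>n. exp (- c * real n)) \<longlonglongrightarrow> 0" by (simp add: exp_of_nat_mult[symmetric] mult.commute)
  qed
  then have "prob ?B \<le> exp t * 0" by (rule LIMSEQ_le_const) (use le in blast)
  then have "prob ?B = 0" by (simp add: measure_le_0_iff)
  then have "AE w in M. w \<notin> ?B" using Bm by (intro AE_not_in) (simp add: null_sets_def emeasure_eq_measure)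
  with AE_space show ?thesis
    by eventually_elim (auto simp: not_le intro: of_nat_0_le_iff)
qed

lemma inverse_subordinator_nonneg: "0 \<le> inverse_subordinator D t w"
  unfolding inverse_subordinator_def by (auto intro!: cInf_greatest)

text \<open>That \<open>t\<close> is exceeded excludes the default value \<open>0\<close>, which would break monotonicity.\<close>

lemma inverse_subordinator_mono:
  assumes "\<exists>r\<ge>0. t < D r w" "s \<le> t"
  shows "inverse_subordinator D s w \<le> inverse_subordinator D t w"
proof -
  have ex: "\<exists>r\<ge>0. s < D r w" using assms by (meson le_less_trans)
  have "Inf {r. 0 \<le> r \<and> s < D r w} \<le> Inf {r. 0 \<le> r \<and> t < D r w}"
    using assms by (intro cInf_superset_mono) (auto simp: bdd_below_def)
  then show ?thesis using assms(1) ex by (simp add: inverse_subordinator_def)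
qed

section \<open>The time-changed intensity\<close>

text \<open>Only two values \<open>S \<le> U\<close> of the clock matter, with their joint independence of the Hawkes process;
  the subordinator itself is abstracted away.\<close>

locale time_changed_hawkes = hawkes_process +
  fixes S U :: "'a \<Rightarrow> real" and \<gamma> :: real
  assumes S_meas[measurable]: "S \<in> borel_measurable M" and U_meas[measurable]: "U \<in> borel_measurable M"
    and S_nonneg: "\<And>w. 0 \<le> S w" and U_nonneg: "\<And>w. 0 \<le> U w" and S_le_U: "AE w in M. S w \<le> U w"
    and clock_indep: "indep_set (sets (vimage_algebra (space M) (\<lambda>w. (S w, U w)) \<B>))
      (sets \<H>)"
    and \<gamma>: "\<gamma> = \<kappa> - \<eta> * \<mu>" and \<gamma>_pos: "0 < \<gamma>"
begin

text \<open>\<open>b\<close> is the stationary mean of the intensity and \<open>\<rho>\<close> the rate, per unit of intensity, at which jumps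
  produce variance.\<close>

definition b where "b = \<kappa> * \<theta> / \<gamma>"
definition \<rho> where "\<rho> = \<eta>\<^sup>2 * (\<psi>\<^sup>2 + \<mu>\<^sup>2)"
definition \<Phi>S where "\<Phi>S = expectation (\<lambda>w. exp (- \<gamma> * S w))"
definition \<Phi>U where "\<Phi>U = expectation (\<lambda>w. exp (- \<gamma> * U w))"
definition \<Phi>sum where "\<Phi>sum = expectation (\<lambda>w. exp (- \<gamma> * (U w + S w)))"
definition \<Phi>diff where "\<Phi>diff = expectation (\<lambda>w. exp (- \<gamma> * (U w - S w)))"

lemma exp_integrable:
  shows "integrable M (\<lambda>w. exp (- \<gamma> * S w))" "integrable M (\<lambda>w. exp (- \<gamma> * U w))"
    "integrable M (\<lambda>w. exp (- \<gamma> * (U w + S w)))" "integrable M (\<lambda>w. exp (- \<gamma> * (U w - S w)))"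
proof -
  have b: "integrable M (\<lambda>w. exp (- \<gamma> * X w))" if [measurable]: "X \<in> borel_measurable M" and "AE w in M. 0 \<le> X w" for X
  proof (rule integrable_const_bound[where B=1])
    show "AE w in M. norm (exp (- \<gamma> * X w)) \<le> 1"
      using that(2) by eventually_elim (use \<gamma>_pos in simp)
  qed measurable
  show "integrable M (\<lambda>w. exp (- \<gamma> * S w))" "integrable M (\<lambda>w. exp (- \<gamma> * U w))"
    "integrable M (\<lambda>w. exp (- \<gamma> * (U w + S w)))"
    by (rule b; measurable; use S_nonneg U_nonneg in \<open>auto intro!: AE_I2 add_nonneg_nonneg\<close>)+
  show "integrable M (\<lambda>w. exp (- \<gamma> * (U w - S w)))"
    by (rule b, measurable) (use S_le_U in eventually_elim, simp)
qed

lemma hawkes_sigma_sub: "subalgebra M \<H>"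
  using indep_setD_ev2[OF clock_indep] space_hawkes_sigma unfolding subalgebra_def by blast

lemma F0_measurable_hawkes_sigma: "f \<in> measurable (F 0) S' \<Longrightarrow> f \<in> measurable \<H> S'"
  using F0_hawkes_sigma space_hawkes_sigma space_F[OF order_refl] by (auto simp: measurable_def)

lemma order: "AE w in M. 0 \<le> fst (S w, U w) \<and> fst (S w, U w) \<le> snd (S w, U w)"
  using S_le_U by eventually_elim (simp add: S_nonneg)

lemma clock_measurable: "(\<lambda>w. (S w, U w)) \<in> measurable M \<B>"
  by measurable

lemmas time_change = time_change_expectation[OF clock_measurable hawkes_sigma_sub clock_indep order]

lemma lam_clock_joint:
  shows "(\<lambda>p. lam (max 0 (fst (fst p))) (snd p)) \<in> borel_measurable (\<B> \<Otimes>\<^sub>M \<H>)" (is "?S")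
    and "(\<lambda>p. lam (max 0 (snd (fst p))) (snd p)) \<in> borel_measurable (\<B> \<Otimes>\<^sub>M \<H>)" (is "?U")
proof -
  note l = lam_joint[OF space_hawkes_sigma lam_hawkes_sigma]
  have "(\<lambda>p. (fst (fst p), snd p)) \<in> measurable (\<B> \<Otimes>\<^sub>M \<H>) (borel \<Otimes>\<^sub>M \<H>)"
    by measurable
  from measurable_compose[OF this l] show ?S by simp
  have "(\<lambda>p. (snd (fst p), snd p)) \<in> measurable (\<B> \<Otimes>\<^sub>M \<H>) (borel \<Otimes>\<^sub>M \<H>)"
    by measurable
  from measurable_compose[OF this l] show ?U by simp
qed

lemma lam_clock_measurable:
  shows "(\<lambda>w. lam (S w) w) \<in> borel_measurable M" "(\<lambda>w. lam (U w) w) \<in> borel_measurable M"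
proof -
  have m: "(\<lambda>w. (X w, w)) \<in> measurable M (borel \<Otimes>\<^sub>M M)" if "X \<in> borel_measurable M" for X
    using that by measurable
  show "(\<lambda>w. lam (S w) w) \<in> borel_measurable M" "(\<lambda>w. lam (U w) w) \<in> borel_measurable M"
    using measurable_compose[OF m[OF S_meas] lam_jointM] measurable_compose[OF m[OF U_meas] lam_jointM]
    by (simp_all add: max_absorb2 S_nonneg U_nonneg)
qed

text \<open>The moments at deterministic times are linear combinations of exponentials; averaging over the clock
  replaces these by their expectations.\<close>

lemma clock_moments:
  assumes adm: "admissible G K"
    and e0: "e0 = expectation G" and l1: "l1 = expectation (\<lambda>w. G w * lam 0 w)"
    and l2: "l2 = expectation (\<lambda>w. G w * (lam 0 w)\<^sup>2)"
  shows "integrable M (\<lambda>w. G w * lam (S w) w)"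
    and "expectation (\<lambda>w. G w * lam (S w) w) = b * e0 + (l1 - b * e0) * \<Phi>S"
    and "integrable M (\<lambda>w. G w * lam (U w) w)"
    and "expectation (\<lambda>w. G w * lam (U w) w) = b * e0 + (l1 - b * e0) * \<Phi>U"
    and "integrable M (\<lambda>w. G w * (lam (S w) w * lam (U w) w))"
    and "expectation (\<lambda>w. G w * (lam (S w) w * lam (U w) w)) =
      b\<^sup>2 * e0 + b * (l1 - b * e0) * (\<Phi>S + \<Phi>U) + (l2 - 2 * b * l1 + b\<^sup>2 * e0) * \<Phi>sum
      + \<rho> * (b * e0 * (\<Phi>diff - \<Phi>sum) / (2 * \<gamma>) + (l1 - b * e0) * (\<Phi>U - \<Phi>sum) / \<gamma>)" (is "?joint")
proof -
  have \<gamma>0: "\<gamma> \<noteq> 0" using \<gamma>_pos by simp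
  have G0: "\<And>w. w \<in> space M \<Longrightarrow> 0 \<le> G w" using adm unfolding admissible_def by blast
  have [measurable]: "G \<in> borel_measurable \<H>"
    using adm F0_measurable_hawkes_sigma unfolding admissible_def by blast
  note [measurable] = lam_clock_joint
  note int = admissible_integrable[OF adm]
  define \<alpha> where "\<alpha> = l1 - b * e0"
  define \<alpha>2 where "\<alpha>2 = l2 - 2 * b * l1 + b\<^sup>2 * e0"
  note mom = second_moment_formula(1)[OF adm _ \<gamma> \<gamma>0 b_def \<rho>_def e0 \<alpha>_def[unfolded l1] \<alpha>2_def[unfolded l1 l2]]
  note joint = joint_moment_formula[OF adm _ _ \<gamma> \<gamma>0 b_def \<rho>_def e0 \<alpha>_def[unfolded l1] \<alpha>2_def[unfolded l1 l2]]
  note tc = time_change[where J="\<lambda>z. b * e0 + \<alpha> * exp (- \<gamma> * fst z)" and h="\<lambda>z w. G w * lam (max 0 (fst z)) w"]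
  have 1: "integrable M (\<lambda>w. G w * lam (max 0 (fst (S w, U w))) w)"
    by (rule tc(1); use G0 lam_nonneg int exp_integrable mom in \<open>auto simp: max_absorb2\<close>)
  have ex1: "expectation (\<lambda>w. G w * lam (max 0 (fst (S w, U w))) w) = expectation (\<lambda>w. b * e0 + \<alpha> * exp (- \<gamma> * fst (S w, U w)))"
    by (rule tc(2); use G0 lam_nonneg int exp_integrable mom in \<open>auto simp: max_absorb2\<close>)
  note tc = time_change[where J="\<lambda>z. b * e0 + \<alpha> * exp (- \<gamma> * snd z)" and h="\<lambda>z w. G w * lam (max 0 (snd z)) w"]
  have 2: "integrable M (\<lambda>w. G w * lam (max 0 (snd (S w, U w))) w)"
    by (rule tc(1); use G0 lam_nonneg int exp_integrable mom in \<open>auto simp: max_absorb2\<close>)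
  have ex2: "expectation (\<lambda>w. G w * lam (max 0 (snd (S w, U w))) w) = expectation (\<lambda>w. b * e0 + \<alpha> * exp (- \<gamma> * snd (S w, U w)))"
    by (rule tc(2); use G0 lam_nonneg int exp_integrable mom in \<open>auto simp: max_absorb2\<close>)
  define J where "J z = b\<^sup>2 * e0 + b * \<alpha> * (exp (- \<gamma> * fst z) + exp (- \<gamma> * snd z)) + \<alpha>2 * exp (- \<gamma> * (snd z + fst z))
      + \<rho> * (b * e0 * (exp (- \<gamma> * (snd z - fst z)) - exp (- \<gamma> * (snd z + fst z))) / (2 * \<gamma>)
        + \<alpha> * (exp (- \<gamma> * snd z) - exp (- \<gamma> * (snd z + fst z))) / \<gamma>)" for z :: "real \<times> real"
  have [measurable]: "J \<in> borel_measurable \<B>" unfolding J_def[abs_def] by measurable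
  have JZ: "integrable M (\<lambda>w. J (S w, U w))"
    unfolding J_def fst_conv snd_conv using exp_integrable by (intro Bochner_Integration.integrable_add integrable_mult_right
      integrable_divide Bochner_Integration.integrable_diff integrable_const)
  note tc = time_change[where J=J and h="\<lambda>z w. G w * (lam (max 0 (fst z)) w * lam (max 0 (snd z)) w)"]
  have 3: "integrable M (\<lambda>w. G w * (lam (max 0 (fst (S w, U w))) w * lam (max 0 (snd (S w, U w))) w))"
    by (rule tc(1); use G0 lam_nonneg int JZ joint in \<open>auto simp: max_absorb2 J_def\<close>)
  have ex3: "expectation (\<lambda>w. G w * (lam (max 0 (fst (S w, U w))) w * lam (max 0 (snd (S w, U w))) w)) = expectation (\<lambda>w. J (S w, U w))"
    by (rule tc(2); use G0 lam_nonneg int JZ joint in \<open>auto simp: max_absorb2 J_def\<close>)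
  show "integrable M (\<lambda>w. G w * lam (S w) w)" "integrable M (\<lambda>w. G w * lam (U w) w)"
    "integrable M (\<lambda>w. G w * (lam (S w) w * lam (U w) w))"
    using 1 2 3 by (simp_all add: max_absorb2 S_nonneg U_nonneg)
  show "expectation (\<lambda>w. G w * lam (S w) w) = b * e0 + (l1 - b * e0) * \<Phi>S"
    using ex1 exp_integrable by (simp add: max_absorb2 S_nonneg \<alpha>_def \<Phi>S_def prob_space)
  show "expectation (\<lambda>w. G w * lam (U w) w) = b * e0 + (l1 - b * e0) * \<Phi>U"
    using ex2 exp_integrable by (simp add: max_absorb2 U_nonneg \<alpha>_def \<Phi>U_def prob_space)
  have "expectation (\<lambda>w. J (S w, U w)) = b\<^sup>2 * e0 + b * \<alpha> * (\<Phi>S + \<Phi>U) + \<alpha>2 * \<Phi>sum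
      + \<rho> * (b * e0 * (\<Phi>diff - \<Phi>sum) / (2 * \<gamma>) + \<alpha> * (\<Phi>U - \<Phi>sum) / \<gamma>)"
    unfolding J_def fst_conv snd_conv \<Phi>S_def \<Phi>U_def \<Phi>sum_def \<Phi>diff_def
    using exp_integrable by (simp add: prob_space del: mult_minus_left)
  then show ?joint
    using ex3 by (simp add: max_absorb2 S_nonneg U_nonneg \<alpha>_def \<alpha>2_def)
qed

lemma sigma_finite_F0: "sigma_finite_subalgebra M (F 0)"
  by (rule sigma_finite_subalgebraI[OF F_sub[OF order_refl]])

text \<open>A function of the clock is independent of \<open>F\<^sub>0\<close>; this follows from the time change by taking for \<open>h\<close> a
  function of the clock times an indicator of an initial event.\<close>

lemma cond_exp_clock:
  fixes k :: "real \<times> real \<Rightarrow> real"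
  assumes k[measurable]: "k \<in> borel_measurable \<B>" and k0: "\<And>z. 0 \<le> k z"
    and int: "integrable M (\<lambda>w. k (S w, U w))"
  shows "AE w in M. real_cond_exp M (F 0) (\<lambda>w. k (S w, U w)) w = expectation (\<lambda>w. k (S w, U w))"
proof (rule sigma_finite_subalgebra.real_cond_exp_charact[OF sigma_finite_F0 _ int])
  fix B assume B: "B \<in> sets (F 0)"
  then have [measurable]: "B \<in> sets M" "B \<in> sets \<H>" using sets_F[OF order_refl] F0_hawkes_sigma by auto
  have "expectation (\<lambda>w. indicator B w * k (S w, U w)) = expectation (\<lambda>w. prob B * k (S w, U w))"
    by (rule time_change(2)[where J="\<lambda>z. prob B * k z" and h="\<lambda>z w. indicator B w * k z"])
      (use k0 int in \<open>auto simp: integrable_real_indicator emeasure_eq_measure\<close>)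
  also have "\<dots> = expectation (\<lambda>w. indicator B w * expectation (\<lambda>w. k (S w, U w)))"
    by simp
  finally show "(\<integral>w\<in>B. k (S w, U w) \<partial>M) = (\<integral>w\<in>B. expectation (\<lambda>w. k (S w, U w)) \<partial>M)"
    unfolding set_lebesgue_integral_def by simp
qed auto

abbreviation low_initial :: "nat \<Rightarrow> 'a set" where
  "low_initial k \<equiv> {w\<in>space M. lam 0 w \<le> real k}"

lemma low_initial_sets: "low_initial k \<in> sets (F 0)"
proof -
  note [measurable] = lam_adapted[OF order_refl]
  have "{w\<in>space (F 0). lam 0 w \<le> real k} \<in> sets (F 0)" by measurable
  then show ?thesis by (simp add: space_F)
qed

lemma low_initial_cover: "(\<Union>k::nat. low_initial k) = space M"
  using real_arch_simple by auto

lemma indicator_admissible: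
  assumes "B \<in> sets (F 0)" "B \<subseteq> low_initial k"
  shows "admissible (indicator B) (max 1 (real k))"
  using assms unfolding admissible_def by (auto simp: indicator_def le_max_iff_disj)

text \<open>Indicators of initial events on which \<open>lam\<^sub>0\<close> is bounded are admissible weights, so weighted moments
  that are affine in \<open>lam\<^sub>0\<close> determine the conditional mean.\<close>

lemma cond_mean:
  assumes L[measurable]: "L \<in> borel_measurable M"
    and int: "\<And>G K. admissible G K \<Longrightarrow> integrable M (\<lambda>w. G w * L w)"
    and ex: "\<And>G K. admissible G K \<Longrightarrow> expectation (\<lambda>w. G w * L w) =
      b * expectation G + (expectation (\<lambda>w. G w * lam 0 w) - b * expectation G) * \<Phi>"
  shows "AE w in M. real_cond_exp M (F 0) L w = b + (lam 0 w - b) * \<Phi>"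
proof (rule sigma_finite_subalgebra.real_cond_exp_charact_local[OF sigma_finite_F0, where A=low_initial])
  fix k B assume B: "B \<in> sets (F 0)" "B \<subseteq> low_initial k"
  note adm = indicator_admissible[OF B]
  note i = admissible_integrable[OF adm]
  have e: "indicator B w * (b + (lam 0 w - b) * \<Phi>) = (b - b * \<Phi>) * indicator B w + \<Phi> * (indicator B w * lam 0 w)" for w :: 'a
    by (simp add: algebra_simps)
  show "integrable M (\<lambda>w. indicator B w * L w)" by (rule int[OF adm])
  show "integrable M (\<lambda>w. indicator B w * (b + (lam 0 w - b) * \<Phi>))"
    unfolding e using i by (intro Bochner_Integration.integrable_add integrable_mult_right) auto
  have "expectation (\<lambda>w. indicator B w * (b + (lam 0 w - b) * \<Phi>)) =
      (b - b * \<Phi>) * expectation (indicator B) + \<Phi> * expectation (\<lambda>w. indicator B w * lam 0 w)"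
    unfolding e using i(1) i(4)[of 0] by (subst Bochner_Integration.integral_add) auto
  then show "expectation (\<lambda>w. indicator B w * L w) = expectation (\<lambda>w. indicator B w * (b + (lam 0 w - b) * \<Phi>))"
    unfolding ex[OF adm] by (simp add: algebra_simps)
qed (use low_initial_sets low_initial_cover lam_adapted[OF order_refl] in \<open>auto simp: L\<close>)

text \<open>After inserting the conditional means, the product of the centred values expands into the mixed
  moment and moments weighted by \<open>1\<close>, \<open>lam\<^sub>0\<close> and \<open>lam\<^sub>0\<^sup>2\<close>, all of which are known.\<close>

lemma cond_cov_formula:
  "AE w in M. cond_cov M (F 0) (\<lambda>w. lam (U w) w) (\<lambda>w. lam (S w) w) w =
    \<rho> * (b * (\<Phi>diff - \<Phi>sum) / (2 * \<gamma>) + (lam 0 w - b) * (\<Phi>U - \<Phi>sum) / \<gamma>)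
    + (lam 0 w - b)\<^sup>2 * (\<Phi>sum - \<Phi>U * \<Phi>S)"
proof -
  interpret C: sigma_finite_subalgebra M "F 0" by (rule sigma_finite_F0)
  let ?LS = "\<lambda>w. lam (S w) w" and ?LU = "\<lambda>w. lam (U w) w"
  let ?f = "\<lambda>w. (?LU w - (b + (lam 0 w - b) * \<Phi>U)) * (?LS w - (b + (lam 0 w - b) * \<Phi>S))"
  let ?g = "\<lambda>w. \<rho> * (b * (\<Phi>diff - \<Phi>sum) / (2 * \<gamma>) + (lam 0 w - b) * (\<Phi>U - \<Phi>sum) / \<gamma>)
    + (lam 0 w - b)\<^sup>2 * (\<Phi>sum - \<Phi>U * \<Phi>S)"
  note [measurable] = lam_clock_measurable lam_measurable[OF order_refl]
  have mS: "AE w in M. real_cond_exp M (F 0) ?LS w = b + (lam 0 w - b) * \<Phi>S"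
    by (rule cond_mean) (use clock_moments(1,2)[OF _ refl refl refl] in auto)
  have mU: "AE w in M. real_cond_exp M (F 0) ?LU w = b + (lam 0 w - b) * \<Phi>U"
    by (rule cond_mean) (use clock_moments(3,4)[OF _ refl refl refl] in auto)
  have "AE w in M. cond_cov M (F 0) ?LU ?LS w = real_cond_exp M (F 0) ?f w"
    unfolding cond_cov_def
  proof (rule C.real_cond_exp_cong)
    show "AE w in M. (?LU w - real_cond_exp M (F 0) ?LU w) * (?LS w - real_cond_exp M (F 0) ?LS w) = ?f w"
      using mS mU by eventually_elim simp
  qed measurable
  moreover have "AE w in M. real_cond_exp M (F 0) ?f w = ?g w"
  proof (rule C.real_cond_exp_charact_local[where A=low_initial])
    fix k B assume B: "B \<in> sets (F 0)" "B \<subseteq> low_initial k"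
    let ?G = "indicator B :: 'a \<Rightarrow> real"
    note adm = indicator_admissible[OF B]
    note adm' = admissible_times_initial[OF adm]
    define e0 where "e0 = expectation ?G"
    define l1 where "l1 = expectation (\<lambda>w. ?G w * lam 0 w)"
    define l2 where "l2 = expectation (\<lambda>w. ?G w * (lam 0 w)\<^sup>2)"
    note m = clock_moments[OF adm e0_def l1_def l2_def]
    have l2': "l2 = expectation (\<lambda>w. ?G w * lam 0 w * lam 0 w)"
      unfolding l2_def by (simp add: power2_eq_square mult.assoc)
    note m' = clock_moments(1-4)[OF adm' l1_def l2' refl]
    note i = admissible_integrable(1)[OF adm] admissible_integrable(3)[OF adm order_refl] admissible_integrable(4)[OF adm order_refl]
    have fe: "?G w * ?f w = ?G w * (?LS w * ?LU w) - (b - b * \<Phi>S) * (?G w * ?LU w) - \<Phi>S * (?G w * lam 0 w * ?LU w)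
        - (b - b * \<Phi>U) * (?G w * ?LS w) - \<Phi>U * (?G w * lam 0 w * ?LS w)
        + (b - b * \<Phi>S) * (b - b * \<Phi>U) * ?G w + ((b - b * \<Phi>S) * \<Phi>U + (b - b * \<Phi>U) * \<Phi>S) * (?G w * lam 0 w)
        + \<Phi>S * \<Phi>U * (?G w * (lam 0 w)\<^sup>2)" for w
      by (simp add: power2_eq_square algebra_simps)
    \<comment> \<open>the claimed covariance as a polynomial in \<open>lam\<^sub>0\<close> with constant term \<open>?c0\<close> and linear coefficient \<open>?c1\<close>\<close>
    let ?c0 = "\<rho> * (b * (\<Phi>diff - \<Phi>sum) / (2 * \<gamma>) - b * (\<Phi>U - \<Phi>sum) / \<gamma>) + b\<^sup>2 * (\<Phi>sum - \<Phi>U * \<Phi>S)"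
    let ?c1 = "\<rho> * (\<Phi>U - \<Phi>sum) / \<gamma> - 2 * b * (\<Phi>sum - \<Phi>U * \<Phi>S)"
    have ge: "?G w * ?g w = ?c0 * ?G w + ?c1 * (?G w * lam 0 w) + (\<Phi>sum - \<Phi>U * \<Phi>S) * (?G w * (lam 0 w)\<^sup>2)" for w
      using \<gamma>_pos by (simp add: power2_eq_square field_simps)
    show "integrable M (\<lambda>w. ?G w * ?f w)"
      unfolding fe using m m' i by (intro Bochner_Integration.integrable_add Bochner_Integration.integrable_diff integrable_mult_right) auto
    show "integrable M (\<lambda>w. ?G w * ?g w)"
      unfolding ge using i by (intro Bochner_Integration.integrable_add integrable_mult_right) auto
    have "expectation (\<lambda>w. ?G w * ?f w) =
      (b\<^sup>2 * e0 + b * (l1 - b * e0) * (\<Phi>S + \<Phi>U) + (l2 - 2 * b * l1 + b\<^sup>2 * e0) * \<Phi>sum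
      + \<rho> * (b * e0 * (\<Phi>diff - \<Phi>sum) / (2 * \<gamma>) + (l1 - b * e0) * (\<Phi>U - \<Phi>sum) / \<gamma>))
      - (b - b * \<Phi>S) * (b * e0 + (l1 - b * e0) * \<Phi>U) - \<Phi>S * (b * l1 + (l2 - b * l1) * \<Phi>U)
      - (b - b * \<Phi>U) * (b * e0 + (l1 - b * e0) * \<Phi>S) - \<Phi>U * (b * l1 + (l2 - b * l1) * \<Phi>S)
      + (b - b * \<Phi>S) * (b - b * \<Phi>U) * e0 + ((b - b * \<Phi>S) * \<Phi>U + (b - b * \<Phi>U) * \<Phi>S) * l1
      + \<Phi>S * \<Phi>U * l2"
      unfolding fe m(2,4,6)[symmetric] m'(2,4)[symmetric] unfolding e0_def l1_def l2_def
      using m(1,3,5) m'(1,3) i by simp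
    also have "\<dots> = ?c0 * e0 + ?c1 * l1 + (\<Phi>sum - \<Phi>U * \<Phi>S) * l2"
      using \<gamma>_pos by (simp add: power2_eq_square field_simps)
    also have "\<dots> = expectation (\<lambda>w. ?G w * ?g w)"
      unfolding ge unfolding e0_def l1_def l2_def using i
      by (simp add: Bochner_Integration.integral_add del: mult_minus_left)
    finally show "expectation (\<lambda>w. ?G w * ?f w) = expectation (\<lambda>w. ?G w * ?g w)" .
  next
    note [measurable] = lam_adapted[OF order_refl]
    show "?g \<in> borel_measurable (F 0)" by measurable
    show "?f \<in> borel_measurable M" by measurable
  qed (use low_initial_sets low_initial_cover in auto)
  ultimately show ?thesis by eventually_elim simp
qed

end

theorem theorem4:
  fixes M :: "'a measure" and F :: "real \<Rightarrow> 'a measure"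
    and N :: "real \<Rightarrow> 'a \<Rightarrow> nat" and lam :: "real \<Rightarrow> 'a \<Rightarrow> real"
    and xi :: "nat \<Rightarrow> 'a \<Rightarrow> real" and D E :: "real \<Rightarrow> 'a \<Rightarrow> real"
    and \<Phi> :: "real \<Rightarrow> real"
    and \<beta> \<nu> \<theta> \<eta> \<kappa> \<mu> \<psi> \<gamma> \<rho>1 \<rho>2 s t :: real
  assumes hawkes: "hawkes_process M F N lam xi \<theta> \<eta> \<kappa> \<mu> \<psi>"
    and tempered: "tempered_stable_subordinator M D \<beta> \<nu>"
    and E: "E = inverse_subordinator D"
    and indep: "prob_space.indep_set M
      (sets (process_sigma M E borel)) (sets (hawkes_sigma M F N lam))"
    and gamma: "\<gamma> = \<kappa> - \<eta> * \<mu>" "0 < \<gamma>"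
    and Phi: "\<Phi> = laplace_of M E \<gamma>"
    and rho1: "\<rho>1 = \<eta>\<^sup>2 * (\<psi>\<^sup>2 + \<mu>\<^sup>2)"
    and rho2: "\<rho>2 = \<eta>\<^sup>2 * \<kappa> * \<theta> * (\<psi>\<^sup>2 + \<mu>\<^sup>2) / (\<eta> * \<mu> - \<kappa>)"
    and times: "0 \<le> s" "s \<le> t"
  shows "AE \<omega> in M.
    cond_cov M (F 0) (\<lambda>\<omega>. lam (E t \<omega>) \<omega>) (\<lambda>\<omega>. lam (E s \<omega>) \<omega>) \<omega> =
      (\<rho>1 * lam 0 \<omega> + \<rho>2) / (\<eta> * \<mu> - \<kappa>)
        * (real_cond_exp M (F 0) (\<lambda>\<omega>. exp (- \<gamma> * (E t \<omega> + E s \<omega>))) \<omega> - \<Phi> t)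
      + \<rho>2 / (2 * (\<eta> * \<mu> - \<kappa>))
        * (real_cond_exp M (F 0) (\<lambda>\<omega>. exp (- \<gamma> * (E t \<omega> - E s \<omega>))) \<omega>
           - real_cond_exp M (F 0) (\<lambda>\<omega>. exp (- \<gamma> * (E t \<omega> + E s \<omega>))) \<omega>)
      + (lam 0 \<omega> + \<kappa> * \<theta> / (\<eta> * \<mu> - \<kappa>))\<^sup>2
        * (real_cond_exp M (F 0) (\<lambda>\<omega>. exp (- \<gamma> * (E t \<omega> + E s \<omega>))) \<omega> - \<Phi> t * \<Phi> s)"
proof -
  interpret hawkes_process M F N lam xi \<theta> \<eta> \<kappa> \<mu> \<psi> by (rule hawkes)
  interpret D: tempered_stable_subordinator M D \<beta> \<nu> by (rule tempered)
  have t0: "0 \<le> t" using times by simp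
  have sub: "sets (process_sigma M E borel) \<subseteq> sets M" by (rule indep_setD_ev1[OF indep])
  have E_proc: "E r \<in> borel_measurable (process_sigma M E borel)" if "0 \<le> r" for r
    by (rule process_sigma_measurable(1)[OF that]) auto
  have sp: "space (process_sigma M E borel) = space M"
    by (rule process_sigma_measurable(2)[of 0]) auto
  have E_meas: "E r \<in> borel_measurable M" if "0 \<le> r" for r
    using E_proc[OF that] sub sp unfolding measurable_def by auto
  have clock: "time_changed_hawkes M F N lam xi \<theta> \<eta> \<kappa> \<mu> \<psi> (E s) (E t) \<gamma>"
  proof (intro time_changed_hawkes.intro[OF hawkes] time_changed_hawkes_axioms.intro)
    show "E s \<in> borel_measurable M" "E t \<in> borel_measurable M" using E_meas times t0 by auto
    show "0 \<le> E s w" "0 \<le> E t w" for w unfolding E by (rule inverse_subordinator_nonneg)+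
    show "AE w in M. E s w \<le> E t w"
      using D.unbounded_AE[of t] unfolding E by eventually_elim (rule inverse_subordinator_mono[OF _ times(2)])
    have "(\<lambda>w. (E s w, E t w)) \<in> measurable (process_sigma M E borel) (borel \<Otimes>\<^sub>M borel)"
      using E_proc[OF times(1)] E_proc[OF t0] by measurable
    from sets_vimage_algebra_mono[OF this sp]
    show "indep_set (sets (vimage_algebra (space M) (\<lambda>w. (E s w, E t w)) (borel \<Otimes>\<^sub>M borel)))
      (sets (hawkes_sigma M F N lam))"
      by (rule indep_set_mono[OF indep _ order_refl])
  qed (use gamma in auto)
  interpret C: time_changed_hawkes M F N lam xi \<theta> \<eta> \<kappa> \<mu> \<psi> "E s" "E t" \<gamma> by (rule clock)
  have sum: "AE w in M. real_cond_exp M (F 0) (\<lambda>w. exp (- \<gamma> * (E t w + E s w))) w = C.\<Phi>sum"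
    using C.cond_exp_clock[of "\<lambda>z. exp (- \<gamma> * (snd z + fst z))"] C.exp_integrable(3)
    unfolding C.\<Phi>sum_def by simp
  have diff: "AE w in M. real_cond_exp M (F 0) (\<lambda>w. exp (- \<gamma> * (E t w - E s w))) w = C.\<Phi>diff"
    using C.cond_exp_clock[of "\<lambda>z. exp (- \<gamma> * (snd z - fst z))"] C.exp_integrable(4)
    unfolding C.\<Phi>diff_def by simp
  have \<Phi>: "\<Phi> t = C.\<Phi>U" "\<Phi> s = C.\<Phi>S"
    unfolding Phi laplace_of_def C.\<Phi>U_def C.\<Phi>S_def by simp_all
  have g: "\<eta> * \<mu> - \<kappa> = - \<gamma>" and g0: "\<gamma> \<noteq> 0" using gamma by auto
  have r1: "\<rho>1 = C.\<rho>" unfolding rho1 C.\<rho>_def ..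
  have r2: "\<rho>2 = - C.\<rho> * C.b" unfolding rho2 g C.\<rho>_def C.b_def by simp
  have kb: "\<kappa> * \<theta> / (- \<gamma>) = - C.b" unfolding C.b_def by simp
  show ?thesis
    using C.cond_cov_formula sum diff
  proof eventually_elim
    case (elim w)
    show ?case
      unfolding elim \<Phi> g kb r1 r2 using g0 by (simp add: field_simps)
  qed
qed

end
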